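(* There exist constants $C>0$ and $N_0$ such that for every integer $N\ge N_0$ and every integer $0\le u<N$, there exist $\ell\le C\log_2 N$ and $a_1,\ldots,a_\ell\in\{1,2\}$ such that the rational number $[a_1,1,a_2,1,\ldots,a_\ell,1]$, computed over $\mathbb{Q}$ and written as $p/q$ with $q$ coprime to $N$, satisfies $p\,q^{-1}\equiv u \pmod N$; that is, $u\equiv [a_1,1,\ldots,a_\ell,1]\pmod N$.
   Context: For integers $b_1,\ldots,b_m\ge 1$ ($m\ge 0$), the continued fraction $[b_1,\ldots,b_m]$ is defined as $\cfrac{1}{b_1+\cfrac{1}{\ddots+\frac{1}{b_m}}}$. The paper specifies that the continued fraction is first evaluated as a rational number and only then reduced modulo $N$. *)

theory Defs
  imports Complex_Main "HOL-Number_Theory.Number_Theory"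
begin

text \<open>The empty continued fraction (the case \<open>m = 0\<close>) has value \<open>0\<close>. The definition is meant
  for entries that are \<open>\<ge> 1\<close>, so that no denominator vanishes.\<close>
fun cfrac :: "int list \<Rightarrow> rat" where
  "cfrac [] = 0"
| "cfrac (b # bs) = 1 / (of_int b + cfrac bs)"

definition interleave_ones :: "int list \<Rightarrow> int list" where
  "interleave_ones as = concat (map (\<lambda>a. [a, 1]) as)"

text \<open>The congruence \<open>r \<equiv> u (mod N)\<close> of a rational number \<open>r\<close> and an integer \<open>u\<close>. It requires in
  particular that \<open>r\<close> can be written with a denominator coprime to \<open>N\<close>; the fraction \<open>p/q\<close> need not
  be reduced, since the residue of \<open>p q\<^sup>-\<^sup>1\<close> does not depend on its choice.\<close>
definition rat_cong :: "rat \<Rightarrow> int \<Rightarrow> int \<Rightarrow> bool" where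
  "rat_cong r u N \<longleftrightarrow>
     (\<exists>p q :: int. q \<noteq> 0 \<and> coprime q N \<and> r = of_int p / of_int q \<and>
        [p * modular_inverse N q = u] (mod N))"

end

theory Submission
  imports Defs "HOL-Analysis.Analysis" "HOL-Real_Asymp.Real_Asymp"
begin

text \<open>Prepending \<open>a, 1\<close> to a continued fraction acts on \<open>(p, q)\<close> by the matrix with rows
  \<open>(1, 1)\<close> and \<open>(a, a + 1)\<close>. If the averaging operator of the two matrices for \<open>a = 1, 2\<close> contracts
  the mean-zero functions on the projective line over \<open>\<int>/N\<close> by a factor independent of \<open>N\<close>, then
  after \<open>O(log N)\<close> steps every class is reached. By the parallelogram law, a function that is not
  contracted in two steps is almost invariant under both elementary matrices, hence under any fixed
  finite subset of \<open>SL\<^sub>2(\<int>)\<close>. So it suffices to bound, uniformly in \<open>N\<close>, the norm of the averaging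
  operator \<open>T\<close> over a symmetric set \<open>W\<close> consisting of the generators and of all matrices with entries of
  size about \<open>m\<close>, where \<open>m\<close> is a large constant.

  This is the trace method of Sarnak and Xue. An eigenvalue of \<open>T\<^sup>2\<close> on mean-zero functions also occurs
  on the functions of some level \<open>e\<close> dividing \<open>N\<close> that are orthogonal to all lower levels. For such a
  function \<open>f\<close> the matrix coefficients \<open>\<langle>f, g f\<rangle>\<close> have mean square about \<open>1/e\<close> over \<open>GL\<^sub>2(\<int>/e)\<close>, so by the
  Cauchy-Schwarz inequality the eigenvalue is controlled by the probability that a long word in \<open>W\<close>
  is scalar modulo \<open>e\<close>. The number of words of length \<open>n\<close> with product \<open>g\<close> is at most \<open>K\<^sup>n / \<bar>g\<bar>\<close> with
  \<open>K = O(m log m)\<close>, because \<open>1 / \<bar>g\<bar>\<close> is nearly an eigenfunction of the walk, while \<open>W\<close> has at least of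
  the order of \<open>m\<^sup>2\<close> elements. The sum of \<open>1 / \<bar>g\<bar>\<close> over the \<open>g\<close> that are scalar modulo \<open>e\<close> is small by the
  divisor bound.\<close>

section \<open>Integer matrices acting on vectors modulo \<open>N\<close>\<close>

text \<open>The constant \<open>m\<close> is large for the following reason. A letter of
  \<open>steps m\<close> can enlarge the norm of a word by a factor \<open>64 * m\<close>, while the
  ratio of \<open>stepK m\<close> to the number of steps is about \<open>log m / m\<close>. Hence,
  if \<open>R\<close> bounds the norm of the words, the words with a given product are rarer than
  average by nearly a factor \<open>R\<close>; the proof secures \<open>R\<close> to the power 9/10.
  At \<open>R\<close> about \<open>N^3\<close> this saves \<open>N\<close> to the power 27/10, which
  has to beat \<open>N^2\<close> from the Cauchy-Schwarz step and a power 1/2 that collects all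
  divisor bounds. Any exponent above 5/6 would win, and a large \<open>m\<close> provides it. The
  trace bound works only for large levels. The finitely many small ones are settled without
  uniformity: \<open>SL2\<close> is transitive on primitive vectors, so a nonzero mean-zero function
  is never invariant and its eigenvalue stays below the trivial one. The squared operator is used
  because its largest eigenvalue is the maximum of a Rayleigh quotient, so that no negative
  eigenvalue has to be treated apart.\<close>

lemmas cong_unfold = unique_euclidean_semiring_class.cong_def

type_synonym vec2 = "int \<times> int"

datatype mat2 = Mat (m11: int) (m12: int) (m21: int) (m22: int)

instantiation mat2 :: monoid_mult
begin

definition one_mat2 :: mat2 where
  "1 = Mat 1 0 0 1"

definition times_mat2 :: "mat2 \<Rightarrow> mat2 \<Rightarrow> mat2" where
  "g * h = Mat (m11 g * m11 h + m12 g * m21 h) (m11 g * m12 h + m12 g * m22 h)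
               (m21 g * m11 h + m22 g * m21 h) (m21 g * m12 h + m22 g * m22 h)"

instance
  by standard (auto simp: one_mat2_def times_mat2_def algebra_simps mat2.expand)

end

lemma mat2_sel_times [simp]:
  "m11 (g * h) = m11 g * m11 h + m12 g * m21 h"
  "m12 (g * h) = m11 g * m12 h + m12 g * m22 h"
  "m21 (g * h) = m21 g * m11 h + m22 g * m21 h"
  "m22 (g * h) = m21 g * m12 h + m22 g * m22 h"
  by (simp_all add: times_mat2_def)

lemma mat2_sel_one [simp]: "m11 1 = 1" "m12 1 = 0" "m21 1 = 0" "m22 1 = 1"
  by (simp_all add: one_mat2_def)

definition det2 :: "mat2 \<Rightarrow> int" where
  "det2 g = m11 g * m22 g - m12 g * m21 g"

definition adj2 :: "mat2 \<Rightarrow> mat2" where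
  "adj2 g = Mat (m22 g) (- m12 g) (- m21 g) (m11 g)"

definition act :: "mat2 \<Rightarrow> vec2 \<Rightarrow> vec2" where
  "act g v = (m11 g * fst v + m12 g * snd v, m21 g * fst v + m22 g * snd v)"

definition cross :: "vec2 \<Rightarrow> vec2 \<Rightarrow> int" where
  "cross v w = fst v * snd w - snd v * fst w"

definition SL2 :: "mat2 set" where
  "SL2 = {g. det2 g = 1}"

lemma det2_Mat [simp]: "det2 (Mat a b c d) = a * d - b * c"
  by (simp add: det2_def)

lemma det2_times [simp]: "det2 (g * h) = det2 g * det2 h"
  by (simp add: det2_def algebra_simps)

lemma det2_one [simp]: "det2 1 = 1"
  by (simp add: det2_def)

lemma det2_adj2 [simp]: "det2 (adj2 g) = det2 g"
  by (simp add: det2_def adj2_def algebra_simps)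

lemma adj2_adj2 [simp]: "adj2 (adj2 g) = g"
  by (simp add: adj2_def mat2.expand)

lemma adj2_times: "adj2 (g * h) = adj2 h * adj2 g"
  by (simp add: adj2_def mat2.expand algebra_simps)

lemma adj2_one [simp]: "adj2 1 = 1"
  by (simp add: adj2_def one_mat2_def)

lemma adj2_mult_self:
  assumes "det2 g = 1"
  shows "adj2 g * g = 1" "g * adj2 g = 1"
  using assms by (auto simp: adj2_def det2_def mat2.expand algebra_simps)

lemma act_times [simp]: "act (g * h) v = act g (act h v)"
  by (simp add: act_def algebra_simps)

lemma act_one [simp]: "act 1 v = v"
  by (simp add: act_def)

lemma act_adj2: "act (adj2 g) (act g v) = (det2 g * fst v, det2 g * snd v)"
  by (simp add: act_def adj2_def det2_def algebra_simps)

lemma act_adj2_SL2: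
  assumes "det2 g = 1"
  shows "act (adj2 g) (act g v) = v" "act g (act (adj2 g) v) = v"
  using act_adj2[of g v] act_adj2[of "adj2 g" v] assms by simp_all

lemma cross_act: "cross (act g v) (act g w) = det2 g * cross v w"
  by (simp add: cross_def act_def det2_def algebra_simps)

lemma cross_self [simp]: "cross v v = 0"
  by (simp add: cross_def)

lemma cross_swap: "cross w v = - cross v w"
  by (simp add: cross_def)

lemma SL2_one [simp]: "1 \<in> SL2"
  by (simp add: SL2_def)

lemma SL2_times: "g \<in> SL2 \<Longrightarrow> h \<in> SL2 \<Longrightarrow> g * h \<in> SL2"
  by (simp add: SL2_def)

lemma SL2_adj2: "g \<in> SL2 \<Longrightarrow> adj2 g \<in> SL2"
  by (simp add: SL2_def)

lemma SL2_prod_list: "set gs \<subseteq> SL2 \<Longrightarrow> prod_list gs \<in> SL2"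
  by (induction gs) (auto simp: SL2_times)

lemma prod_list_rev_adj2: "prod_list (rev (map adj2 gs)) = adj2 (prod_list gs)"
  by (induction gs) (auto simp: adj2_times)

definition matL :: mat2 where "matL = Mat 1 0 1 1"
definition matU :: mat2 where "matU = Mat 1 1 0 1"

section \<open>Primitive vectors modulo N and transitivity\<close>

definition prim :: "int \<Rightarrow> vec2 \<Rightarrow> bool" where
  "prim N v \<longleftrightarrow> coprime (gcd (fst v) (snd v)) N"

definition vmod :: "int \<Rightarrow> vec2 \<Rightarrow> vec2" where
  "vmod N v = (fst v mod N, snd v mod N)"

definition pvec :: "int \<Rightarrow> vec2 set" where
  "pvec N = {v \<in> {0..<N} \<times> {0..<N}. prim N v}"

lemma finite_pvec [simp]: "finite (pvec N)"
  unfolding pvec_def by (rule finite_subset[of _ "{0..<N} \<times> {0..<N}"]) auto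

lemma primI:
  assumes "\<And>d. d dvd fst v \<Longrightarrow> d dvd snd v \<Longrightarrow> d dvd N \<Longrightarrow> is_unit d"
  shows "prim N v"
  unfolding prim_def by (rule coprimeI) (use assms in auto)

lemma primD: "prim N v \<Longrightarrow> d dvd fst v \<Longrightarrow> d dvd snd v \<Longrightarrow> d dvd N \<Longrightarrow> is_unit d"
  unfolding prim_def by (meson coprime_common_divisor gcd_greatest)

lemma prim_dvd: "prim N v \<Longrightarrow> e dvd N \<Longrightarrow> prim e v"
  by (meson dvd_trans primD primI)

lemma prim_cong:
  assumes "[fst v = fst w] (mod N)" "[snd v = snd w] (mod N)"
  shows "prim N v \<longleftrightarrow> prim N w"
proof -
  have "prim N w" if "prim N v" "[fst v = fst w] (mod N)" "[snd v = snd w] (mod N)" for v w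
  proof (rule primI)
    fix d assume "d dvd fst w" "d dvd snd w" "d dvd N"
    then show "is_unit d"
      using that cong_dvd_iff[of "fst v" "fst w" d] cong_dvd_iff[of "snd v" "snd w" d]
        cong_dvd_modulus[of "fst v" "fst w" N d] cong_dvd_modulus[of "snd v" "snd w" N d]
      by (intro primD[of N v d]) auto
  qed
  then show ?thesis using assms cong_sym by blast
qed

lemma prim_vmod [simp]: "prim N (vmod N v) \<longleftrightarrow> prim N v"
  by (rule prim_cong) (auto simp: vmod_def)

lemma prim_act:
  assumes "prim N v" "coprime (det2 g) N"
  shows "prim N (act g v)"
proof (rule primI)
  fix d assume d: "d dvd fst (act g v)" "d dvd snd (act g v)" "d dvd N"
  have "d dvd fst (act (adj2 g) (act g v))" "d dvd snd (act (adj2 g) (act g v))"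
    using d by (auto simp: act_def[of "adj2 g"])
  then have "d dvd det2 g * fst v" "d dvd det2 g * snd v"
    by (auto simp: act_adj2)
  moreover have "coprime d (det2 g)"
    using assms(2) d(3) coprime_divisors[of "det2 g" "det2 g" d N] by (simp add: coprime_commute)
  ultimately have "d dvd fst v" "d dvd snd v"
    using coprime_dvd_mult_right_iff by blast+
  then show "is_unit d"
    using assms(1) d(3) primD by blast
qed

lemma prim_act_iff:
  assumes "coprime (det2 g) N"
  shows "prim N (act g v) \<longleftrightarrow> prim N v"
proof
  assume "prim N (act g v)"
  then have p: "prim N (act (adj2 g) (act g v))"
    using assms by (simp add: prim_act)
  show "prim N v"
  proof (rule primI)
    fix d assume "d dvd fst v" "d dvd snd v" "d dvd N"
    then show "is_unit d"
      using p primD[of N _ d] by (fastforce simp: act_adj2)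
  qed
qed (use assms prim_act in auto)

lemma vmod_vmod [simp]: "vmod N (vmod N v) = vmod N v"
  by (simp add: vmod_def)

lemma vmod_act_vmod: "vmod N (act g (vmod N v)) = vmod N (act g v)"
  by (auto simp: vmod_def act_def intro!: cong_unfold[THEN iffD1] cong_add cong_mult cong_mod_left cong_refl)

lemma vmod_in_pvec: "N > 0 \<Longrightarrow> prim N v \<Longrightarrow> vmod N v \<in> pvec N"
  unfolding pvec_def using prim_vmod[of N v] by (auto simp: vmod_def)

lemma pvec_vmod: "v \<in> pvec N \<Longrightarrow> vmod N v = v"
  by (auto simp: pvec_def vmod_def)

text \<open>The adjugate is a left inverse up to \<open>det2 g\<close>, a unit modulo
  \<open>N\<close>; injectivity on a finite set gives surjectivity.\<close>

lemma bij_betw_act_pvec: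
  assumes "N > 0" "coprime (det2 g) N"
  shows "bij_betw (\<lambda>v. vmod N (act g v)) (pvec N) (pvec N)"
proof -
  have "inj_on (\<lambda>v. vmod N (act g v)) (pvec N)"
  proof (rule inj_onI)
    fix v w assume vw: "v \<in> pvec N" "w \<in> pvec N" and eq: "vmod N (act g v) = vmod N (act g w)"
    have "vmod N (act (adj2 g) (act g v)) = vmod N (act (adj2 g) (act g w))"
      by (metis eq vmod_act_vmod)
    then have "[det2 g * fst v = det2 g * fst w] (mod N)" "[det2 g * snd v = det2 g * snd w] (mod N)"
      by (simp_all add: act_adj2 vmod_def cong_unfold)
    then have "[fst v = fst w] (mod N)" "[snd v = snd w] (mod N)"
      using assms by (simp_all add: cong_mult_lcancel)
    then have "vmod N v = vmod N w"
      by (simp add: vmod_def cong_unfold)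
    with vw show "v = w"
      by (metis pvec_vmod)
  qed
  moreover have "(\<lambda>v. vmod N (act g v)) ` pvec N \<subseteq> pvec N"
  proof (rule image_subsetI)
    fix v assume "v \<in> pvec N"
    then have "prim N (act g v)"
      using assms prim_act by (auto simp: pvec_def)
    with assms show "vmod N (act g v) \<in> pvec N"
      by (metis vmod_in_pvec)
  qed
  ultimately show ?thesis
    by (simp add: bij_betw_def endo_inj_surj)
qed

lemma sum_pvec_act:
  fixes f :: "vec2 \<Rightarrow> 'a::comm_monoid_add"
  assumes "N > 0" "coprime (det2 g) N" "\<And>v. f (vmod N v) = f v"
  shows "(\<Sum>v\<in>pvec N. f (act g v)) = (\<Sum>v\<in>pvec N. f v)"
proof -
  have "(\<Sum>v\<in>pvec N. f (vmod N (act g v))) = (\<Sum>v\<in>pvec N. f v)"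
    by (rule sum.reindex_bij_betw[OF bij_betw_act_pvec]) (use assms in auto)
  then show ?thesis using assms(3) by simp
qed

text \<open>Take \<open>b\<close> divisible by exactly those primes of \<open>N\<close> that do not
  divide \<open>s\<close>. A prime of \<open>N\<close> then divides exactly one of \<open>s\<close>
  and \<open>b\<close>, and if it divides \<open>s\<close>, it does not divide \<open>d\<close> by
  hypothesis. Either way it divides one summand of \<open>s + b * d\<close> and not the
  other.\<close>

lemma coprime_shift:
  fixes s d N :: int
  assumes "coprime (gcd s d) N" "N \<noteq> 0"
  shows "\<exists>b. coprime (s + b * d) N"
proof -
  define b where "b = \<Prod>{p \<in> prime_factors N. \<not> p dvd s}"
  have "coprime (s + b * d) N"
  proof (rule ccontr)
    assume "\<not> coprime (s + b * d) N"
    then have "\<not> is_unit (gcd (s + b * d) N)" "gcd (s + b * d) N \<noteq> 0"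
      using assms(2) by (auto simp: is_unit_gcd)
    then obtain p where "prime p" "p dvd gcd (s + b * d) N"
      using prime_divisor_exists by blast
    then have p: "prime p" "p dvd s + b * d" "p dvd N"
      by auto
    have pN: "p \<in> prime_factors N"
      using p assms(2) by (simp add: in_prime_factors_iff)
    have fin: "finite {p \<in> prime_factors N. \<not> p dvd s}" by simp
    show False
    proof (cases "p dvd s")
      case False
      then have "p dvd b"
        unfolding b_def using pN dvd_prodI[OF fin, of p "\<lambda>x. x"] by simp
      with p(2) False show False
        using dvd_add_left_iff[of p "b * d" s] by simp
    next
      case True
      then have "p dvd b * d" using p(2) by (simp add: dvd_add_right_iff)
      then consider "p dvd b" | "p dvd d" using p(1) prime_dvd_mult_iff by blast
      then show False
      proof cases
        case 1
        then obtain q where "q \<in> prime_factors N" "\<not> q dvd s" "p dvd q"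
          unfolding b_def using fin p(1) by (auto simp: prime_dvd_prod_iff)
        then show False
          using p(1) True primes_dvd_imp_eq[of p q] by auto
      next
        case 2
        then have "p dvd gcd s d" using True by simp
        then show False
          using assms(1) p coprime_common_divisor[of "gcd s d" N p] not_prime_unit by blast
      qed
    qed
  qed
  then show ?thesis by blast
qed

text \<open>A primitive vector modulo \<open>N\<close> lifts to a vector with coprime integer
  entries, which Bezout completes to a matrix of determinant 1.\<close>

lemma prim_transitive:
  assumes "prim N v" "N > 0"
  obtains g where "det2 g = 1" "vmod N v = vmod N (act g (1, 0))"
proof -
  define d where "d = gcd (fst v) N"
  have "coprime (gcd (snd v) N) (fst v)"
    using assms(1) unfolding prim_def coprime_iff_gcd_eq_1 by (simp add: gcd.assoc gcd.commute gcd.left_commute)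
  \<comment> \<open>A vanishing first entry is replaced by its lift \<open>N\<close>, because the
    shift lemma needs a nonzero modulus.\<close>
  then have "\<exists>b. coprime (snd v + b * N) (if fst v = 0 then N else fst v)"
    using assms by (intro coprime_shift) (auto simp: prim_def gcd.commute)
  then obtain b where b: "coprime (snd v + b * N) (if fst v = 0 then N else fst v)" by blast
  define x where "x = (if fst v = 0 then N else fst v)"
  define y where "y = snd v + b * N"
  have "coprime x y" using b by (simp add: x_def y_def coprime_commute)
  then obtain s t where st: "s * x + t * y = 1"
    using bezout_int[of x y] by auto
  show ?thesis
    by (rule that[of "Mat x (-t) y s"])
       (use st in \<open>auto simp: x_def y_def det2_def vmod_def act_def algebra_simps\<close>)
qed

section \<open>A kernel bound for balanced matrices\<close>

definition nm :: "mat2 \<Rightarrow> int" where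
  "nm g = max (max \<bar>m11 g\<bar> \<bar>m12 g\<bar>) (max \<bar>m21 g\<bar> \<bar>m22 g\<bar>)"

definition vn :: "vec2 \<Rightarrow> int" where
  "vn v = max \<bar>fst v\<bar> \<bar>snd v\<bar>"

lemma nm_entries: "\<bar>m11 g\<bar> \<le> nm g" "\<bar>m12 g\<bar> \<le> nm g" "\<bar>m21 g\<bar> \<le> nm g" "\<bar>m22 g\<bar> \<le> nm g"
  by (simp_all add: nm_def le_max_iff_disj)

lemma nm_nonneg [simp]: "0 \<le> nm g"
  by (simp add: nm_def)

lemma nm_leI:
  assumes "\<bar>m11 g\<bar> \<le> x" "\<bar>m12 g\<bar> \<le> x" "\<bar>m21 g\<bar> \<le> x" "\<bar>m22 g\<bar> \<le> x"
  shows "nm g \<le> x"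
  using assms by (simp add: nm_def)

lemma abs_comb_le:
  fixes a b c d x y :: int
  assumes "\<bar>a\<bar> \<le> x" "\<bar>b\<bar> \<le> x" "\<bar>c\<bar> \<le> y" "\<bar>d\<bar> \<le> y"
  shows "\<bar>a * c + b * d\<bar> \<le> 2 * x * y"
proof -
  have "\<bar>a * c\<bar> \<le> x * y" "\<bar>b * d\<bar> \<le> x * y"
    unfolding abs_mult using assms by (auto intro!: mult_mono)
  then show ?thesis by linarith
qed

lemma nm_times: "nm (g * h) \<le> 2 * nm g * nm h"
  by (rule nm_leI) (simp_all add: abs_comb_le nm_entries)

lemma nm_adj2 [simp]: "nm (adj2 g) = nm g"
  by (simp add: nm_def adj2_def max.commute max.left_commute max.assoc)

lemma nm_pos:
  assumes "g \<in> SL2"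
  shows "1 \<le> nm g"
proof (rule ccontr)
  assume "\<not> 1 \<le> nm g"
  then have "m11 g = 0" "m12 g = 0"
    using nm_entries[of g] by linarith+
  with assms show False by (simp add: SL2_def det2_def)
qed

text \<open>The lower bound \<open>m\<close> on every entry keeps the ratios of entries bounded and
  lets only boundedly many matrices share a first row. The factor 32 leaves room for the matrices
  built in \<open>card_bulk_ge\<close>, with lower entries up to \<open>16 * m\<close> and upper
  entries at most twice as large.\<close>

definition bulk :: "int \<Rightarrow> mat2 set" where
  "bulk m = {g \<in> SL2. (\<forall>x \<in> {m11 g, m12 g, m21 g, m22 g}. m \<le> \<bar>x\<bar> \<and> \<bar>x\<bar> \<le> 32 * m)}"

text \<open>The identity is included so that the differences \<open>f (act g v) - f v\<close> occur
  among the pairwise differences in \<open>sqn_Top\<close>; the inverses make \<open>steps\<close>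
  symmetric.\<close>

definition gens :: "mat2 set" where
  "gens = {1, matL, adj2 matL, matU, adj2 matU}"

definition steps :: "int \<Rightarrow> mat2 set" where
  "steps m = gens \<union> bulk m"

lemma finite_mat2_box:
  assumes "finite S"
  shows "finite {g. m11 g \<in> S \<and> m12 g \<in> S \<and> m21 g \<in> S \<and> m22 g \<in> S}"
proof (rule finite_subset)
  show "{g. m11 g \<in> S \<and> m12 g \<in> S \<and> m21 g \<in> S \<and> m22 g \<in> S}
      \<subseteq> (\<lambda>(a, b, c, d). Mat a b c d) ` (S \<times> S \<times> S \<times> S)"
  proof
    fix g assume "g \<in> {g. m11 g \<in> S \<and> m12 g \<in> S \<and> m21 g \<in> S \<and> m22 g \<in> S}"
    then show "g \<in> (\<lambda>(a, b, c, d). Mat a b c d) ` (S \<times> S \<times> S \<times> S)"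
      by (intro image_eqI[of _ _ "(m11 g, m12 g, m21 g, m22 g)"]) auto
  qed
qed (use assms in simp)

lemma finite_nm_le: "finite {g. nm g \<le> R}"
  by (rule finite_subset[OF _ finite_mat2_box[of "{-R..R}"]]) (auto simp: nm_def)

lemma bulk_nm: "g \<in> bulk m \<Longrightarrow> nm g \<le> 32 * m"
  by (auto simp: bulk_def nm_def)

lemma finite_bulk [simp]: "finite (bulk m)"
  by (rule finite_subset[OF _ finite_nm_le[of "32 * m"]]) (auto simp: bulk_nm)

lemma finite_gens [simp]: "finite gens"
  by (simp add: gens_def)

lemma finite_steps [simp]: "finite (steps m)"
  by (simp add: steps_def)

lemma gens_SL2: "gens \<subseteq> SL2"
  by (auto simp: gens_def SL2_def matL_def matU_def)

lemma steps_SL2: "steps m \<subseteq> SL2"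
  using gens_SL2 by (auto simp: steps_def bulk_def)

lemma adj2_gens: "adj2 g \<in> gens \<longleftrightarrow> g \<in> gens"
proof -
  have "adj2 g \<in> gens" if "g \<in> gens" for g using that by (auto simp: gens_def)
  from this[of g] this[of "adj2 g"] show ?thesis by auto
qed

lemma adj2_bulk: "adj2 g \<in> bulk m \<longleftrightarrow> g \<in> bulk m"
proof -
  have "adj2 g \<in> bulk m" if "g \<in> bulk m" for g
    using that by (auto simp: bulk_def adj2_def SL2_def det2_def algebra_simps)
  from this[of g] this[of "adj2 g"] show ?thesis by auto
qed

lemma adj2_steps: "adj2 g \<in> steps m \<longleftrightarrow> g \<in> steps m"
  by (simp add: steps_def adj2_gens adj2_bulk)

lemma gens_nm: "g \<in> gens \<Longrightarrow> nm g \<le> 1"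
  by (auto simp: gens_def nm_def matL_def matU_def adj2_def one_mat2_def)

lemma steps_nm: "m \<ge> 1 \<Longrightarrow> g \<in> steps m \<Longrightarrow> nm g \<le> 32 * m"
  using gens_nm[of g] bulk_nm[of g m] by (auto simp: steps_def)

section \<open>Sums of reciprocals over separated slopes\<close>

lemma harm_eq_sum_int: "harm J = (\<Sum>i\<in>{1..int J}. 1 / real_of_int i)"
  unfolding harm_def
  by (rule sum.reindex_bij_witness[of _ nat int]) (auto simp: field_simps)

text \<open>At most three elements have \<open>\<bar>k u\<bar> \<le> 1\<close>, each contributing at
  most \<open>B\<close>. For either sign of \<open>k\<close> the remaining values
  \<open>\<bar>k u\<bar> - 1\<close> are distinct positive integers, so each half is at most
  \<open>D\<close> times a harmonic number.\<close>

lemma sum_separated_le: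
  fixes h :: "'a \<Rightarrow> real" and k :: "'a \<Rightarrow> int"
  assumes fin: "finite A" and inj: "inj_on k A" and kJ: "\<And>u. u \<in> A \<Longrightarrow> \<bar>k u\<bar> \<le> int J"
    and hB: "\<And>u. u \<in> A \<Longrightarrow> h u \<le> B" and hD: "\<And>u. u \<in> A \<Longrightarrow> h u * (\<bar>k u\<bar> - 1) \<le> D"
    and "0 \<le> B" "0 \<le> D"
  shows "sum h A \<le> 3 * B + 2 * D * harm J"
proof -
  define A1 where "A1 = {u \<in> A. \<bar>k u\<bar> \<le> 1}"
  define A2 where "A2 = {u \<in> A. k u \<ge> 2}"
  define A3 where "A3 = {u \<in> A. k u \<le> -2}"
  have "A1 \<subseteq> A" by (auto simp: A1_def)
  then have "card A1 = card (k ` A1)"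
    using inj by (simp add: card_image inj_on_subset)
  also have "\<dots> \<le> card {-1..1::int}"
    by (rule card_mono) (auto simp: A1_def)
  finally have c1: "card A1 \<le> 3" by simp
  have s1: "sum h A1 \<le> 3 * B"
  proof -
    have "sum h A1 \<le> real (card A1) * B"
      by (rule sum_bounded_above) (use hB in \<open>auto simp: A1_def\<close>)
    also have "\<dots> \<le> 3 * B" using c1 \<open>0 \<le> B\<close> by (intro mult_right_mono) auto
    finally show ?thesis .
  qed
  have aux: "sum h A' \<le> D * harm J" if "A' \<subseteq> A" and sgn: "\<And>u. u \<in> A' \<Longrightarrow> \<bar>k u\<bar> \<ge> 2"
    and inj': "inj_on (\<lambda>u. \<bar>k u\<bar>) A'" for A'
  proof -
    have inj2: "inj_on (\<lambda>u. \<bar>k u\<bar> - 1) A'"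
      using inj' by (auto simp: inj_on_def)
    have "sum h A' \<le> (\<Sum>u\<in>A'. D * (1 / real_of_int (\<bar>k u\<bar> - 1)))"
    proof (rule sum_mono)
      fix u assume u: "u \<in> A'"
      then have "real_of_int (\<bar>k u\<bar> - 1) > 0" using sgn[OF u] by linarith
      moreover have "h u * real_of_int (\<bar>k u\<bar> - 1) \<le> D"
        using hD[of u] u \<open>A' \<subseteq> A\<close> by auto
      ultimately show "h u \<le> D * (1 / real_of_int (\<bar>k u\<bar> - 1))"
        by (simp add: field_simps)
    qed
    also have "\<dots> = D * (\<Sum>i\<in>(\<lambda>u. \<bar>k u\<bar> - 1) ` A'. 1 / real_of_int i)"
      by (simp add: sum_distrib_left sum.reindex[OF inj2])
    also have "\<dots> \<le> D * (\<Sum>i\<in>{1..int J}. 1 / real_of_int i)"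
    proof (intro mult_left_mono sum_mono2)
      show "(\<lambda>u. \<bar>k u\<bar> - 1) ` A' \<subseteq> {1..int J}"
        using sgn kJ \<open>A' \<subseteq> A\<close> by fastforce
    qed (use \<open>0 \<le> D\<close> in auto)
    finally show ?thesis by (simp add: harm_eq_sum_int)
  qed
  have s2: "sum h A2 \<le> D * harm J"
    by (rule aux) (use inj in \<open>auto simp: A2_def inj_on_def\<close>)
  have s3: "sum h A3 \<le> D * harm J"
    by (rule aux) (use inj in \<open>auto simp: A3_def inj_on_def\<close>)
  have A: "A = A1 \<union> (A2 \<union> A3)" by (auto simp: A1_def A2_def A3_def)
  have "sum h A = sum h A1 + sum h (A2 \<union> A3)"
    unfolding A by (rule sum.union_disjoint) (use fin in \<open>auto simp: A1_def A2_def A3_def\<close>)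
  also have "sum h (A2 \<union> A3) = sum h A2 + sum h A3"
    by (rule sum.union_disjoint) (use fin in \<open>auto simp: A2_def A3_def\<close>)
  finally show ?thesis using s1 s2 s3 by simp
qed


lemma harm_le_ln:
  assumes "n \<ge> 1"
  shows "(harm n :: real) \<le> 1 + ln n"
proof -
  have "harm (Suc k) - ln (real (Suc k)) \<le> 1" for k
    using decseqD[OF decseq_harm_diff_ln, of 0 k] by (simp add: harm_expand)
  from this[of "n - 1"] assms show ?thesis by simp
qed

definition bulk_rows :: "int \<Rightarrow> vec2 set" where
  "bulk_rows m = {u. coprime (fst u) (snd u) \<and> m \<le> \<bar>fst u\<bar> \<and> \<bar>fst u\<bar> \<le> 32 * m \<and>
      m \<le> \<bar>snd u\<bar> \<and> \<bar>snd u\<bar> \<le> 32 * m}"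

lemma finite_bulk_rows [simp]: "finite (bulk_rows m)"
  by (rule finite_subset[of _ "{-32*m..32*m} \<times> {-32*m..32*m}"]) (auto simp: bulk_rows_def)

text \<open>Distinct primitive vectors with positive second coordinate at most \<open>Y\<close> have slopes at least
  \<open>1 / Y\<^sup>2\<close> apart.\<close>

lemma slope_sum_pos:
  fixes \<alpha> :: real and m :: int
  assumes m: "m \<ge> 1" and \<alpha>: "\<bar>\<alpha>\<bar> \<le> 1"
  shows "(\<Sum>u\<in>{u \<in> bulk_rows m. snd u > 0}. 1 / max \<bar>real_of_int (fst u) + \<alpha> * real_of_int (snd u)\<bar> (1 / (64 * real_of_int m)))
    \<le> 192 * real_of_int m + 2048 * real_of_int m * harm (nat (34816 * m\<^sup>2))"
proof -
  define A where "A = {u \<in> bulk_rows m. snd u > 0}"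
  \<comment> \<open>\<open>Y\<close> is the square of \<open>32 * m\<close>, a bound for the product
    of two denominators. Distinct slopes are at least \<open>1 / Y\<close> apart, so the floor
    \<open>k\<close> separates them.\<close>
  define Y :: real where "Y = 1024 * m\<^sup>2"
  define s where "s u = real_of_int (fst u) / real_of_int (snd u) + \<alpha>" for u :: vec2
  define k where "k u = \<lfloor>s u * Y\<rfloor>" for u
  define h where "h u = 1 / max \<bar>real_of_int (fst u) + \<alpha> * real_of_int (snd u)\<bar> (1 / (64 * real_of_int m))" for u
  have m': "real_of_int m \<ge> 1" using m by simp
  have Y: "Y \<ge> 1024"
    using one_le_power[OF m', of 2] by (simp add: Y_def)
  have sA: "1 \<le> real_of_int (snd u)" "real_of_int (snd u) \<le> 32 * real_of_int m" "\<bar>real_of_int (fst u)\<bar> \<le> 32 * real_of_int m"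
    "real_of_int m \<le> real_of_int (snd u)" if "u \<in> A" for u
    using that by (auto simp: A_def bulk_rows_def)
  have su: "s u * real_of_int (snd u) = real_of_int (fst u) + \<alpha> * real_of_int (snd u)" if "u \<in> A" for u
    using sA[OF that] by (simp add: s_def field_simps)
  have inj: "inj_on k A"
  proof (rule inj_onI, rule ccontr)
    fix u v assume uv: "u \<in> A" "v \<in> A" and eq: "k u = k v" and ne: "u \<noteq> v"
    have "fst u * snd v \<noteq> fst v * snd u"
    proof
      assume eq': "fst u * snd v = fst v * snd u"
      have "snd u dvd fst u * snd v" "snd v dvd fst v * snd u"
        using eq' dvd_triv_right[of "snd u" "fst v"] dvd_triv_right[of "snd v" "fst u"] by auto
      then have "snd u dvd snd v" "snd v dvd snd u"
        using uv coprime_dvd_mult_right_iff[of "snd u" "fst u" "snd v"]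
          coprime_dvd_mult_right_iff[of "snd v" "fst v" "snd u"]
        by (auto simp: A_def bulk_rows_def coprime_commute)
      then have "snd u = snd v"
        using uv by (intro zdvd_antisym_nonneg) (auto simp: A_def)
      with eq' uv have "u = v" by (auto simp: A_def prod_eq_iff)
      with ne show False by simp
    qed
    then have "\<bar>fst u * snd v - fst v * snd u\<bar> \<ge> 1" by simp
    then have "real_of_int \<bar>fst u * snd v - fst v * snd u\<bar> \<ge> 1" by linarith
    moreover have "s u - s v = real_of_int (fst u * snd v - fst v * snd u) / (real_of_int (snd u) * real_of_int (snd v))"
      using sA[OF uv(1)] sA[OF uv(2)] by (simp add: s_def field_simps)
    ultimately have "\<bar>s u - s v\<bar> \<ge> 1 / (real_of_int (snd u) * real_of_int (snd v))"
      using sA[OF uv(1)] sA[OF uv(2)] by (simp add: abs_mult divide_right_mono)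
    moreover have "real_of_int (snd u) * real_of_int (snd v) \<le> Y"
      using mult_mono[of "real_of_int (snd u)" "32 * real_of_int m" "real_of_int (snd v)" "32 * real_of_int m"] sA[OF uv(1)] sA[OF uv(2)] m'
      by (simp add: Y_def power2_eq_square algebra_simps)
    moreover have "0 < real_of_int (snd u) * real_of_int (snd v)"
      using sA[OF uv(1)] sA[OF uv(2)] by (intro mult_pos_pos) auto
    ultimately have "\<bar>s u - s v\<bar> \<ge> 1 / Y"
      by (smt (verit) frac_le)
    then have "\<bar>s u - s v\<bar> * Y \<ge> 1" using Y by (simp add: field_simps)
    then have "\<bar>s u * Y - s v * Y\<bar> \<ge> 1"
      using Y by (simp add: left_diff_distrib[symmetric] abs_mult)
    then show False using eq unfolding k_def by linarith
  qed
  have sle: "\<bar>s u\<bar> \<le> 33" if "u \<in> A" for u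
  proof -
    have "\<bar>real_of_int (fst u)\<bar> \<le> 32 * real_of_int (snd u)" using sA[OF that] by linarith
    then have "\<bar>real_of_int (fst u) / real_of_int (snd u)\<bar> \<le> 32"
      using sA[OF that] by (simp add: field_simps)
    then show ?thesis using \<alpha> unfolding s_def by linarith
  qed
  \<comment> \<open>\<open>64 * m\<close> is the reciprocal of the truncation in \<open>h\<close>;
    \<open>1024 * m\<close> is \<open>Y / m\<close>, as denominators are at least \<open>m\<close>;
    and 34816 is 34 * 1024, as the slopes have absolute value at most 33 and the rounding is
    absorbed by one more \<open>Y\<close>.\<close>
  have "sum h A \<le> 3 * (64 * real_of_int m) + 2 * (1024 * real_of_int m) * harm (nat (34816 * m\<^sup>2))"
  proof (rule sum_separated_le[where k = k])
    show "finite A" by (simp add: A_def)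
    fix u assume u: "u \<in> A"
    have "\<bar>s u * Y\<bar> \<le> 33 * Y" using sle[OF u] Y by (simp add: abs_mult)
    then have "\<bar>k u\<bar> \<le> 33 * Y + 1" unfolding k_def by linarith
    then have "real_of_int \<bar>k u\<bar> \<le> 34 * Y" using Y by linarith
    then have "real_of_int \<bar>k u\<bar> \<le> real_of_int (34816 * m\<^sup>2)" by (simp add: Y_def)
    then show "\<bar>k u\<bar> \<le> int (nat (34816 * m\<^sup>2))"
      by linarith
    have "1 / (64 * real_of_int m) > (0::real)" using m' by simp
    then have hpos: "h u \<ge> 0" unfolding h_def by (auto intro!: divide_nonneg_nonneg)
    have "h u \<le> 1 / (1 / (64 * real_of_int m))"
      unfolding h_def using m' by (intro frac_le) auto
    then show "h u \<le> 64 * real_of_int m" by simp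
    have "\<bar>k u\<bar> - 1 \<le> \<bar>s u * Y\<bar>" unfolding k_def by linarith
    then have "h u * (\<bar>k u\<bar> - 1) \<le> h u * \<bar>s u * Y\<bar>"
      using hpos by (intro mult_left_mono) auto
    also have "\<dots> = (h u * \<bar>real_of_int (fst u) + \<alpha> * real_of_int (snd u)\<bar>) * (Y / real_of_int (snd u))"
      using sA[OF u] Y by (simp add: su[OF u, symmetric] abs_mult)
    also have "\<dots> \<le> 1 * (Y / real_of_int m)"
    proof (intro mult_mono)
      show "h u * \<bar>real_of_int (fst u) + \<alpha> * real_of_int (snd u)\<bar> \<le> 1"
        using m' by (auto simp: h_def divide_simps max_def)
      show "Y / real_of_int (snd u) \<le> Y / real_of_int m"
        using sA[OF u] m' Y by (intro divide_left_mono mult_pos_pos) auto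
    qed (use sA[OF u] Y in auto)
    also have "\<dots> = 1024 * real_of_int m"
      using m' by (simp add: Y_def power2_eq_square)
    finally show "h u * (\<bar>k u\<bar> - 1) \<le> 1024 * real_of_int m" .
  qed (use inj m in auto)
  then show ?thesis by (simp add: h_def A_def)
qed

definition slopeC :: "int \<Rightarrow> real" where
  "slopeC m = 2 * (192 * real_of_int m + 2048 * real_of_int m * harm (nat (34816 * m\<^sup>2)))"

lemma slope_sum:
  fixes \<alpha> :: real and m :: int
  assumes m: "m \<ge> 1" and \<alpha>: "\<bar>\<alpha>\<bar> \<le> 1"
  shows "(\<Sum>u\<in>bulk_rows m. 1 / max \<bar>real_of_int (fst u) + \<alpha> * real_of_int (snd u)\<bar> (1 / (64 * real_of_int m))) \<le> slopeC m"
proof -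
  let ?h = "\<lambda>u::vec2. 1 / max \<bar>real_of_int (fst u) + \<alpha> * real_of_int (snd u)\<bar> (1 / (64 * real_of_int m))"
  let ?P = "{u \<in> bulk_rows m. snd u > 0}" and ?Q = "{u \<in> bulk_rows m. snd u < 0}"
  have P: "sum ?h ?P \<le> slopeC m / 2"
    using slope_sum_pos[OF assms] by (simp add: slopeC_def)
  have QP: "sum ?h ?Q = sum ?h ?P"
  proof (rule sum.reindex_bij_witness[of _ "\<lambda>u. (- fst u, - snd u)" "\<lambda>u. (- fst u, - snd u)"])
    fix u :: vec2
    show "?h (- fst u, - snd u) = ?h u"
      using abs_minus_cancel[of "real_of_int (fst u) + \<alpha> * real_of_int (snd u)"] by simp
  qed (auto simp: bulk_rows_def)
  have PQ: "bulk_rows m = ?P \<union> ?Q"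
    using m by (auto simp: bulk_rows_def)
  have "sum ?h (bulk_rows m) = sum ?h ?P + sum ?h ?Q"
    by (subst (1) PQ, rule sum.union_disjoint) auto
  then show ?thesis using P QP by linarith
qed

text \<open>Division by the larger coordinate of \<open>r\<close> reduces to a slope \<alpha> of
  absolute value at most 1; \<open>bulk_rows\<close> is symmetric under exchange of the coordinates.
  The truncation at \<open>vn r / (64 * m)\<close> is the a priori lower bound for the norm of a
  product in \<open>steps_kernel\<close>.\<close>

lemma slope_sum_vec:
  fixes r :: vec2
  assumes m: "m \<ge> 1" and r: "vn r > 0"
  shows "(\<Sum>u\<in>bulk_rows m. 1 / max \<bar>real_of_int (fst u * fst r + snd u * snd r)\<bar> (vn r / (64 * real_of_int m)))
    \<le> slopeC m / vn r"
proof -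
  have main: "(\<Sum>u\<in>bulk_rows m. 1 / max \<bar>real_of_int (fst u * x + snd u * y)\<bar> (\<bar>x\<bar> / (64 * real_of_int m)))
      \<le> slopeC m / \<bar>x\<bar>" if xy: "\<bar>y\<bar> \<le> \<bar>x\<bar>" "x \<noteq> 0" for x y :: int
  proof -
    define \<alpha> where "\<alpha> = real_of_int y / x"
    have x: "\<bar>real_of_int x\<bar> > 0" using xy by simp
    have "\<bar>real_of_int y\<bar> \<le> \<bar>real_of_int x\<bar>" using xy by linarith
    then have "\<bar>\<alpha>\<bar> \<le> 1" using xy by (simp add: \<alpha>_def field_simps)
    then have "(\<Sum>u\<in>bulk_rows m. 1 / max \<bar>real_of_int (fst u) + \<alpha> * real_of_int (snd u)\<bar> (1 / (64 * real_of_int m))) / \<bar>x\<bar> \<le> slopeC m / \<bar>x\<bar>"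
      using slope_sum[OF m] by (intro divide_right_mono) auto
    moreover have "max \<bar>real_of_int (fst u * x + snd u * y)\<bar> (\<bar>x\<bar> / (64 * real_of_int m)) =
        max \<bar>real_of_int (fst u) + \<alpha> * real_of_int (snd u)\<bar> (1 / (64 * real_of_int m)) * \<bar>x\<bar>" for u :: vec2
    proof -
      have "real_of_int (fst u * x + snd u * y) = (real_of_int (fst u) + \<alpha> * real_of_int (snd u)) * x"
        using x by (simp add: \<alpha>_def field_simps)
      then show ?thesis
        by (simp add: abs_mult max_mult_distrib_right)
    qed
    ultimately show ?thesis
      by (simp add: sum_divide_distrib)
  qed
  show ?thesis
  proof (cases "\<bar>snd r\<bar> \<le> \<bar>fst r\<bar>")
    case True
    then have "vn r = \<bar>fst r\<bar>" by (simp add: vn_def)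
    with main[OF True] r show ?thesis by simp
  next
    case False
    then have eq: "vn r = \<bar>snd r\<bar>" by (simp add: vn_def)
    have "(\<Sum>u\<in>bulk_rows m. 1 / max \<bar>real_of_int (fst u * fst r + snd u * snd r)\<bar> (vn r / (64 * real_of_int m))) =
      (\<Sum>u\<in>bulk_rows m. 1 / max \<bar>real_of_int (fst u * snd r + snd u * fst r)\<bar> (\<bar>snd r\<bar> / (64 * real_of_int m)))"
      by (rule sum.reindex_bij_witness[of _ prod.swap prod.swap])
        (auto simp: bulk_rows_def eq algebra_simps coprime_commute)
    with main[of "fst r" "snd r"] False r eq show ?thesis by simp
  qed
qed

text \<open>Matrices of determinant 1 with the same first row have second rows differing by
  \<open>t\<close> times that row. The bounds \<open>m\<close> and \<open>32 * m\<close> on the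
  entries force \<open>\<bar>t\<bar> \<le> 64\<close>, which leaves 129 values.\<close>

lemma bulk_fiber:
  assumes m: "m \<ge> 1" and u: "u \<in> bulk_rows m"
  shows "card {w \<in> bulk m. (m11 w, m12 w) = u} \<le> 129"
proof (cases "{w \<in> bulk m. (m11 w, m12 w) = u} = {}")
  case False
  then obtain w0 where w0: "w0 \<in> bulk m" "(m11 w0, m12 w0) = u" by blast
  let ?F = "\<lambda>t. Mat (fst u) (snd u) (m21 w0 + t * fst u) (m22 w0 + t * snd u)"
  have "{w \<in> bulk m. (m11 w, m12 w) = u} \<subseteq> ?F ` {-64..64}"
  proof
    fix w assume "w \<in> {w \<in> bulk m. (m11 w, m12 w) = u}"
    then have w: "w \<in> bulk m" "m11 w = fst u" "m12 w = snd u" by auto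
    let ?c = "m21 w - m21 w0" and ?d = "m22 w - m22 w0"
    have "fst u * m22 w - snd u * m21 w = 1" "fst u * m22 w0 - snd u * m21 w0 = 1"
      using w w0 by (auto simp: bulk_def SL2_def det2_def)
    then have eq: "fst u * ?d = snd u * ?c" by (simp add: algebra_simps)
    then have "fst u dvd snd u * ?c" by (metis dvd_triv_left)
    then have "fst u dvd ?c"
      using u coprime_dvd_mult_right_iff[of "fst u" "snd u" ?c] by (simp add: bulk_rows_def)
    then obtain t where t: "?c = t * fst u" by (metis dvd_def mult.commute)
    have "fst u \<noteq> 0" using u m by (auto simp: bulk_rows_def)
    moreover have "fst u * ?d = fst u * (t * snd u)" using eq t by (simp add: algebra_simps)
    ultimately have t': "?d = t * snd u" using mult_cancel_left[of "fst u" ?d "t * snd u"] by blast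
    have "\<bar>m21 w\<bar> \<le> 32 * m" "\<bar>m21 w0\<bar> \<le> 32 * m" using w w0 by (auto simp: bulk_def)
    then have "\<bar>?c\<bar> \<le> 64 * m" by linarith
    moreover have "\<bar>t\<bar> * m \<le> \<bar>t\<bar> * \<bar>fst u\<bar>"
      using u by (intro mult_left_mono) (auto simp: bulk_rows_def)
    ultimately have "\<bar>t\<bar> * m \<le> 64 * m" using t by (simp add: abs_mult)
    then have "\<bar>t\<bar> \<le> 64" using m by (simp add: mult_le_cancel_right)
    moreover have "w = ?F t"
      using t t' w by (cases w) (auto simp: algebra_simps)
    ultimately show "w \<in> ?F ` {-64..64}" by (intro image_eqI[of _ _ t]) auto
  qed
  then have "card {w \<in> bulk m. (m11 w, m12 w) = u} \<le> card (?F ` {-64..64})"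
    by (intro card_mono) auto
  also have "\<dots> \<le> card {-64..64::int}" by (rule card_image_le) simp
  finally show ?thesis by simp
next
  case True
  show ?thesis unfolding True by simp
qed

text \<open>The 10 accounts for at most five generators, each of which shrinks the norm by a factor
  of at most 2; 129 is the bound of \<open>bulk_fiber\<close>.\<close>

definition stepK :: "int \<Rightarrow> real" where
  "stepK m = 10 + 129 * slopeC m"

lemma nm_column:
  obtains e where "vn (act g e) = nm g" "e = (1, 0) \<or> e = (0, 1)"
proof -
  have "nm g = max (vn (act g (1, 0))) (vn (act g (0, 1)))"
    by (simp add: nm_def vn_def act_def max.assoc max.left_commute)
  then have "vn (act g (1, 0)) = nm g \<or> vn (act g (0, 1)) = nm g"
    by linarith
  then show ?thesis using that by blast
qed

lemma vn_act_le_nm: "e = (1, 0) \<or> e = (0, 1) \<Longrightarrow> vn (act g e) \<le> nm g"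
  by (auto simp: nm_def vn_def act_def le_max_iff_disj)

text \<open>Let \<open>r\<close> be a column of \<open>g\<close> with \<open>vn r = nm g\<close>.
  The norm of \<open>w * g\<close> is at least the absolute value of the pairing of \<open>r\<close>
  with the first row of \<open>w\<close>. It is also at least \<open>nm g / (64 * m)\<close>, since
  undoing \<open>w\<close> costs a factor \<open>2 * nm w\<close>. The sum over first rows is then
  \<open>slope_sum_vec\<close>, and \<open>bulk_fiber\<close> bounds the number of \<open>w\<close>
  per row.\<close>

theorem steps_kernel:
  assumes m: "m \<ge> 1" and g: "g \<in> SL2"
  shows "(\<Sum>w\<in>steps m. 1 / real_of_int (nm (w * g))) \<le> stepK m / nm g"
proof -
  have ng: "real_of_int (nm g) \<ge> 1" using nm_pos[OF g] by simp
  have bk: "nm g \<le> 2 * nm w * nm (w * g)" if "w \<in> SL2" for w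
  proof -
    have "nm (adj2 w * (w * g)) \<le> 2 * nm (adj2 w) * nm (w * g)" by (rule nm_times)
    moreover have "adj2 w * (w * g) = g"
      using that adj2_mult_self(1)[of w] by (simp add: SL2_def mult.assoc[symmetric] del: mat2.expand)
    ultimately show ?thesis by simp
  qed
  have "(\<Sum>w\<in>gens. 1 / real_of_int (nm (w * g))) \<le> real (card gens) * (2 / nm g)"
  proof (rule sum_bounded_above)
    fix w assume w: "w \<in> gens"
    then have "w * g \<in> SL2" using gens_SL2 g SL2_times by blast
    then have "nm (w * g) \<ge> 1" by (rule nm_pos)
    have "nm w * nm (w * g) \<le> 1 * nm (w * g)"
      using gens_nm[OF w] by (intro mult_right_mono) auto
    moreover have "w \<in> SL2" using w gens_SL2 by blast
    from bk[OF this] have "nm g \<le> 2 * (nm w * nm (w * g))" by simp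
    ultimately have "nm g \<le> 2 * nm (w * g)" by linarith
    then have "real_of_int (nm g) \<le> 2 * real_of_int (nm (w * g))" by linarith
    with \<open>nm (w * g) \<ge> 1\<close> show "1 / real_of_int (nm (w * g)) \<le> 2 / nm g"
      using ng by (simp add: field_simps)
  qed
  also have "\<dots> \<le> 5 * (2 / nm g)"
  proof (intro mult_right_mono)
    have "card gens \<le> 5"
      unfolding gens_def by (intro card_insert_le_m1) auto
    then show "real (card gens) \<le> 5" by simp
  qed (use ng in auto)
  finally have s1: "(\<Sum>w\<in>gens. 1 / real_of_int (nm (w * g))) \<le> 10 / nm g" by simp
  obtain e where e: "vn (act g e) = nm g" "e = (1, 0) \<or> e = (0, 1)" by (rule nm_column)
  define r where "r = act g e"
  have vr: "vn r = nm g" using e by (simp add: r_def)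
  let ?h = "\<lambda>u::vec2. 1 / max \<bar>real_of_int (fst u * fst r + snd u * snd r)\<bar> (vn r / (64 * real_of_int m))"
  let ?row = "\<lambda>w. (m11 w, m12 w)"
  have rows: "?row ` bulk m \<subseteq> bulk_rows m"
  proof (rule image_subsetI)
    fix w assume w: "w \<in> bulk m"
    then have "m11 w * m22 w + m12 w * (- m21 w) = 1" by (simp add: bulk_def SL2_def det2_def)
    then have "coprime (m11 w) (m12 w)"
      by (metis coprimeI dvd_add dvd_mult2)
    with w show "?row w \<in> bulk_rows m" by (auto simp: bulk_rows_def bulk_def)
  qed
  have hpos: "?h u \<ge> 0" for u using m ng vr by (auto intro!: divide_nonneg_nonneg)
  have "(\<Sum>w\<in>bulk m. 1 / real_of_int (nm (w * g))) \<le> (\<Sum>w\<in>bulk m. ?h (?row w))"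
  proof (rule sum_mono)
    fix w assume w: "w \<in> bulk m"
    then have wS: "w \<in> SL2" by (simp add: bulk_def)
    have "vn (act w r) \<le> nm (w * g)"
      using vn_act_le_nm[OF e(2), of "w * g"] by (simp add: r_def)
    moreover have "\<bar>m11 w * fst r + m12 w * snd r\<bar> \<le> vn (act w r)"
      by (simp add: vn_def act_def)
    ultimately have 1: "\<bar>m11 w * fst r + m12 w * snd r\<bar> \<le> nm (w * g)" by linarith
    have "nm w * nm (w * g) \<le> (32 * m) * nm (w * g)"
      using bulk_nm[OF w] by (intro mult_right_mono) auto
    with bk[OF wS] have "vn r \<le> 64 * m * nm (w * g)" unfolding vr by linarith
    then have "real_of_int (vn r) \<le> real_of_int (64 * m * nm (w * g))" by (simp only: of_int_le_iff)
    then have 2: "vn r / (64 * real_of_int m) \<le> real_of_int (nm (w * g))"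
      using m by (simp add: field_simps)
    have "0 < vn r / (64 * real_of_int m)" using m ng vr by simp
    then have "0 < max \<bar>real_of_int (m11 w * fst r + m12 w * snd r)\<bar> (vn r / (64 * real_of_int m))" by linarith
    moreover have "max \<bar>real_of_int (m11 w * fst r + m12 w * snd r)\<bar> (vn r / (64 * real_of_int m)) \<le> nm (w * g)"
      using 1 2 by (intro max.boundedI) linarith+
    ultimately show "1 / real_of_int (nm (w * g)) \<le> ?h (?row w)"
      unfolding fst_conv snd_conv by (intro divide_left_mono mult_pos_pos) linarith+
  qed
  also have "\<dots> = (\<Sum>u\<in>bulk_rows m. \<Sum>w\<in>{w \<in> bulk m. ?row w = u}. ?h (?row w))"
    by (rule sum.group[symmetric]) (use rows in auto)
  also have "\<dots> \<le> (\<Sum>u\<in>bulk_rows m. 129 * ?h u)"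
  proof (rule sum_mono)
    fix u assume u: "u \<in> bulk_rows m"
    have "(\<Sum>w\<in>{w \<in> bulk m. ?row w = u}. ?h (?row w)) = real (card {w \<in> bulk m. ?row w = u}) * ?h u"
      by simp
    also have "\<dots> \<le> 129 * ?h u"
      using bulk_fiber[OF m u] hpos by (intro mult_right_mono) auto
    finally show "(\<Sum>w\<in>{w \<in> bulk m. ?row w = u}. ?h (?row w)) \<le> 129 * ?h u" .
  qed
  also have "\<dots> = 129 * (\<Sum>u\<in>bulk_rows m. ?h u)" by (simp add: sum_distrib_left)
  also have "\<dots> \<le> 129 * (slopeC m / vn r)"
    using slope_sum_vec[OF m, of r] ng vr by (intro mult_left_mono) auto
  finally have s2: "(\<Sum>w\<in>bulk m. 1 / real_of_int (nm (w * g))) \<le> 129 * slopeC m / nm g"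
    by (simp add: vr)
  have "(\<Sum>w\<in>steps m. 1 / real_of_int (nm (w * g))) \<le>
      (\<Sum>w\<in>gens. 1 / real_of_int (nm (w * g))) + (\<Sum>w\<in>bulk m. 1 / real_of_int (nm (w * g)))"
    unfolding steps_def
    by (subst sum.union_inter[symmetric]) (auto intro!: sum_nonneg)
  with s1 s2 show ?thesis by (simp add: stepK_def add_divide_distrib)
qed

section \<open>The number of balanced matrices\<close>

lemma sum_inverse_squares_le:
  assumes "n \<ge> 2"
  shows "(\<Sum>k\<in>{2..n}. 1 / real k ^ 2) \<le> 3 / 4"
proof -
  \<comment> \<open>The extra \<open>1 / n\<close> makes the induction telescope; at
    \<open>n = 2\<close> both sides are 1/4.\<close>
  have "(\<Sum>k\<in>{2..n}. 1 / real k ^ 2) \<le> 3 / 4 - 1 / n"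
    using assms
  proof (induction n rule: dec_induct)
    case (step n)
    have "1 / (real n + 1) ^ 2 \<le> 1 / n - 1 / (real n + 1)"
      using step.hyps by (simp add: divide_simps power2_eq_square)
    with step.IH step.hyps show ?case by (simp add: add.commute)
  qed simp
  also have "\<dots> \<le> 3 / 4" by simp
  finally show ?thesis .
qed

text \<open>At most \<open>(Y / k)^2\<close> pairs are divisible by a given
  \<open>k \<ge> 2\<close>, and these bounds sum to at most three quarters of
  \<open>Y^2\<close>.\<close>

lemma card_coprime_pairs:
  fixes Y :: nat
  shows "real (card {(c, d) \<in> {1..Y} \<times> {1..Y}. coprime c d}) \<ge> real Y ^ 2 / 4"
proof -
  let ?B = "{1..Y} \<times> {1..Y}"
  let ?C = "{(c, d) \<in> ?B. coprime c d}" and ?D = "{(c, d) \<in> ?B. \<not> coprime c d}"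
  have "?D \<subseteq> (\<Union>k\<in>{2..Y}. (\<lambda>(i, j). (k * i, k * j)) ` ({1..Y div k} \<times> {1..Y div k}))"
  proof safe
    fix c d :: nat assume cd: "c \<in> {1..Y}" "d \<in> {1..Y}" "\<not> coprime c d"
    define k where "k = gcd c d"
    have "k \<noteq> 1" using cd unfolding k_def coprime_iff_gcd_eq_1 by simp
    moreover have "k \<noteq> 0" using cd by (simp add: k_def)
    ultimately have k2: "k \<ge> 2" by simp
    have "k \<le> c" unfolding k_def using cd by (intro dvd_imp_le) auto
    then have kY: "k \<le> Y" using cd by simp
    obtain i where i: "c = k * i" using gcd_dvd1[of c d] unfolding k_def by (elim dvdE)
    obtain j where j: "d = k * j" using gcd_dvd2[of c d] unfolding k_def by (elim dvdE)
    have "i \<in> {1..Y div k}" "j \<in> {1..Y div k}"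
      using cd k2 unfolding i j by (auto simp: less_eq_div_iff_mult_less_eq mult.commute Suc_le_eq)
    then show "(c, d) \<in> (\<Union>k\<in>{2..Y}. (\<lambda>(i, j). (k * i, k * j)) ` ({1..Y div k} \<times> {1..Y div k}))"
      using k2 kY i j by (intro UN_I[of k] image_eqI[of _ _ "(i, j)"]) auto
  qed
  then have "card ?D \<le> card (\<Union>k\<in>{2..Y}. (\<lambda>(i, j). (k * i, k * j)) ` ({1..Y div k} \<times> {1..Y div k}))"
    by (intro card_mono) auto
  also have "\<dots> \<le> (\<Sum>k\<in>{2..Y}. card ((\<lambda>(i, j). (k * i, k * j)) ` ({1..Y div k} \<times> {1..Y div k})))"
    by (rule card_UN_le) auto
  also have "\<dots> \<le> (\<Sum>k\<in>{2..Y}. (Y div k) ^ 2)"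
  proof (rule sum_mono)
    fix k assume "k \<in> {2..Y}"
    have "card ((\<lambda>(i, j). (k * i, k * j)) ` ({1..Y div k} \<times> {1..Y div k})) \<le> card ({1..Y div k} \<times> {1..Y div k})"
      by (rule card_image_le) auto
    then show "card ((\<lambda>(i, j). (k * i, k * j)) ` ({1..Y div k} \<times> {1..Y div k})) \<le> (Y div k) ^ 2"
      by (simp add: power2_eq_square)
  qed
  finally have "real (card ?D) \<le> real (\<Sum>k\<in>{2..Y}. (Y div k) ^ 2)" by (simp only: of_nat_le_iff)
  also have "\<dots> \<le> (\<Sum>k\<in>{2..Y}. real Y ^ 2 * (1 / real k ^ 2))"
    unfolding of_nat_sum
  proof (rule sum_mono)
    fix k assume "k \<in> {2..Y}"
    have "real (Y div k) ^ 2 \<le> (real Y / real k) ^ 2"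
      by (intro power_mono of_nat_div_le_of_nat) auto
    then show "real ((Y div k) ^ 2) \<le> real Y ^ 2 * (1 / real k ^ 2)"
      by (simp add: power_divide)
  qed
  also have "\<dots> = real Y ^ 2 * (\<Sum>k\<in>{2..Y}. 1 / real k ^ 2)"
    by (simp add: sum_distrib_left)
  also have "\<dots> \<le> real Y ^ 2 * (3 / 4)"
  proof (cases "Y \<ge> 2")
    case True
    then show ?thesis by (intro mult_left_mono sum_inverse_squares_le) auto
  qed auto
  finally have D: "real (card ?D) \<le> real Y ^ 2 * (3 / 4)" .
  have fin: "finite ?C" "finite ?D" by (auto intro: finite_subset[of _ ?B])
  have "?B = ?C \<union> ?D" by blast
  then have "card ?B = card (?C \<union> ?D)" by (rule arg_cong)
  also have "\<dots> = card ?C + card ?D"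
    by (rule card_Un_disjoint[OF fin]) blast
  finally have "card ?C + card ?D = Y ^ 2" by (simp add: power2_eq_square)
  then have "real (card ?C + card ?D) = real (Y ^ 2)" by (rule arg_cong)
  then have "real (card ?C) + real (card ?D) = real Y ^ 2"
    unfolding of_nat_add of_nat_power .
  with D show ?thesis by linarith
qed

text \<open>Of the pairs up to \<open>16 * m\<close>, at least \<open>64 * m^2\<close> are coprime
  and at most \<open>32 * m^2\<close> have a coordinate below \<open>m\<close>. Each pair that
  remains is the second row of a bulk matrix.\<close>

lemma card_bulk_ge:
  fixes m :: nat
  assumes m: "m \<ge> 2"
  shows "32 * real m ^ 2 \<le> card (bulk m)"
proof -
  let ?Y = "16 * m"
  let ?C = "{(c, d) \<in> {1..?Y} \<times> {1..?Y}. coprime c d}"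
  let ?G = "{(c, d) \<in> {m..?Y} \<times> {m..?Y}. coprime c d}"
  have finC: "finite ?C" by (rule finite_subset[of _ "{1..?Y} \<times> {1..?Y}"]) auto
  have finG: "finite ?G" by (rule finite_subset[of _ "{1..?Y} \<times> {1..?Y}"]) (use m in auto)
  have "?C \<subseteq> ?G \<union> ({1..<m} \<times> {1..?Y} \<union> {1..?Y} \<times> {1..<m})" by auto
  then have "card ?C \<le> card (?G \<union> ({1..<m} \<times> {1..?Y} \<union> {1..?Y} \<times> {1..<m}))"
    using finG by (intro card_mono) auto
  also have "\<dots> \<le> card ?G + (card ({1..<m} \<times> {1..?Y}) + card ({1..?Y} \<times> {1..<m}))"
    by (intro order_trans[OF card_Un_le] add_mono card_Un_le order_refl)
  also have "\<dots> = card ?G + 32 * (m - 1) * m" by (simp add: card_cartesian_product algebra_simps)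
  also have "\<dots> \<le> card ?G + 32 * m ^ 2"
    by (simp add: power2_eq_square)
  finally have "real (card ?C) \<le> real (card ?G + 32 * m ^ 2)" by (simp only: of_nat_le_iff)
  with card_coprime_pairs[of ?Y] have G: "32 * real m ^ 2 \<le> card ?G"
    by (simp add: power2_eq_square)
  have ex: "\<exists>w \<in> bulk m. m21 w = int c \<and> m22 w = int d" if cd: "(c, d) \<in> ?G" for c d
  proof -
    have c: "m \<le> c" "c \<le> 16 * m" "m \<le> d" "d \<le> 16 * m" "coprime (int d) (int c)"
      using cd by (auto simp: coprime_commute)
    obtain x where x: "[int d * x = 1] (mod int c)"
      using cong_solve_coprime_int[OF c(5)] by blast
    \<comment> \<open>The inverse of \<open>d\<close> modulo \<open>c\<close> is taken between
      \<open>c\<close> and \<open>2 * c\<close> rather than below \<open>c\<close>, so that the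
      upper row is no smaller than the lower one; \<open>b\<close> then lies between
      \<open>d\<close> and \<open>2 * d\<close>.\<close>
    define a where "a = x mod int c + int c"
    have "[int d * a = 1] (mod int c)"
      using x by (simp add: a_def cong_unfold distrib_left mod_simps)
    then have "int c dvd a * int d - 1" by (simp add: cong_iff_dvd_diff mult.commute)
    then obtain b where b: "a * int d - 1 = int c * b" by (elim dvdE)
    have a: "int c \<le> a" "a < 2 * int c" using c m by (auto simp: a_def)
    have "int c * int d \<le> a * int d" using a by (intro mult_right_mono) auto
    then have "int c * int d \<le> int c * b + 1" using b by linarith
    then have "int c * (int d - b) \<le> 1" by (simp add: algebra_simps)
    then have bd: "int d \<le> b"
    proof -
      have "\<not> int d - b \<ge> 1"
      proof
        assume "int d - b \<ge> 1"
        then have "int c * 1 \<le> int c * (int d - b)" by (intro mult_left_mono) auto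
        with \<open>int c * (int d - b) \<le> 1\<close> c m show False by linarith
      qed
      then show ?thesis by simp
    qed
    have "int c * b \<le> int c * (2 * int d)"
    proof -
      have "a * int d \<le> (2 * int c) * int d" using a by (intro mult_right_mono) auto
      with b show ?thesis by (simp add: algebra_simps)
    qed
    then have b2: "b \<le> 2 * int d" using c m by (simp add: mult_le_cancel_left)
    have "Mat a b (int c) (int d) \<in> bulk m"
      using a b bd b2 c m by (auto simp: bulk_def SL2_def algebra_simps)
    then show ?thesis by force
  qed
  have "?G \<subseteq> (\<lambda>w. (nat (m21 w), nat (m22 w))) ` bulk m"
  proof
    fix p assume "p \<in> ?G"
    moreover obtain c d where p: "p = (c, d)" by (cases p)
    ultimately obtain w where "w \<in> bulk m" "m21 w = int c" "m22 w = int d" using ex by blast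
    then show "p \<in> (\<lambda>w. (nat (m21 w), nat (m22 w))) ` bulk m"
      by (intro image_eqI[of _ _ w]) (auto simp: p)
  qed
  then have "card ?G \<le> card (bulk m)"
    by (rule surj_card_le[OF finite_bulk])
  then have "real (card ?G) \<le> real (card (bulk m))" by simp
  with G show ?thesis by linarith
qed

text \<open>\<open>stepK m\<close> is of order \<open>m * log m\<close> against at least
  \<open>32 * m^2\<close> steps, so any exponent above -1 is reached for large \<open>m\<close>. The
  base \<open>64 * m\<close> bounds the growth of the norm of a word per letter.\<close>

lemma exists_good_steps:
  "\<exists>m::nat. m \<ge> 2 \<and> stepK m \<le> real (card (steps m)) * (64 * real m) powr (-9/10)"
proof -
  have "eventually (\<lambda>x::real. 10 + 258 * (192 * x + 2048 * x * (1 + ln (34816 * x ^ 2)))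
      \<le> 32 * x ^ 2 * (64 * x) powr (-9/10)) at_top"
    by real_asymp
  then have "eventually (\<lambda>m::nat. 10 + 258 * (192 * real m + 2048 * real m * (1 + ln (34816 * real m ^ 2)))
      \<le> 32 * real m ^ 2 * (64 * real m) powr (-9/10)) at_top"
    using filterlim_real_sequentially by (rule eventually_compose_filterlim)
  then obtain m0 where m0: "\<And>m::nat. m \<ge> m0 \<Longrightarrow>
      10 + 258 * (192 * real m + 2048 * real m * (1 + ln (34816 * real m ^ 2)))
      \<le> 32 * real m ^ 2 * (64 * real m) powr (-9/10)"
    by (auto simp: eventually_sequentially)
  define m where "m = max m0 2"
  have m: "m \<ge> 2" "m \<ge> m0" by (simp_all add: m_def)
  have "nat (34816 * (int m)\<^sup>2) = 34816 * m ^ 2"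
    by (simp add: nat_mult_distrib nat_power_eq)
  moreover have "harm (34816 * m ^ 2) \<le> (1 + ln (real (34816 * m ^ 2)) :: real)"
    using m by (intro harm_le_ln) (auto simp: Suc_le_eq)
  ultimately have "stepK m \<le> 10 + 258 * (192 * real m + 2048 * real m * (1 + ln (34816 * real m ^ 2)))"
    unfolding stepK_def slopeC_def by (simp add: mult_left_mono)
  also have "\<dots> \<le> 32 * real m ^ 2 * (64 * real m) powr (-9/10)"
    using m0 m by blast
  also have "\<dots> \<le> real (card (steps m)) * (64 * real m) powr (-9/10)"
  proof (intro mult_right_mono)
    have "card (bulk m) \<le> card (steps m)" by (intro card_mono) (auto simp: steps_def)
    then show "32 * real m ^ 2 \<le> real (card (steps m))"
      using card_bulk_ge[OF m(1)] by linarith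
  qed auto
  finally show ?thesis using m(1) by blast
qed

section \<open>Words in the steps and their products\<close>

definition wlists :: "int \<Rightarrow> nat \<Rightarrow> mat2 list set" where
  "wlists m n = {ws. set ws \<subseteq> steps m \<and> length ws = n}"

lemma finite_wlists [simp]: "finite (wlists m n)"
  unfolding wlists_def by (rule finite_lists_length_eq) simp

lemma wlists_0 [simp]: "wlists m 0 = {[]}"
  by (auto simp: wlists_def)

lemma sum_wlists_Suc:
  fixes F :: "mat2 list \<Rightarrow> 'a::comm_monoid_add"
  shows "(\<Sum>ws\<in>wlists m (Suc n). F ws) = (\<Sum>w\<in>steps m. \<Sum>ws\<in>wlists m n. F (w # ws))"
proof -
  have "(\<Sum>ws\<in>wlists m (Suc n). F ws) = (\<Sum>(w, ws)\<in>steps m \<times> wlists m n. F (w # ws))"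
    by (rule sum.reindex_bij_witness[of _ "\<lambda>(w, ws). w # ws" "\<lambda>ws. (hd ws, tl ws)"])
       (auto simp: wlists_def length_Suc_conv)
  then show ?thesis by (simp add: sum.cartesian_product)
qed

lemma wlists_SL2: "ws \<in> wlists m n \<Longrightarrow> prod_list ws \<in> SL2"
  using steps_SL2 by (intro SL2_prod_list) (auto simp: wlists_def)

lemma wlists_nm:
  assumes "m \<ge> 1" "ws \<in> wlists m n"
  shows "nm (prod_list ws) \<le> (64 * m) ^ n"
  using assms(2)
proof (induction n arbitrary: ws)
  case 0
  then show ?case by (simp add: nm_def)
next
  case (Suc n)
  then obtain w vs where ws: "ws = w # vs" "w \<in> steps m" "vs \<in> wlists m n"
    by (auto simp: wlists_def length_Suc_conv)
  have "nm (w * prod_list vs) \<le> 2 * nm w * nm (prod_list vs)" by (rule nm_times)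
  also have "\<dots> \<le> 2 * (32 * m) * (64 * m) ^ n"
    using steps_nm[OF assms(1) ws(2)] Suc.IH[OF ws(3)] assms(1) by (intro mult_mono) auto
  finally show ?case by (simp add: ws)
qed

lemma steps_kernel_adj2:
  assumes m: "m \<ge> 1" and g: "g \<in> SL2"
  shows "(\<Sum>w\<in>steps m. 1 / real_of_int (nm (adj2 w * g))) \<le> stepK m / nm g"
proof -
  have "(\<Sum>w\<in>steps m. 1 / real_of_int (nm (adj2 w * g))) = (\<Sum>w\<in>steps m. 1 / real_of_int (nm (w * g)))"
    by (rule sum.reindex_bij_witness[of _ adj2 adj2]) (auto simp: adj2_steps)
  then show ?thesis using steps_kernel[OF assms] by simp
qed

text \<open>Removing the first letter turns the count for \<open>g\<close> into a sum of counts for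
  \<open>adj2 w * g\<close>, and the kernel bound reproduces the weight \<open>1 / nm g\<close> up
  to the factor \<open>stepK m\<close>.\<close>

lemma card_words_le:
  assumes m: "m \<ge> 1" and g: "g \<in> SL2"
  shows "real (card {ws \<in> wlists m n. prod_list ws = g}) \<le> stepK m ^ n / nm g"
  using g
proof (induction n arbitrary: g)
  case 0
  show ?case
  proof (cases "g = 1")
    case True
    have "card {ws \<in> wlists m 0. prod_list ws = g} \<le> card {[] :: mat2 list}"
      by (rule card_mono) auto
    then show ?thesis using True by (simp add: nm_def)
  next
    case False
    then have e: "{ws \<in> wlists m 0. prod_list ws = g} = {}" by auto
    show ?thesis unfolding e by simp
  qed
next
  case (Suc n)
  have K: "stepK m \<ge> 0"
    using m by (auto simp: stepK_def slopeC_def intro!: add_nonneg_nonneg mult_nonneg_nonneg harm_nonneg)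
  have "{ws \<in> wlists m (Suc n). prod_list ws = g} \<subseteq>
      (\<Union>w\<in>steps m. (#) w ` {ws \<in> wlists m n. prod_list ws = adj2 w * g})"
  proof
    fix ws assume "ws \<in> {ws \<in> wlists m (Suc n). prod_list ws = g}"
    then obtain w vs where ws: "ws = w # vs" "w \<in> steps m" "vs \<in> wlists m n" "w * prod_list vs = g"
      by (auto simp: wlists_def length_Suc_conv)
    have "adj2 w * g = adj2 w * w * prod_list vs"
      unfolding ws(4)[symmetric] by (simp only: mult.assoc)
    also have "\<dots> = prod_list vs"
    proof -
      have "det2 w = 1" using ws(2) steps_SL2 by (auto simp: SL2_def)
      then show ?thesis by (simp only: adj2_mult_self mult_1_left)
    qed
    finally have "vs \<in> {ws \<in> wlists m n. prod_list ws = adj2 w * g}"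
      using ws(3) by simp
    then show "ws \<in> (\<Union>w\<in>steps m. (#) w ` {ws \<in> wlists m n. prod_list ws = adj2 w * g})"
      using ws(1,2) by blast
  qed
  then have "card {ws \<in> wlists m (Suc n). prod_list ws = g} \<le>
      card (\<Union>w\<in>steps m. (#) w ` {ws \<in> wlists m n. prod_list ws = adj2 w * g})"
    by (intro card_mono) auto
  also have "\<dots> \<le> (\<Sum>w\<in>steps m. card ((#) w ` {ws \<in> wlists m n. prod_list ws = adj2 w * g}))"
    by (rule card_UN_le) simp
  also have "\<dots> = (\<Sum>w\<in>steps m. card {ws \<in> wlists m n. prod_list ws = adj2 w * g})"
    by (intro sum.cong refl card_image) auto
  finally have "real (card {ws \<in> wlists m (Suc n). prod_list ws = g}) \<le>
      (\<Sum>w\<in>steps m. real (card {ws \<in> wlists m n. prod_list ws = adj2 w * g}))"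
    by (simp only: of_nat_le_iff of_nat_sum[symmetric])
  also have "\<dots> \<le> (\<Sum>w\<in>steps m. stepK m ^ n * (1 / nm (adj2 w * g)))"
  proof (rule sum_mono)
    fix w assume "w \<in> steps m"
    then have "adj2 w * g \<in> SL2" using steps_SL2 Suc.prems SL2_adj2 SL2_times by blast
    then show "real (card {ws \<in> wlists m n. prod_list ws = adj2 w * g}) \<le> stepK m ^ n * (1 / nm (adj2 w * g))"
      using Suc.IH by simp
  qed
  also have "\<dots> \<le> stepK m ^ n * (stepK m / nm g)"
    unfolding sum_distrib_left[symmetric]
    using steps_kernel_adj2[OF m Suc.prems] K by (intro mult_left_mono) auto
  finally show ?case by (simp only: power_Suc2 times_divide_eq_right)
qed

section \<open>Counting matrices congruent to scalars\<close>

definition ndiv :: "nat \<Rightarrow> nat" where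
  "ndiv m = card {d. d dvd m}"

lemma ndiv_mult_le:
  assumes "a > 0" "b > 0"
  shows "ndiv (a * b) \<le> ndiv a * ndiv b"
proof -
  have "{d. d dvd a * b} \<subseteq> (\<lambda>(x, y). x * y) ` ({d. d dvd a} \<times> {d. d dvd b})"
  proof
    fix d assume "d \<in> {d. d dvd a * b}"
    then obtain x y where "d = x * y" "x dvd a" "y dvd b"
      using division_decomp by blast
    then show "d \<in> (\<lambda>(x, y). x * y) ` ({d. d dvd a} \<times> {d. d dvd b})"
      by (intro image_eqI[of _ _ "(x, y)"]) auto
  qed
  then have "ndiv (a * b) \<le> card ((\<lambda>(x, y). x * y) ` ({d. d dvd a} \<times> {d. d dvd b}))"
    unfolding ndiv_def using assms by (intro card_mono finite_imageI finite_cartesian_product) auto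
  also have "\<dots> \<le> card ({d. d dvd a} \<times> {d. d dvd b})"
    by (rule card_image_le) (use assms in auto)
  finally show ?thesis by (simp add: ndiv_def card_cartesian_product)
qed

lemma ndiv_prime_power_le:
  assumes "prime p"
  shows "ndiv (p ^ a) \<le> a + 1"
proof -
  have "{d. d dvd p ^ a} \<subseteq> (\<lambda>i. p ^ i) ` {0..a}"
    using divides_primepow_nat[OF assms] by auto
  then have "ndiv (p ^ a) \<le> card ((\<lambda>i. p ^ i) ` {0..a})"
    unfolding ndiv_def by (intro card_mono) auto
  also have "\<dots> \<le> card {0..a}" by (rule card_image_le) simp
  finally show ?thesis by simp
qed

text \<open>A prime \<open>p \<ge> 2^16\<close> satisfies \<open>p powr (1/16) \<ge> 2\<close>, so
  each prime factor, which at most doubles the number of divisors, pays for itself.\<close>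

lemma ndiv_large_primes:
  assumes "m > 0" "\<And>p. prime p \<Longrightarrow> p dvd m \<Longrightarrow> p \<ge> 2 ^ 16"
  shows "real (ndiv m) \<le> real m powr (1/16)"
  using assms
proof (induction m rule: less_induct)
  case (less m)
  show ?case
  proof (cases "m = 1")
    case True
    then show ?thesis by (simp add: ndiv_def)
  next
    case False
    then obtain p where p: "prime p" "p dvd m" using prime_factor_nat by blast
    then obtain k where k: "m = p * k" by (elim dvdE)
    have p16: "p \<ge> 2 ^ 16" using less.prems p by blast
    have k0: "k > 0" using less.prems k by simp
    have "k < m" using k k0 p prime_gt_1_nat[of p] by simp
    have IH: "real (ndiv k) \<le> real k powr (1/16)"
      using \<open>k < m\<close> k0 less.prems(2) k by (intro less.IH) auto
    have "ndiv m \<le> ndiv p * ndiv k" unfolding k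
      using k0 p prime_gt_0_nat by (intro ndiv_mult_le) auto
    also have "\<dots> \<le> 2 * ndiv k"
      using ndiv_prime_power_le[OF p(1), of 1] by (intro mult_right_mono) auto
    finally have "real (ndiv m) \<le> 2 * real (ndiv k)" by linarith
    also have "\<dots> \<le> real p powr (1/16) * real k powr (1/16)"
    proof (intro mult_mono IH)
      have "2 = (2 ^ 16 :: real) powr (1/16)"
        by (simp add: powr_realpow[symmetric] powr_powr del: of_nat_numeral)
      also have "\<dots> \<le> real p powr (1/16)"
        using p16 by (intro powr_mono2) (auto simp flip: of_nat_le_iff)
      finally show "2 \<le> real p powr (1/16)" .
    qed auto
    also have "\<dots> = real m powr (1/16)" by (simp add: k powr_mult)
    finally show ?thesis .
  qed
qed

text \<open>With \<open>x = a / 16 * ln 2\<close> one has \<open>exp x \<ge> 1 + x\<close>, and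
  \<open>ln 2 \<ge> 1 / 2\<close> gives \<open>x \<ge> a / 32\<close>. A small prime thus costs only
  a factor 32, whatever its exponent.\<close>

lemma exponent_le_powr:
  "real (a + 1) \<le> 32 * 2 powr (a / 16)"
proof -
  define x where "x = real a / 16 * ln 2"
  have "1 + x \<le> exp x" by (rule exp_ge_add_one_self)
  moreover have "ln 2 \<ge> (1/2::real)" using ln2_ge_two_thirds by simp
  then have "real a / 16 * (1/2) \<le> x" unfolding x_def by (intro mult_left_mono) auto
  ultimately have "real (a + 1) \<le> 32 * exp x" unfolding of_nat_add by linarith
  then show ?thesis by (simp add: powr_def x_def)
qed

text \<open>Induction over the small primes: splitting off the full power of one prime multiplies
  the constant by 32.\<close>

lemma divisor_bound_aux:
  assumes "finite P"
  shows "\<exists>C\<ge>1. \<forall>m>0. (\<forall>p. prime p \<longrightarrow> p dvd m \<longrightarrow> p \<in> P \<or> p \<ge> 2 ^ 16) \<longrightarrow>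
    real (ndiv m) \<le> C * real m powr (1/16)"
  using assms
proof (induction P)
  case empty
  show ?case using ndiv_large_primes by (intro exI[of _ 1]) auto
next
  case (insert q P)
  then obtain C where C: "C \<ge> 1" "\<And>m. m > 0 \<Longrightarrow> (\<forall>p. prime p \<longrightarrow> p dvd m \<longrightarrow> p \<in> P \<or> p \<ge> 2 ^ 16) \<Longrightarrow>
    real (ndiv m) \<le> C * real m powr (1/16)" by blast
  show ?case
  proof (rule exI[of _ "32 * C"], intro conjI allI impI)
    show "32 * C \<ge> 1" using C by simp
    fix m :: nat assume m: "m > 0" and hyp: "\<forall>p. prime p \<longrightarrow> p dvd m \<longrightarrow> p \<in> insert q P \<or> p \<ge> 2 ^ 16"
    show "real (ndiv m) \<le> 32 * C * real m powr (1/16)"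
    proof (cases "prime q")
      case False
      then have "real (ndiv m) \<le> C * real m powr (1/16)" using hyp m by (intro C(2)) auto
      also have "\<dots> \<le> 32 * C * real m powr (1/16)" using C(1) by (intro mult_right_mono) auto
      finally show ?thesis .
    next
      case True
      then obtain k where k: "m = q ^ multiplicity q m * k" "\<not> q dvd k"
        using m multiplicity_decompose'[of m q thesis] not_prime_unit[of q] True by blast
      define a where "a = multiplicity q m"
      have k0: "k > 0" and q2: "q \<ge> 2" using k m True prime_ge_2_nat by (auto intro: Nat.gr0I)
      have "ndiv m \<le> ndiv (q ^ a) * ndiv k"
        unfolding a_def using k0 q2 by (subst k(1), intro ndiv_mult_le) auto
      also have "\<dots> \<le> (a + 1) * ndiv k"
        using ndiv_prime_power_le[OF True] by (intro mult_right_mono) auto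
      finally have "real (ndiv m) \<le> real ((a + 1) * ndiv k)" by (simp only: of_nat_le_iff)
      also have "\<dots> = real (a + 1) * real (ndiv k)" by (rule of_nat_mult)
      also have "\<dots> \<le> (32 * 2 powr (a / 16)) * (C * real k powr (1/16))"
      proof (intro mult_mono exponent_le_powr C(2) k0 allI impI)
        fix p assume p: "prime p" "p dvd k"
        then have "p dvd m" by (subst k(1)) simp
        moreover have "p \<noteq> q" using p k by auto
        ultimately show "p \<in> P \<or> p \<ge> 2 ^ 16" using hyp p by auto
      qed auto
      also have "\<dots> \<le> (32 * real q powr (a / 16)) * (C * real k powr (1/16))"
        using q2 C(1) by (intro mult_right_mono mult_left_mono powr_mono2) auto
      also have "real q powr (a / 16) = real (q ^ a) powr (1/16)"
        using q2 by (simp add: powr_realpow[symmetric] powr_powr)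
      also have "(32 * real (q ^ a) powr (1/16)) * (C * real k powr (1/16)) =
          32 * C * real (q ^ a * k) powr (1/16)"
        by (simp add: powr_mult)
      also have "q ^ a * k = m" using k(1) by (simp add: a_def)
      finally show ?thesis .
    qed
  qed
qed

theorem divisor_bound:
  obtains C where "C \<ge> 1" "\<And>m. m > 0 \<Longrightarrow> real (ndiv m) \<le> C * real m powr (1/16)"
proof -
  have "finite {p::nat. p < 2 ^ 16}" by simp
  from divisor_bound_aux[OF this] obtain C where C: "C \<ge> 1"
    "\<And>m. m > 0 \<Longrightarrow> (\<forall>p. prime p \<longrightarrow> p dvd m \<longrightarrow> p \<in> {p. p < 2 ^ 16} \<or> p \<ge> 2 ^ 16)
      \<Longrightarrow> real (ndiv m) \<le> C * real m powr (1/16)"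
    by blast
  show ?thesis
  proof (rule that[OF C(1) C(2)])
    have "p < b \<or> p \<ge> b" for p b :: nat by linarith
    then show "\<forall>p. prime p \<longrightarrow> p dvd m \<longrightarrow> p \<in> {p. p < 2 ^ 16} \<or> p \<ge> 2 ^ 16" for m :: nat
      unfolding mem_Collect_eq by blast
  qed
qed

section \<open>Square roots of one and matrices congruent to scalars\<close>

definition sq1 :: "int \<Rightarrow> int set" where
  "sq1 N = {t \<in> {0..<N}. N dvd t * t - 1}"

text \<open>For a root \<open>t\<close> put \<open>E = gcd (t - 1) N\<close> and
  \<open>M = N / E\<close>. Then \<open>t\<close> is 1 modulo \<open>E\<close> and -1 modulo
  \<open>M\<close>, which fixes it modulo \<open>lcm E M\<close>. As \<open>gcd E M\<close> divides
  2, this modulus is at least \<open>N / 2\<close>, so each divisor \<open>E\<close> of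
  \<open>N\<close> belongs to at most three roots.\<close>

lemma card_sq1:
  assumes N: "N > 0"
  shows "card (sq1 N) \<le> 3 * ndiv (nat N)"
proof -
  let ?e = "\<lambda>t. nat (gcd (t - 1) N)"
  have fin: "finite (sq1 N)" unfolding sq1_def by (rule finite_subset[of _ "{0..<N}"]) auto
  have img: "?e ` sq1 N \<subseteq> {d. d dvd nat N}"
  proof (rule image_subsetI)
    fix t
    have "nat (gcd (t - 1) N) dvd nat N" using N by (simp add: nat_dvd_iff)
    then show "?e t \<in> {d. d dvd nat N}" by simp
  qed
  have fib: "card {t \<in> sq1 N. ?e t = e} \<le> 3" for e
  proof (cases "{t \<in> sq1 N. ?e t = e} = {}")
    case True
    show ?thesis unfolding True by simp
  next
    case False
    then obtain t0 where t0: "t0 \<in> sq1 N" "?e t0 = e" by blast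
    define E where "E = int e"
    have E: "gcd (t0 - 1) N = E" unfolding E_def t0(2)[symmetric] by simp
    have E0: "E > 0" unfolding E[symmetric] using N by (simp add: gcd_pos_int)
    have "E dvd N" unfolding E[symmetric] by (rule gcd_dvd2)
    then obtain M where M: "N = E * M" by (elim dvdE)
    have key: "E dvd t - 1 \<and> M dvd t + 1" if t: "t \<in> sq1 N" "?e t = e" for t
    proof
      have Et: "gcd (t - 1) N = E" unfolding E_def t(2)[symmetric] by simp
      show Edvd: "E dvd t - 1" unfolding Et[symmetric] by (rule gcd_dvd1)
      then obtain s where s: "t - 1 = E * s" by (elim dvdE)
      have "E * gcd s M = E" using Et E0 gcd_mult_distrib_int[of E s M] unfolding s M by simp
      then have "gcd s M = 1" using E0 by simp
      then have "coprime M s" by (simp add: coprime_iff_gcd_eq_1[symmetric] coprime_commute)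
      have "t * t - 1 = (t - 1) * (t + 1)" by (simp add: algebra_simps)
      then have "E * M dvd E * (s * (t + 1))"
        using t unfolding sq1_def s M by (simp add: mult.assoc)
      then have "M dvd s * (t + 1)" using E0 by simp
      with \<open>coprime M s\<close> show "M dvd t + 1" by (simp add: coprime_dvd_mult_right_iff)
    qed
    define L where "L = lcm E M"
    have "gcd E M dvd t0 - 1" "gcd E M dvd t0 + 1"
      using key[OF t0] dvd_trans[OF gcd_dvd1[of E M], of "t0 - 1"]
        dvd_trans[OF gcd_dvd2[of E M], of "t0 + 1"] by blast+
    then have "gcd E M dvd (t0 + 1) - (t0 - 1)" by (rule dvd_diff[rotated])
    then have "gcd E M dvd 2" by simp
    then have "gcd E M \<le> 2" by (rule zdvd_imp_le) simp
    have M0: "M > 0" using M N E0 by (simp add: zero_less_mult_iff)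
    have gL: "gcd E M * L = N" unfolding L_def using E0 M0 M prod_gcd_lcm_int[of E M] by simp
    have "L \<ge> 0" by (simp add: L_def)
    then have L2: "N \<le> 2 * L" unfolding gL[symmetric] using \<open>gcd E M \<le> 2\<close> by (intro mult_right_mono)
    have "{t \<in> sq1 N. ?e t = e} \<subseteq> {t0 - L, t0, t0 + L}"
    proof
      fix t assume t: "t \<in> {t \<in> sq1 N. ?e t = e}"
      have "E dvd t - t0" "M dvd t - t0"
        using key[of t] key[OF t0] t dvd_diff[of E "t - 1" "t0 - 1"] dvd_diff[of M "t + 1" "t0 + 1"] by auto
      then have "L dvd t - t0" unfolding L_def by (rule lcm_least)
      then obtain c where c: "t - t0 = L * c" by (elim dvdE)
      have "\<bar>t - t0\<bar> < N" using t t0 by (auto simp: sq1_def)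
      then have "L * \<bar>c\<bar> < L * 2" using c L2 \<open>L \<ge> 0\<close> by (simp add: abs_mult)
      then have "\<bar>c\<bar> < 2" using \<open>L \<ge> 0\<close> by (simp add: mult_less_cancel_left)
      then have "c = -1 \<or> c = 0 \<or> c = 1" by linarith
      then show "t \<in> {t0 - L, t0, t0 + L}" using c by auto
    qed
    then have "card {t \<in> sq1 N. ?e t = e} \<le> card {t0 - L, t0, t0 + L}" by (intro card_mono) auto
    also have "\<dots> \<le> 3" by (simp add: card_insert_if)
    finally show ?thesis .
  qed
  have "card (sq1 N) = (\<Sum>e\<in>{d. d dvd nat N}. card {t \<in> sq1 N. ?e t = e})"
    using sum.group[OF fin _ img, of "\<lambda>_. 1::nat"] N by simp
  also have "\<dots> \<le> (\<Sum>e\<in>{d. d dvd nat N}. 3)" by (intro sum_mono fib)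
  finally show ?thesis by (simp add: ndiv_def)
qed


definition scal :: "int \<Rightarrow> mat2 \<Rightarrow> bool" where
  "scal N g \<longleftrightarrow> N dvd m12 g \<and> N dvd m21 g \<and> N dvd m11 g - m22 g"

lemma sum_inverse_symmetric:
  assumes "R \<ge> 0"
  shows "(\<Sum>x\<in>{-R..R}. 1 / real_of_int (max 1 \<bar>x\<bar>)) = 1 + 2 * harm (nat R)"
proof -
  have harmR: "(\<Sum>i\<in>{1..R}. 1 / real_of_int i) = harm (nat R)"
    using assms by (simp add: harm_eq_sum_int)
  have "{-R..R} = insert 0 ({1..R} \<union> {-R..-1})" using assms by auto
  then have "(\<Sum>x\<in>{-R..R}. 1 / real_of_int (max 1 \<bar>x\<bar>)) =
      1 + (\<Sum>x\<in>{1..R} \<union> {-R..-1}. 1 / real_of_int (max 1 \<bar>x\<bar>))"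
    by simp
  also have "(\<Sum>x\<in>{1..R} \<union> {-R..-1}. 1 / real_of_int (max 1 \<bar>x\<bar>)) =
      (\<Sum>x\<in>{1..R}. 1 / real_of_int (max 1 \<bar>x\<bar>)) + (\<Sum>x\<in>{-R..-1}. 1 / real_of_int (max 1 \<bar>x\<bar>))"
    by (rule sum.union_disjoint) auto
  also have "(\<Sum>x\<in>{-R..-1}. 1 / real_of_int (max 1 \<bar>x\<bar>)) = (\<Sum>x\<in>{1..R}. 1 / real_of_int (max 1 \<bar>x\<bar>))"
    by (rule sum.reindex_bij_witness[of _ uminus uminus]) auto
  also have "(\<Sum>x\<in>{1..R}. 1 / real_of_int (max 1 \<bar>x\<bar>)) = (\<Sum>x\<in>{1..R}. 1 / real_of_int x)"
    by (rule sum.cong) auto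
  finally show ?thesis using harmR by simp
qed

text \<open>If the diagonal product is 1, the off-diagonal product is 0 and counting divisors says
  nothing. But the matrix is then triangular with equal diagonal entries 1 or -1: a sign, a side and
  one free entry, hence four sums of harmonic type.\<close>

lemma scal_sum_diag_one:
  fixes R :: int
  assumes R: "R \<ge> 0"
  shows "(\<Sum>g\<in>{g \<in> SL2. nm g \<le> R \<and> m11 g * m22 g = 1}. 1 / real_of_int (nm g)) \<le> 4 * (1 + 2 * harm (nat R))"
proof -
  let ?f = "\<lambda>(s::int, t::bool, x). if t then Mat s x 0 s else Mat s 0 x s"
  let ?I = "{1, -1 :: int} \<times> (UNIV :: bool set) \<times> {-R..R}"
  let ?S = "{g \<in> SL2. nm g \<le> R \<and> m11 g * m22 g = 1}"
  have sub: "?S \<subseteq> ?f ` ?I"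
  proof
    fix g assume g: "g \<in> ?S"
    then have ad: "m11 g * m22 g = 1" and bc: "m12 g * m21 g = 0" by (auto simp: SL2_def det2_def)
    then have a: "(m11 g = 1 \<or> m11 g = -1) \<and> m22 g = m11 g" using zmult_eq_1_iff[of "m11 g" "m22 g"] by auto
    have "\<bar>m12 g\<bar> \<le> R" "\<bar>m21 g\<bar> \<le> R" using g nm_entries[of g] by auto
    show "g \<in> ?f ` ?I"
    proof (cases "m21 g = 0")
      case True
      then have "g = ?f (m11 g, True, m12 g)" using a by (cases g) auto
      moreover have "(m11 g, True, m12 g) \<in> ?I" using a \<open>\<bar>m12 g\<bar> \<le> R\<close> by auto
      ultimately show ?thesis by (rule image_eqI)
    next
      case False
      then have "g = ?f (m11 g, False, m21 g)" using a bc by (cases g) auto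
      moreover have "(m11 g, False, m21 g) \<in> ?I" using a \<open>\<bar>m21 g\<bar> \<le> R\<close> by auto
      ultimately show ?thesis by (rule image_eqI)
    qed
  qed
  have "(\<Sum>g\<in>?S. 1 / real_of_int (nm g)) \<le> (\<Sum>g\<in>?f ` ?I. 1 / real_of_int (nm g))"
    by (rule sum_mono2) (use sub in auto)
  also have "\<dots> \<le> (\<Sum>p\<in>?I. 1 / real_of_int (nm (?f p)))"
    by (rule sum_image_le[of ?I "\<lambda>g. 1 / real_of_int (nm g)" ?f, unfolded comp_def]) auto
  also have "\<dots> = (\<Sum>s\<in>{1, -1}. \<Sum>t\<in>(UNIV :: bool set). \<Sum>x\<in>{-R..R}. 1 / real_of_int (nm (?f (s, t, x))))"
    unfolding sum.cartesian_product by (rule sum.cong) auto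
  also have "\<dots> = (\<Sum>s\<in>{1, -1::int}. \<Sum>t\<in>(UNIV :: bool set). \<Sum>x\<in>{-R..R}. 1 / real_of_int (max 1 \<bar>x\<bar>))"
    by (intro sum.cong refl) (auto simp: nm_def max_def)
  also have "\<dots> = 4 * (1 + 2 * harm (nat R))"
    by (simp add: sum_inverse_symmetric[OF R] UNIV_bool)
  finally show ?thesis .
qed

text \<open>The determinant fixes the off-diagonal product, which is nonzero; one entry is a divisor
  of it up to sign and determines the other.\<close>

lemma card_fixed_diagonal:
  assumes "a * d \<noteq> (1::int)"
  shows "finite {g \<in> SL2. m11 g = a \<and> m22 g = d}"
    and "card {g \<in> SL2. m11 g = a \<and> m22 g = d} \<le> 2 * ndiv (nat \<bar>a * d - 1\<bar>)"
proof -
  define k where "k = a * d - 1"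
  let ?S = "{g \<in> SL2. m11 g = a \<and> m22 g = d}"
  let ?f = "\<lambda>(s::int, x::nat). Mat a (s * int x) (k div (s * int x)) d"
  let ?I = "{1, -1 :: int} \<times> {x. x dvd nat \<bar>k\<bar>}"
  have k: "k \<noteq> 0" using assms by (simp add: k_def)
  then have fin: "finite ?I" by (intro finite_cartesian_product finite_divisors_nat) auto
  have sub: "?S \<subseteq> ?f ` ?I"
  proof
    fix g assume g: "g \<in> ?S"
    then have bc: "m12 g * m21 g = k" by (auto simp: SL2_def det2_def k_def)
    define s :: int where "s = (if m12 g > 0 then 1 else -1)"
    define x where "x = nat \<bar>m12 g\<bar>"
    have b: "m12 g \<noteq> 0" using bc k by auto
    have sx: "s * int x = m12 g" using b by (auto simp: s_def x_def)
    have "m12 g dvd k" using bc by auto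
    then have "x dvd nat \<bar>k\<bar>" unfolding x_def by (simp add: nat_dvd_iff)
    then have "(s, x) \<in> ?I" by (auto simp: s_def)
    moreover have "g = ?f (s, x)" using g bc[symmetric] b sx by (cases g) auto
    ultimately show "g \<in> ?f ` ?I" by (intro image_eqI)
  qed
  from sub show "finite ?S" using fin by (rule finite_surj[rotated])
  have "card ?S \<le> card ?I" by (rule surj_card_le[OF fin sub])
  then show "card ?S \<le> 2 * ndiv (nat \<bar>a * d - 1\<bar>)"
    by (simp add: card_cartesian_product ndiv_def k_def)
qed

lemma card_residue_interval:
  fixes A q d0 :: int
  assumes "A \<ge> 0" "q > 0"
  shows "real (card {d \<in> {-A..A}. [d = d0] (mod q)}) \<le> 2 * A / q + 1"
proof (cases "{d \<in> {-A..A}. [d = d0] (mod q)} = {}")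
  case True
  show ?thesis unfolding True using assms by simp
next
  case False
  let ?S = "{d \<in> {-A..A}. [d = d0] (mod q)}"
  have fin: "finite ?S" by (rule finite_subset[of _ "{-A..A}"]) auto
  define e where "e = Min ?S"
  have e: "e \<in> ?S" unfolding e_def using fin False by (rule Min_in)
  have "?S \<subseteq> (\<lambda>j. e + q * j) ` {0..2 * A div q}"
  proof
    fix d assume d: "d \<in> ?S"
    have "[d = e] (mod q)" using d e by (auto intro: cong_trans cong_sym)
    then have "q dvd d - e" by (simp add: cong_iff_dvd_diff)
    then obtain j where j: "d - e = q * j" by (elim dvdE)
    have "e \<le> d" unfolding e_def using fin d by (rule Min_le)
    then have "0 \<le> q * j" using j by linarith
    then have j0: "0 \<le> j" using assms by (simp add: zero_le_mult_iff)
    have "q * j \<le> 2 * A" unfolding j[symmetric] using d e by auto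
    then have "j \<le> 2 * A div q" using zdiv_mono1[of "q * j" "2 * A" q] assms by simp
    then show "d \<in> (\<lambda>j. e + q * j) ` {0..2 * A div q}" using j j0 by (intro image_eqI[of _ _ j]) auto
  qed
  then have "card ?S \<le> card {0..2 * A div q}" by (rule surj_card_le[rotated]) simp
  then have "real (card ?S) \<le> real (card {0..2 * A div q})" by (simp only: of_nat_le_iff)
  also have "\<dots> = real_of_int (2 * A div q) + 1" using assms by (simp add: pos_imp_zdiv_nonneg_iff)
  also have "\<dots> \<le> 2 * A / q + 1" using real_of_int_div4[of "2 * A" q] by simp
  finally show ?thesis .
qed


text \<open>Such an \<open>a\<close> is determined by its sign, the residue of
  \<open>\<bar>a\<bar>\<close>, which is a root of 1, and the quotient by \<open>N\<close>. The
  condition \<open>N \<le> 2 * \<bar>a\<bar>\<close> serves the quotient 0, whose terms then weigh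
  at most \<open>2 / N\<close>.\<close>

lemma sum_inverse_roots:
  fixes N R :: int
  assumes N: "N \<ge> 2" and R: "R \<ge> 0"
  shows "(\<Sum>a\<in>{a \<in> {-R..R}. N dvd a * a - 1 \<and> N \<le> 2 * \<bar>a\<bar>}. 1 / real_of_int \<bar>a\<bar>)
    \<le> 4 * card (sq1 N) / N * (1 + harm (nat R))"
proof -
  let ?A = "{a \<in> {-R..R}. N dvd a * a - 1 \<and> N \<le> 2 * \<bar>a\<bar>}"
  let ?k = "\<lambda>a. (a > 0, \<bar>a\<bar> mod N, \<bar>a\<bar> div N)"
  let ?I = "(UNIV :: bool set) \<times> sq1 N \<times> {0..R}"
  let ?w = "\<lambda>j. 2 / real_of_int N * (1 / real_of_int (max 1 j))"
  have finA: "finite ?A" by (rule finite_subset[of _ "{-R..R}"]) auto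
  have fin1: "finite (sq1 N)" unfolding sq1_def by (rule finite_subset[of _ "{0..<N}"]) auto
  have inj: "inj_on ?k ?A"
  proof (rule inj_onI)
    fix a b assume ab: "a \<in> ?A" "b \<in> ?A" "?k a = ?k b"
    then have "\<bar>a\<bar> div N = \<bar>b\<bar> div N" "\<bar>a\<bar> mod N = \<bar>b\<bar> mod N" by simp_all
    then have "\<bar>a\<bar> = \<bar>b\<bar>"
      using mult_div_mod_eq[of N "\<bar>a\<bar>"] mult_div_mod_eq[of N "\<bar>b\<bar>"] by argo
    moreover have "(a > 0) = (b > 0)" using ab by simp
    moreover have "a \<noteq> 0" "b \<noteq> 0" using ab N by auto
    ultimately show "a = b" by linarith
  qed
  have sub: "?k ` ?A \<subseteq> ?I"
  proof (rule image_subsetI)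
    fix a assume a: "a \<in> ?A"
    let ?t = "\<bar>a\<bar> mod N"
    have "[?t * ?t - 1 = \<bar>a\<bar> * \<bar>a\<bar> - 1] (mod N)"
      by (intro cong_diff cong_mult cong_refl) (auto simp: cong_unfold)
    moreover have "N dvd \<bar>a\<bar> * \<bar>a\<bar> - 1" using a by simp
    ultimately have "N dvd ?t * ?t - 1" using cong_dvd_iff by blast
    moreover have "\<bar>a\<bar> div N \<le> \<bar>a\<bar>" using N zdiv_mono2[of "\<bar>a\<bar>" 1 N] by simp
    moreover have "\<bar>a\<bar> div N \<ge> 0" using N by (simp add: pos_imp_zdiv_nonneg_iff)
    moreover have "\<bar>a\<bar> \<le> R" using a by auto
    ultimately show "?k a \<in> ?I" using N by (auto simp: sq1_def)
  qed
  have "(\<Sum>a\<in>?A. 1 / real_of_int \<bar>a\<bar>) \<le> (\<Sum>a\<in>?A. ?w (snd (snd (?k a))))"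
  proof (rule sum_mono)
    fix a assume a: "a \<in> ?A"
    let ?j = "\<bar>a\<bar> div N"
    have "N * max 1 ?j \<le> 2 * \<bar>a\<bar>"
    proof (cases "?j \<ge> 1")
      case True
      have "N * ?j \<le> \<bar>a\<bar>" using N mult_div_mod_eq[of N "\<bar>a\<bar>"] pos_mod_sign[of N "\<bar>a\<bar>"] by linarith
      with True show ?thesis by (simp add: max_absorb2)
    next
      case False
      then show ?thesis using a by (simp add: max_absorb1)
    qed
    then have "real_of_int (N * max 1 ?j) \<le> real_of_int (2 * \<bar>a\<bar>)" by (simp only: of_int_le_iff)
    then have "real_of_int N * real_of_int (max 1 ?j) \<le> 2 * real_of_int \<bar>a\<bar>" by (simp only: of_int_mult of_int_numeral)
    moreover have "real_of_int N * real_of_int (max 1 ?j) > 0" using N by (intro mult_pos_pos) auto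
    moreover have "real_of_int \<bar>a\<bar> > 0" using a N by auto
    ultimately have "1 / real_of_int \<bar>a\<bar> \<le> 2 / (real_of_int N * real_of_int (max 1 ?j))"
      by (simp add: divide_simps)
    then show "1 / real_of_int \<bar>a\<bar> \<le> ?w (snd (snd (?k a)))" by simp
  qed
  also have "\<dots> = (\<Sum>p\<in>?k ` ?A. ?w (snd (snd p)))"
    using inj by (simp only: sum.reindex comp_def)
  also have "\<dots> \<le> (\<Sum>p\<in>?I. ?w (snd (snd p)))"
    by (rule sum_mono2) (use sub fin1 N in auto)
  also have "\<dots> = (\<Sum>t\<in>(UNIV::bool set). \<Sum>s\<in>sq1 N. \<Sum>j\<in>{0..R}. ?w j)"
    unfolding sum.cartesian_product by (rule sum.cong) auto
  also have "\<dots> = 2 * (real (card (sq1 N)) * (2 / real_of_int N * (\<Sum>j\<in>{0..R}. 1 / real_of_int (max 1 j))))"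
    by (simp add: UNIV_bool sum_distrib_left)
  also have "(\<Sum>j\<in>{0..R}. 1 / real_of_int (max 1 j)) = 1 + harm (nat R)"
  proof -
    have "{0..R} = insert 0 {1..R}" using R by auto
    moreover have "(\<Sum>j\<in>{1..R}. 1 / real_of_int (max 1 j)) = harm (nat R)"
      using R by (simp add: harm_eq_sum_int)
    ultimately show ?thesis by simp
  qed
  also have "2 * (real (card (sq1 N)) * (2 / real_of_int N * (1 + harm (nat R)))) =
      4 * card (sq1 N) / N * (1 + harm (nat R))"
    by simp
  finally show ?thesis .
qed

text \<open>Let the rows be \<open>(a, b)\<close> and \<open>(c, d)\<close>. As \<open>N^2\<close>
  divides \<open>b * c\<close>, the product \<open>a * d\<close> is 1 modulo \<open>N^2\<close>; as
  \<open>a\<close> and \<open>d\<close> agree modulo \<open>N\<close>, \<open>a\<close> is a square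
  root of 1 modulo \<open>N\<close>. Given \<open>a\<close>, the entry \<open>d\<close> lies in a
  single class modulo \<open>N^2\<close>; given both, the divisor bound counts the pairs
  \<open>(b, c)\<close>. The case \<open>a * d = 1\<close> is counted apart.\<close>

theorem scal_sum:
  fixes N R :: int and D :: real
  assumes N: "N \<ge> 2" and R: "R \<ge> 0"
    and D: "\<And>k. k > 0 \<Longrightarrow> int k \<le> R * R + 1 \<Longrightarrow> real (ndiv k) \<le> D" and D0: "D \<ge> 0"
  shows "(\<Sum>g\<in>{g \<in> SL2. nm g \<le> R \<and> scal N g}. 1 / real_of_int (nm g))
    \<le> 4 * (1 + 2 * harm (nat R)) +
       16 * D * card (sq1 N) * (1 + harm (nat R)) * ((2 * R / N ^ 2 + 1) / N)"
proof -
  let ?H = "harm (nat R) :: real"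
  let ?S = "{g \<in> SL2. nm g \<le> R \<and> scal N g}"
  let ?S1 = "{g \<in> SL2. nm g \<le> R \<and> m11 g * m22 g = 1}"
  let ?S2 = "{g \<in> SL2. nm g \<le> R \<and> scal N g \<and> m11 g * m22 g \<noteq> 1}"
  let ?A = "{a \<in> {-R..R}. N dvd a * a - 1 \<and> N \<le> 2 * \<bar>a\<bar>}"
  define PP where "PP = {(a, d) \<in> {-R..R} \<times> {-R..R}. N dvd a - d \<and> N * N dvd a * d - 1 \<and> a * d \<noteq> 1}"
  \<comment> \<open>By symmetry the first diagonal entry may be taken as the larger one; the weight
    is then the reciprocal of its absolute value.\<close>
  define P1 where "P1 = {p \<in> PP. \<bar>snd p\<bar> \<le> \<bar>fst p\<bar>}"
  define P2 where "P2 = {p \<in> PP. \<bar>fst p\<bar> \<le> \<bar>snd p\<bar>}"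
  let ?m = "\<lambda>p. real_of_int (max \<bar>fst p\<bar> \<bar>snd p\<bar>)"
  have fin: "finite {g \<in> SL2. nm g \<le> R \<and> Q g}" for Q
    by (rule finite_subset[OF _ finite_nm_le[of R]]) auto
  have finPP: "finite PP" unfolding PP_def by (rule finite_subset[of _ "{-R..R} \<times> {-R..R}"]) auto
  have finA: "finite ?A" by (rule finite_subset[of _ "{-R..R}"]) auto
  have PPpos: "max \<bar>fst p\<bar> \<bar>snd p\<bar> \<ge> 1" if "p \<in> PP" for p
  proof (rule ccontr)
    assume "\<not> ?thesis"
    then have "fst p = 0" "snd p = 0" by auto
    with that have "N * N dvd 1" by (auto simp: PP_def)
    then have "N dvd 1" by (rule dvd_mult_left)
    then show False using N by auto
  qed
  have memP: "(m11 g, m22 g) \<in> PP" if g: "g \<in> ?S2" for g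
  proof -
    have "N * N dvd m12 g * m21 g" using g by (intro mult_dvd_mono) (auto simp: scal_def)
    moreover have "m12 g * m21 g = m11 g * m22 g - 1" using g by (auto simp: SL2_def det2_def)
    moreover have "\<bar>m11 g\<bar> \<le> R" "\<bar>m22 g\<bar> \<le> R" using g nm_entries[of g] by auto
    ultimately show ?thesis using g by (auto simp: PP_def scal_def)
  qed
  have "(\<Sum>g\<in>?S2. 1 / real_of_int (nm g)) \<le> (\<Sum>g\<in>?S2. 1 / ?m (m11 g, m22 g))"
  proof (rule sum_mono)
    fix g assume g: "g \<in> ?S2"
    have "max \<bar>m11 g\<bar> \<bar>m22 g\<bar> \<le> nm g" by (auto simp: nm_entries)
    moreover have "max \<bar>m11 g\<bar> \<bar>m22 g\<bar> \<ge> 1" using PPpos[OF memP[OF g]] by simp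
    ultimately show "1 / real_of_int (nm g) \<le> 1 / ?m (m11 g, m22 g)"
      unfolding fst_conv snd_conv by (intro divide_left_mono mult_pos_pos) linarith+
  qed
  also have "\<dots> = (\<Sum>p\<in>PP. \<Sum>g\<in>{g \<in> ?S2. (m11 g, m22 g) = p}. 1 / ?m (m11 g, m22 g))"
    by (rule sum.group[symmetric]) (use fin finPP memP in auto)
  also have "\<dots> \<le> (\<Sum>p\<in>PP. 2 * D * (1 / ?m p))"
  proof (rule sum_mono)
    fix p assume p: "p \<in> PP"
    obtain a d where ad: "p = (a, d)" by (cases p)
    let ?F = "{g \<in> ?S2. (m11 g, m22 g) = p}"
    have ne: "a * d \<noteq> 1" and le: "\<bar>a\<bar> \<le> R" "\<bar>d\<bar> \<le> R" using p by (auto simp: PP_def ad)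
    have "card ?F \<le> card {g \<in> SL2. m11 g = a \<and> m22 g = d}"
      using card_fixed_diagonal(1)[OF ne] by (intro card_mono) (auto simp: ad)
    also have "\<dots> \<le> 2 * ndiv (nat \<bar>a * d - 1\<bar>)" by (rule card_fixed_diagonal(2)[OF ne])
    finally have "real (card ?F) \<le> 2 * real (ndiv (nat \<bar>a * d - 1\<bar>))" by linarith
    also have "real (ndiv (nat \<bar>a * d - 1\<bar>)) \<le> D"
    proof (rule D)
      have "\<bar>a * d\<bar> \<le> R * R" unfolding abs_mult using le by (intro mult_mono) auto
      then show "int (nat \<bar>a * d - 1\<bar>) \<le> R * R + 1" by simp
    qed (use ne in simp)
    finally have card: "real (card ?F) \<le> 2 * D" by simp
    have "(\<Sum>g\<in>?F. 1 / ?m (m11 g, m22 g)) = real (card ?F) * (1 / ?m p)"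
      by (subst sum.cong[OF refl, of _ _ "\<lambda>_. 1 / ?m p"]) auto
    also have "\<dots> \<le> 2 * D * (1 / ?m p)"
      using card by (intro mult_right_mono) auto
    finally show "(\<Sum>g\<in>?F. 1 / ?m (m11 g, m22 g)) \<le> 2 * D * (1 / ?m p)" .
  qed
  also have "\<dots> = 2 * D * (\<Sum>p\<in>PP. 1 / ?m p)" by (simp add: sum_distrib_left)
  also have "(\<Sum>p\<in>PP. 1 / ?m p) \<le> 2 * (\<Sum>p\<in>P1. 1 / real_of_int \<bar>fst p\<bar>)"
  proof -
    have "PP = P1 \<union> P2" unfolding P1_def P2_def by (auto intro: linorder_le_cases)
    then have "(\<Sum>p\<in>PP. 1 / ?m p) \<le> (\<Sum>p\<in>P1. 1 / ?m p) + (\<Sum>p\<in>P2. 1 / ?m p)"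
      using finPP by (subst sum.union_inter[symmetric]) (auto simp: P1_def P2_def intro!: sum_nonneg)
    also have "(\<Sum>p\<in>P2. 1 / ?m p) = (\<Sum>p\<in>P1. 1 / ?m p)"
      by (rule sum.reindex_bij_witness[of _ prod.swap prod.swap])
        (auto simp: P1_def P2_def PP_def max.commute mult.commute dvd_diff_commute)
    also have "(\<Sum>p\<in>P1. 1 / ?m p) = (\<Sum>p\<in>P1. 1 / real_of_int \<bar>fst p\<bar>)"
      by (rule sum.cong) (auto simp: P1_def)
    finally show ?thesis by simp
  qed
  also have "(\<Sum>p\<in>P1. 1 / real_of_int \<bar>fst p\<bar>) \<le> (2 * R / N ^ 2 + 1) * (\<Sum>a\<in>?A. 1 / real_of_int \<bar>a\<bar>)"
  proof -
    have fA: "fst p \<in> ?A" if p: "p \<in> P1" for p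
    proof -
      obtain a d where ad: "p = (a, d)" by (cases p)
      have h: "N dvd a - d" "N * N dvd a * d - 1" "a * d \<noteq> 1" "\<bar>d\<bar> \<le> \<bar>a\<bar>" "\<bar>a\<bar> \<le> R"
        using p by (auto simp: P1_def PP_def ad)
      have "N dvd a * (a - d) + (a * d - 1)"
        using h(1) dvd_mult_left[OF h(2)] by (intro dvd_add dvd_mult)
      then have "N dvd a * a - 1" by (simp add: algebra_simps)
      moreover have "N * N \<le> \<bar>a * d - 1\<bar>" using h(2,3) by (intro zdvd_imp_le) auto
      then have NN: "N * N \<le> \<bar>a\<bar> * \<bar>d\<bar> + 1" by (simp add: abs_mult[symmetric])
      \<comment> \<open>The nonzero multiple \<open>a * d - 1\<close> of \<open>N * N\<close> has
        absolute value at most \<open>a * a + 1\<close>, since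
        \<open>\<bar>d\<bar> \<le> \<bar>a\<bar>\<close>; so \<open>\<bar>a\<bar>\<close> cannot be
        much below \<open>N\<close>.\<close>
      have "N \<le> 2 * \<bar>a\<bar>"
      proof (rule ccontr)
        assume "\<not> N \<le> 2 * \<bar>a\<bar>"
        then have lt: "2 * \<bar>a\<bar> + 1 \<le> N" by simp
        have "\<bar>a\<bar> * \<bar>d\<bar> \<le> \<bar>a\<bar> * \<bar>a\<bar>" using h by (intro mult_left_mono) auto
        moreover have "(2 * \<bar>a\<bar> + 1) * (2 * \<bar>a\<bar> + 1) \<le> N * N" using lt by (intro mult_mono) auto
        moreover have "(2 * \<bar>a\<bar> + 1) * (2 * \<bar>a\<bar> + 1) = 4 * (\<bar>a\<bar> * \<bar>a\<bar>) + 4 * \<bar>a\<bar> + 1" by (simp add: algebra_simps)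
        moreover have "\<bar>a\<bar> * \<bar>a\<bar> \<ge> 0" by simp
        ultimately have "\<bar>a\<bar> * \<bar>a\<bar> = 0" "N * N \<le> 1" using NN by linarith+
        moreover have "2 * 2 \<le> N * N" using N by (intro mult_mono) auto
        ultimately show False by simp
      qed
      ultimately show ?thesis using h by (auto simp: ad)
    qed
    have "(\<Sum>p\<in>P1. 1 / real_of_int \<bar>fst p\<bar>) = (\<Sum>a\<in>?A. \<Sum>p\<in>{p \<in> P1. fst p = a}. 1 / real_of_int \<bar>fst p\<bar>)"
      by (rule sum.group[symmetric]) (use finPP finA fA in \<open>auto simp: P1_def\<close>)
    also have "\<dots> \<le> (\<Sum>a\<in>?A. (2 * R / N ^ 2 + 1) * (1 / real_of_int \<bar>a\<bar>))"
    proof (rule sum_mono)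
      fix a assume a: "a \<in> ?A"
      let ?F = "{p \<in> P1. fst p = a}"
      have cardF: "real (card ?F) \<le> 2 * R / N ^ 2 + 1"
      proof (cases "?F = {}")
        case True
        show ?thesis unfolding True using R by simp
      next
        case False
        then obtain d0 where d0: "(a, d0) \<in> P1" by auto
        let ?T = "{d \<in> {-R..R}. [d = d0] (mod (N * N))}"
        have "?F \<subseteq> Pair a ` ?T"
        proof
          fix p assume p: "p \<in> ?F"
          then obtain d where d: "p = (a, d)" by (cases p) auto
          have "N * N dvd a * d - 1" "N * N dvd a * d0 - 1" "\<bar>d\<bar> \<le> R"
            using p d0 by (auto simp: d P1_def PP_def)
          then have "[a * d = 1] (mod (N * N))" "[a * d0 = 1] (mod (N * N))"
            by (auto simp: cong_iff_dvd_diff)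
          then have "[a * d = a * d0] (mod (N * N))" "coprime a (N * N)"
            using cong_trans cong_sym coprime_iff_invertible_int by blast+
          then have "[d = d0] (mod (N * N))" by (simp only: cong_mult_lcancel)
          with \<open>\<bar>d\<bar> \<le> R\<close> show "p \<in> Pair a ` ?T" by (auto simp: d)
        qed
        moreover have "finite ?T" by (rule finite_subset[of _ "{-R..R}"]) auto
        ultimately have "card ?F \<le> card ?T" by (rule surj_card_le[rotated])
        then have "real (card ?F) \<le> real (card ?T)" by simp
        also have "\<dots> \<le> 2 * R / (N * N) + 1"
          using card_residue_interval[OF R, of "N * N" d0] N by simp
        finally show ?thesis by (simp add: power2_eq_square)
      qed
      have "(\<Sum>p\<in>?F. 1 / real_of_int \<bar>fst p\<bar>) = real (card ?F) * (1 / real_of_int \<bar>a\<bar>)"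
        by (subst sum.cong[OF refl, of _ _ "\<lambda>_. 1 / real_of_int \<bar>a\<bar>"]) auto
      also have "\<dots> \<le> (2 * R / N ^ 2 + 1) * (1 / real_of_int \<bar>a\<bar>)"
        using cardF by (intro mult_right_mono) auto
      finally show "(\<Sum>p\<in>?F. 1 / real_of_int \<bar>fst p\<bar>) \<le> (2 * R / N ^ 2 + 1) * (1 / real_of_int \<bar>a\<bar>)" .
    qed
    finally show ?thesis by (simp only: sum_distrib_left)
  qed
  also have "(\<Sum>a\<in>?A. 1 / real_of_int \<bar>a\<bar>) \<le> 4 * card (sq1 N) / N * (1 + ?H)"
    by (rule sum_inverse_roots[OF N R])
  finally have S2: "(\<Sum>g\<in>?S2. 1 / real_of_int (nm g)) \<le>
      2 * D * (2 * ((2 * R / N ^ 2 + 1) * (4 * card (sq1 N) / N * (1 + ?H))))"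
    using D0 R N by (simp add: mult_left_mono)
  have "(\<Sum>g\<in>?S. 1 / real_of_int (nm g)) \<le> (\<Sum>g\<in>?S1 \<union> ?S2. 1 / real_of_int (nm g))"
    by (rule sum_mono2) (use fin in auto)
  also have "\<dots> = (\<Sum>g\<in>?S1. 1 / real_of_int (nm g)) + (\<Sum>g\<in>?S2. 1 / real_of_int (nm g))"
    by (rule sum.union_disjoint) (use fin in auto)
  also have "\<dots> \<le> 4 * (1 + 2 * ?H) + 2 * D * (2 * ((2 * R / N ^ 2 + 1) * (4 * card (sq1 N) / N * (1 + ?H))))"
    by (intro add_mono scal_sum_diag_one[OF R] S2)
  finally show ?thesis by (simp add: field_simps)
qed

section \<open>Functions on the projective line over \<open>\<int>/N\<close>\<close>

definition mmod :: "int \<Rightarrow> mat2 \<Rightarrow> mat2" where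
  "mmod N g = Mat (m11 g mod N) (m12 g mod N) (m21 g mod N) (m22 g mod N)"

definition smat :: "int \<Rightarrow> mat2 \<Rightarrow> mat2" where
  "smat c g = Mat (c * m11 g) (c * m12 g) (c * m21 g) (c * m22 g)"

definition GL :: "int \<Rightarrow> mat2 set" where
  "GL N = {g. mmod N g = g \<and> coprime (det2 g) N}"

lemma cong_mod_self: "[x mod N = x] (mod (N::int))"
  by (simp add: cong_unfold)

lemma mmod_eq_iff: "mmod N g = mmod N h \<longleftrightarrow> [m11 g = m11 h] (mod N) \<and> [m12 g = m12 h] (mod N) \<and>
    [m21 g = m21 h] (mod N) \<and> [m22 g = m22 h] (mod N)"
  by (simp add: mmod_def cong_unfold)

lemma mmod_mmod [simp]: "mmod N (mmod N g) = mmod N g"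
  by (simp add: mmod_def)

lemma mmod_times_left: "mmod N (mmod N g * h) = mmod N (g * h)"
  unfolding mmod_eq_iff mat2_sel_times
  by (auto simp: mmod_def intro!: cong_add cong_mult cong_mod_self cong_refl)

lemma mmod_times_right: "mmod N (g * mmod N h) = mmod N (g * h)"
  unfolding mmod_eq_iff mat2_sel_times
  by (auto simp: mmod_def intro!: cong_add cong_mult cong_mod_self cong_refl)

lemma det2_mmod: "[det2 (mmod N g) = det2 g] (mod N)"
  unfolding det2_def by (auto simp: mmod_def intro!: cong_diff cong_mult cong_mod_self)

lemma coprime_det2_mmod [simp]: "coprime (det2 (mmod N g)) N \<longleftrightarrow> coprime (det2 g) N"
  using det2_mmod[of N g] cong_imp_coprime cong_sym by blast

lemma mmod_in_GL: "coprime (det2 g) N \<Longrightarrow> mmod N g \<in> GL N"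
  by (simp add: GL_def)

lemma vmod_act_mmod: "vmod N (act (mmod N g) v) = vmod N (act g v)"
  unfolding vmod_def act_def
  by (auto simp: mmod_def intro!: cong_unfold[THEN iffD1] cong_add cong_mult cong_mod_self)

lemma finite_GL [simp]: "N > 0 \<Longrightarrow> finite (GL N)"
proof (rule finite_subset[OF _ finite_mat2_box[of "{0..<N}"]])
  assume N: "N > 0"
  show "GL N \<subseteq> {g. m11 g \<in> {0..<N} \<and> m12 g \<in> {0..<N} \<and> m21 g \<in> {0..<N} \<and> m22 g \<in> {0..<N}}"
  proof
    fix g assume "g \<in> GL N"
    then have "g = mmod N g" by (simp add: GL_def)
    then have "m11 g = m11 g mod N" "m12 g = m12 g mod N" "m21 g = m21 g mod N" "m22 g = m22 g mod N"
      by (metis mmod_def mat2.sel)+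
    then show "g \<in> {g. m11 g \<in> {0..<N} \<and> m12 g \<in> {0..<N} \<and> m21 g \<in> {0..<N} \<and> m22 g \<in> {0..<N}}"
      using N pos_mod_bound[of N] pos_mod_sign[of N] by (metis (mono_tags, lifting) atLeastLessThan_iff mem_Collect_eq)
  qed
qed simp

lemma GL_inverse:
  assumes "coprime (det2 k) N"
  obtains k' where "coprime (det2 k') N" "mmod N (k * k') = mmod N 1" "mmod N (k' * k) = mmod N 1"
proof -
  obtain c where c: "[det2 k * c = 1] (mod N)"
    using cong_solve_coprime_int[OF assms] by blast
  have e1: "k * smat c (adj2 k) = smat (det2 k * c) 1" "smat c (adj2 k) * k = smat (det2 k * c) 1"
    by (auto simp: smat_def adj2_def det2_def mat2.expand algebra_simps)
  have e2: "mmod N (smat (det2 k * c) 1) = mmod N 1"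
    unfolding mmod_eq_iff using c by (simp add: smat_def)
  have "coprime c N"
    using c coprime_iff_invertible_int[of c N] by (metis mult.commute)
  moreover have "det2 (smat c (adj2 k)) = c * c * det2 k"
    by (simp add: smat_def adj2_def det2_def algebra_simps)
  ultimately have "coprime (det2 (smat c (adj2 k))) N" using assms by simp
  with that e1 e2 show ?thesis by metis
qed

lemma sum_GL_right:
  fixes F :: "mat2 \<Rightarrow> 'a::comm_monoid_add"
  assumes "coprime (det2 k) N" and F: "\<And>g. F (mmod N g) = F g"
  shows "(\<Sum>g\<in>GL N. F (g * k)) = (\<Sum>g\<in>GL N. F g)"
proof -
  obtain k' where k': "coprime (det2 k') N" "mmod N (k * k') = mmod N 1" "mmod N (k' * k) = mmod N 1"
    using GL_inverse[OF assms(1)] .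
  have inv: "mmod N (mmod N (g * a) * b) = g" if "mmod N (a * b) = mmod N 1" "g \<in> GL N" for g a b
  proof -
    have "mmod N (mmod N (g * a) * b) = mmod N (g * mmod N (a * b))"
      by (simp add: mmod_times_left mmod_times_right mult.assoc)
    also have "\<dots> = g" unfolding that(1) using that(2) by (simp add: mmod_times_right GL_def)
    finally show ?thesis .
  qed
  have "(\<Sum>g\<in>GL N. F (mmod N (g * k))) = (\<Sum>g\<in>GL N. F g)"
    by (rule sum.reindex_bij_witness[of _ "\<lambda>g. mmod N (g * k')" "\<lambda>g. mmod N (g * k)"])
       (use k' assms(1) inv in \<open>auto intro!: mmod_in_GL simp: GL_def\<close>)
  then show ?thesis by (simp add: F)
qed

text \<open>A function of level \<open>N\<close> is a function on \<open>P\<^sup>1(\<int>/N)\<close>, lifted to integer vectors and extended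
  by zero; two primitive vectors span the same line modulo \<open>N\<close> iff \<open>N\<close> divides their cross product.\<close>

definition lev :: "int \<Rightarrow> (vec2 \<Rightarrow> real) \<Rightarrow> bool" where
  "lev N f \<longleftrightarrow> (\<forall>v. \<not> prim N v \<longrightarrow> f v = 0) \<and>
     (\<forall>v w. prim N v \<longrightarrow> prim N w \<longrightarrow> N dvd cross v w \<longrightarrow> f v = f w)"

lemma lev_eq: "lev N f \<Longrightarrow> prim N v \<Longrightarrow> prim N w \<Longrightarrow> N dvd cross v w \<Longrightarrow> f v = f w"
  unfolding lev_def by blast

lemma lev_zero: "lev N f \<Longrightarrow> \<not> prim N v \<Longrightarrow> f v = 0"
  unfolding lev_def by blast

lemma cross_e1 [simp]: "cross (1, 0) w = snd w"
  by (simp add: cross_def)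

lemma cross_cong:
  assumes "vmod N v = vmod N v'" "vmod N w = vmod N w'"
  shows "[cross v w = cross v' w'] (mod N)"
  unfolding cross_def using assms
  by (intro cong_diff cong_mult) (auto simp: vmod_def cong_unfold)

lemma cross_vmod: "[cross (vmod N v) (vmod N w) = cross v w] (mod N)"
  by (rule cross_cong) auto

lemma dvd_cross_vmod [simp]: "N dvd cross v (vmod N w) \<longleftrightarrow> N dvd cross v w"
  using cross_cong[of N v v "vmod N w" w] cong_dvd_iff by auto

lemma lev_vmod [simp]: "lev N f \<Longrightarrow> f (vmod N v) = f v"
proof (cases "prim N v")
  case True
  assume "lev N f"
  then show ?thesis
    using True lev_eq[of N f v "vmod N v"] by simp
next
  case False
  assume "lev N f"
  then show ?thesis using False by (simp add: lev_zero)
qed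

text \<open>The Plucker relation: three vectors in the plane are dependent, with their cross
  products as coefficients.\<close>

lemma plucker: "cross v w * fst u = cross u w * fst v - cross u v * fst w"
  "cross v w * snd u = cross u w * snd v - cross u v * snd w"
  by (simp_all add: cross_def algebra_simps)

text \<open>By the Plucker relation \<open>e\<close> divides \<open>cross v w\<close> times each
  coordinate of \<open>u\<close>, and primitivity of \<open>u\<close> cancels the
  coordinates.\<close>

lemma dvd_cross_trans:
  assumes "prim e u" "e dvd cross u v" "e dvd cross u w"
  shows "e dvd cross v w"
proof -
  have 1: "e dvd cross v w * fst u" "e dvd cross v w * snd u"
    unfolding plucker[of v w u] using assms by auto
  then have "e dvd gcd (cross v w * fst u) (cross v w * snd u)" by simp
  then have "e dvd \<bar>cross v w\<bar> * gcd (fst u) (snd u)"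
    unfolding gcd_mult_distrib_int .
  moreover have "coprime e (gcd (fst u) (snd u))"
    using assms(1) by (simp add: prim_def coprime_commute)
  ultimately have "e dvd \<bar>cross v w\<bar>" using coprime_dvd_mult_left_iff by blast
  then show ?thesis by simp
qed

lemma dvd_cross_swap: "e dvd cross v w \<longleftrightarrow> e dvd cross w v"
  by (simp add: cross_swap[of v w])

lemma lev_act:
  assumes "lev N f" "coprime (det2 g) N"
  shows "lev N (\<lambda>v. f (act g v))"
  unfolding lev_def
proof (intro conjI allI impI)
  fix v assume "\<not> prim N v"
  then show "f (act g v) = 0" using assms by (simp add: lev_zero prim_act_iff)
next
  fix v w assume "prim N v" "prim N w" "N dvd cross v w"
  then show "f (act g v) = f (act g w)"
    using assms by (intro lev_eq[OF assms(1)]) (auto simp: prim_act_iff cross_act)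
qed

section \<open>Euler's totient and counting vectors by their cross product\<close>

definition ph :: "int \<Rightarrow> nat" where
  "ph N = card {t \<in> {0..<N}. coprime t N}"

text \<open>Transitivity moves \<open>v\<close> to \<open>(1, 0)\<close> modulo \<open>N\<close>,
  and the cross product with \<open>(1, 0)\<close> is the second coordinate.\<close>

lemma card_cross_transfer:
  assumes "N > 0" "prim N v" and P: "\<And>x y. [x = y] (mod N) \<Longrightarrow> P x \<longleftrightarrow> P y"
  shows "card {w \<in> pvec N. P (cross v w)} = card {w \<in> pvec N. P (snd w)}"
proof -
  obtain g where g: "det2 g = 1" and vg: "vmod N v = vmod N (act g (1, 0))"
    using prim_transitive[OF assms(2,1)] .
  have bij: "bij_betw (\<lambda>w. vmod N (act g w)) (pvec N) (pvec N)"
    using assms(1) g by (intro bij_betw_act_pvec) auto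
  have eq: "P (cross v (vmod N (act g w))) \<longleftrightarrow> P (snd w)" for w
  proof (rule P)
    have "[cross v (vmod N (act g w)) = cross (act g (1, 0)) (act g w)] (mod N)"
      using vg by (intro cross_cong) auto
    then show "[cross v (vmod N (act g w)) = snd w] (mod N)"
      using g by (simp add: cross_act)
  qed
  have "bij_betw (\<lambda>w. vmod N (act g w)) {w \<in> pvec N. P (snd w)} {w \<in> pvec N. P (cross v w)}"
    unfolding bij_betw_def
  proof
    show "inj_on (\<lambda>w. vmod N (act g w)) {w \<in> pvec N. P (snd w)}"
      using bij by (auto simp: bij_betw_def intro: inj_on_subset)
    have "pvec N = (\<lambda>w. vmod N (act g w)) ` pvec N" using bij by (simp add: bij_betw_def)
    then have "{w \<in> pvec N. P (cross v w)} = {w \<in> (\<lambda>w. vmod N (act g w)) ` pvec N. P (cross v w)}" by simp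
    also have "\<dots> = (\<lambda>w. vmod N (act g w)) ` {w \<in> pvec N. P (snd w)}" using eq by blast
    finally show "(\<lambda>w. vmod N (act g w)) ` {w \<in> pvec N. P (snd w)} = {w \<in> pvec N. P (cross v w)}" ..
  qed
  then show ?thesis by (simp add: bij_betw_same_card)
qed

lemma prim_unit_left: "coprime s N \<Longrightarrow> prim N (s, t)"
  by (rule primI) (auto dest: coprime_common_divisor)

lemma prim_unit_right: "coprime t N \<Longrightarrow> prim N (s, t)"
  by (rule primI) (auto dest: coprime_common_divisor)

lemma card_line:
  assumes "N > 0" "prim N v"
  shows "card {w \<in> pvec N. N dvd cross v w} = ph N"
proof -
  have "card {w \<in> pvec N. N dvd cross v w} = card {w \<in> pvec N. N dvd snd w}"
    using assms by (rule card_cross_transfer) (rule cong_dvd_iff)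
  also have "{w \<in> pvec N. N dvd snd w} = (\<lambda>t. (t, 0::int)) ` {t \<in> {0..<N}. coprime t N}"
  proof (intro equalityI subsetI)
    fix w assume w: "w \<in> {w \<in> pvec N. N dvd snd w}"
    obtain a b where ab: "w = (a, b)" by (cases w)
    have "b = 0" using w by (auto simp: ab pvec_def dest: zdvd_imp_le)
    moreover have "coprime a N" using w \<open>b = 0\<close> by (auto simp: ab pvec_def prim_def)
    ultimately show "w \<in> (\<lambda>t. (t, 0::int)) ` {t \<in> {0..<N}. coprime t N}"
      using w by (auto simp: ab pvec_def)
  next
    fix w assume "w \<in> (\<lambda>t. (t, 0::int)) ` {t \<in> {0..<N}. coprime t N}"
    then show "w \<in> {w \<in> pvec N. N dvd snd w}"
      using assms prim_unit_left by (auto simp: pvec_def)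
  qed
  also have "card \<dots> = ph N"
    unfolding ph_def by (rule card_image) (auto simp: inj_on_def)
  finally show ?thesis .
qed

lemma sum_line:
  assumes "N > 0" "lev N f" "prim N v"
  shows "(\<Sum>w\<in>{w \<in> pvec N. N dvd cross v w}. f w) = real (ph N) * f v"
proof -
  have "(\<Sum>w\<in>{w \<in> pvec N. N dvd cross v w}. f w) = (\<Sum>w\<in>{w \<in> pvec N. N dvd cross v w}. f v)"
  proof (rule sum.cong)
    fix w assume "w \<in> {w \<in> pvec N. N dvd cross v w}"
    then show "f w = f v" using assms by (intro lev_eq[symmetric]) (auto simp: pvec_def)
  qed simp
  then show ?thesis using card_line[OF assms(1,3)] by simp
qed

lemma ph_pos: "N > 0 \<Longrightarrow> ph N > 0"
proof -
  assume N: "N > 0"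
  have "1 mod N \<in> {t \<in> {0..<N}. coprime t N}"
    using N by (simp add: coprime_mod_left_iff)
  moreover have "finite {t \<in> {0..<N}. coprime t N}" by (rule finite_subset[of _ "{0..<N}"]) auto
  ultimately show ?thesis unfolding ph_def by (metis card_gt_0_iff empty_iff)
qed

text \<open>After the transfer the vectors \<open>(t, d)\<close> with \<open>t\<close> a unit
  already suffice; the reduction \<open>d mod N\<close> matters only for
  \<open>d = N\<close>.\<close>

lemma card_gcd_fiber:
  assumes N: "N > 0" and v: "prim N v" and d: "d dvd N" "d > 0"
  shows "ph N \<le> card {w \<in> pvec N. gcd (cross v w) N = d}"
proof -
  have "card {w \<in> pvec N. gcd (cross v w) N = d} = card {w \<in> pvec N. gcd (snd w) N = d}"
    using N v by (rule card_cross_transfer) (metis cong_gcd_eq)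
  moreover have "(\<lambda>t. (t, d mod N)) ` {t \<in> {0..<N}. coprime t N} \<subseteq> {w \<in> pvec N. gcd (snd w) N = d}"
  proof (rule image_subsetI)
    fix t assume "t \<in> {t \<in> {0..<N}. coprime t N}"
    moreover have "gcd (d mod N) N = d"
      using d by (simp add: gcd.commute[of _ N] gcd_red_int[symmetric] gcd_proj2_if_dvd_int abs_of_pos)
    ultimately show "(t, d mod N) \<in> {w \<in> pvec N. gcd (snd w) N = d}"
      using N prim_unit_left by (auto simp: pvec_def)
  qed
  then have "card ((\<lambda>t. (t, d mod N)) ` {t \<in> {0..<N}. coprime t N}) \<le> card {w \<in> pvec N. gcd (snd w) N = d}"
    by (intro card_mono) auto
  moreover have "card ((\<lambda>t. (t, d mod N)) ` {t \<in> {0..<N}. coprime t N}) = ph N"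
    unfolding ph_def by (rule card_image) (auto simp: inj_on_def)
  ultimately show ?thesis by simp
qed

text \<open>The first column is primitive and the second has a unit cross product with it. After the
  transfer the second column consists of an arbitrary residue and a unit.\<close>

lemma card_GL_le:
  assumes N: "N > 0"
  shows "card (GL N) \<le> card (pvec N) * (nat N * ph N)"
proof -
  let ?T = "SIGMA v:pvec N. {w \<in> pvec N. coprime (cross v w) N}"
  have "GL N \<subseteq> (\<lambda>(v, w). Mat (fst v) (fst w) (snd v) (snd w)) ` ?T"
  proof
    fix g assume g: "g \<in> GL N"
    let ?v = "(m11 g, m21 g)" and ?w = "(m12 g, m22 g)"
    have gg: "mmod N g = g" and cop: "coprime (det2 g) N" using g by (auto simp: GL_def)
    have "vmod N ?v = ?v" "vmod N ?w = ?w"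
      using gg by (cases g, simp add: mmod_def vmod_def)+
    moreover have "prim N (act g (1, 0))" "prim N (act g (0, 1))"
      using cop prim_unit_left[of 1 N 0] prim_unit_right[of 1 N 0] by (simp_all add: prim_act_iff)
    then have "prim N ?v" "prim N ?w" by (simp_all add: act_def)
    ultimately have "?v \<in> pvec N" "?w \<in> pvec N" using N vmod_in_pvec by metis+
    moreover have "cross ?v ?w = det2 g" by (simp add: cross_def det2_def algebra_simps)
    ultimately have "(?v, ?w) \<in> ?T" using cop by simp
    then show "g \<in> (\<lambda>(v, w). Mat (fst v) (fst w) (snd v) (snd w)) ` ?T"
      by (rule image_eqI[rotated]) simp
  qed
  then have "card (GL N) \<le> card ?T" by (rule surj_card_le[rotated]) simp
  also have "\<dots> = (\<Sum>v\<in>pvec N. card {w \<in> pvec N. coprime (cross v w) N})" by simp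
  also have "\<dots> \<le> (\<Sum>v\<in>pvec N. nat N * ph N)"
  proof (rule sum_mono)
    fix v assume "v \<in> pvec N"
    then have "prim N v" by (simp add: pvec_def)
    then have "card {w \<in> pvec N. coprime (cross v w) N} = card {w \<in> pvec N. coprime (snd w) N}"
      using N by (intro card_cross_transfer) (auto intro: cong_imp_coprime cong_sym)
    also have "\<dots> \<le> card ({0..<N} \<times> {t \<in> {0..<N}. coprime t N})"
      by (intro card_mono finite_cartesian_product finite_subset[of "{t \<in> {0..<N}. coprime t N}" "{0..<N}"])
         (auto simp: pvec_def)
    also have "\<dots> = nat N * ph N" by (simp add: ph_def card_cartesian_product)
    finally show "card {w \<in> pvec N. coprime (cross v w) N} \<le> nat N * ph N" .
  qed
  finally show ?thesis by simp
qed

text \<open>The orbits of \<open>GL\<^sub>2(\<int>/N)\<close> on pairs of lines are separated by the gcd of the cross product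
  with \<open>N\<close>.\<close>

lemma pair_normal_form:
  assumes N: "N > 0" and v: "prim N v" and w: "prim N w"
  obtains k where "coprime (det2 k) N" "N dvd cross v (act k (1, 0))"
    "vmod N (act k (1, gcd (cross v w) N)) = vmod N w"
proof -
  define d where "d = gcd (cross v w) N"
  obtain h where h: "det2 h = 1" and vh: "vmod N v = vmod N (act h (1, 0))"
    using prim_transitive[OF v N] .
  obtain s t where st: "act (adj2 h) w = (s, t)" by (cases "act (adj2 h) w")
  have w_eq: "act h (s, t) = w" using act_adj2_SL2(2)[OF h, of w] st by simp
  have pst: "prim N (s, t)" using w h prim_act[of N w "adj2 h"] by (simp add: st)
  have "[cross v w = cross (act h (1, 0)) (act h (s, t))] (mod N)"
    using vh w_eq by (intro cross_cong) auto
  then have "[cross v w = t] (mod N)" using h by (simp add: cross_act)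
  then have d: "d = gcd t N" unfolding d_def by (rule cong_gcd_eq)
  have d0: "d > 0" "d dvd t" "d dvd N" using N by (auto simp: d)
  obtain t' where t': "t = d * t'" using d0(2) by (elim dvdE)
  obtain M where M: "N = d * M" using d0(3) by (elim dvdE)
  have "gcd (d * t') (d * M) = d" by (simp only: t'[symmetric] M[symmetric] d[symmetric])
  then have "d * gcd t' M = d" using gcd_mult_distrib_int[of d t' M] d0(1) by simp
  then have "gcd t' M = 1" using d0(1) by simp
  then have "\<exists>b. coprime (t' + b * M) N" using N by (intro coprime_shift) auto
  then obtain b1 where b1: "coprime (t' + b1 * M) N" by blast
  have "coprime (gcd s d) N"
  proof (rule coprimeI)
    fix c assume "c dvd gcd s d" "c dvd N"
    then show "is_unit c" using primD[OF pst, of c] dvd_trans[OF _ d0(2)] by auto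
  qed
  then have "\<exists>b. coprime (s + b * d) N" using N by (intro coprime_shift) auto
  then obtain b2 where b2: "coprime (s + b2 * d) N" by blast
  \<comment> \<open>This triangular matrix fixes the line of \<open>(1, 0)\<close> and sends
    \<open>(1, d)\<close> to \<open>(s, t + b1 * N)\<close>; the shifts by \<open>b1\<close> and
    \<open>b2\<close> make its diagonal entries units.\<close>
  define k0 where "k0 = Mat (s + b2 * d) (- b2) 0 (t' + b1 * M)"
  have "coprime (det2 (h * k0)) N" using h b1 b2 by (simp add: k0_def)
  moreover have "N dvd cross v (act (h * k0) (1, 0))"
  proof -
    have "[cross v (act (h * k0) (1, 0)) = cross (act h (1, 0)) (act h (act k0 (1, 0)))] (mod N)"
      using vh by (intro cross_cong) auto
    moreover have "cross (act h (1, 0)) (act h (act k0 (1, 0))) = 0"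
      by (simp add: cross_act h) (simp add: k0_def act_def cross_def)
    ultimately show ?thesis by (simp add: cong_0_iff)
  qed
  moreover have "vmod N (act (h * k0) (1, d)) = vmod N w"
  proof -
    have "act k0 (1, d) = (s, t + b1 * N)"
      by (simp add: k0_def act_def t' M algebra_simps)
    then have "vmod N (act k0 (1, d)) = vmod N (s, t)" by (simp add: vmod_def)
    then have "vmod N (act h (act k0 (1, d))) = vmod N (act h (s, t))"
      by (metis vmod_act_vmod)
    then show ?thesis by (simp add: w_eq)
  qed
  ultimately show ?thesis unfolding d_def by (rule that)
qed

section \<open>New functions are quasirandom\<close>

text \<open>Orthogonality to all functions pulled back from a proper divisor \<open>e\<close>: the
  sums over the fibres of the reduction from level \<open>N\<close> to level \<open>e\<close>
  vanish. For \<open>N > 1\<close> the divisor \<open>e = 1\<close> makes the total sum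
  zero.\<close>

definition lnew :: "int \<Rightarrow> (vec2 \<Rightarrow> real) \<Rightarrow> bool" where
  "lnew N f \<longleftrightarrow> (\<forall>e>0. e dvd N \<longrightarrow> e \<noteq> N \<longrightarrow>
     (\<forall>v. prim N v \<longrightarrow> (\<Sum>w\<in>{w \<in> pvec N. e dvd cross v w}. f w) = 0))"

text \<open>The sum runs over vectors rather than lines, so each line is counted \<open>ph N\<close>
  times.\<close>

definition sqn :: "int \<Rightarrow> (vec2 \<Rightarrow> real) \<Rightarrow> real" where
  "sqn N f = (\<Sum>v\<in>pvec N. f v ^ 2)"

lemma sqn_nonneg [simp]: "sqn N f \<ge> 0"
  by (simp add: sqn_def sum_nonneg)

lemma lnewD:
  assumes "lnew N f" "lev N f" "N > 0" "prim N v" "e > 0" "e dvd N"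
  shows "(\<Sum>w\<in>{w \<in> pvec N. e dvd cross v w}. f w) = (if e = N then real (ph N) * f v else 0)"
proof (cases "e = N")
  case True
  then show ?thesis using sum_line[of N f v] assms by simp
next
  case False
  then have "(\<Sum>w\<in>{w \<in> pvec N. e dvd cross v w}. f w) = 0"
    using assms unfolding lnew_def by blast
  with False show ?thesis by simp
qed

text \<open>Inclusion-exclusion over the primes in \<open>Q\<close>: for a new function only the term in which
  the divisor reaches the full level \<open>N\<close> survives.\<close>

lemma lnew_sieve:
  assumes f: "lnew N f" "lev N f" and N: "N > 0" and v: "prim N v"
  shows "finite Q \<Longrightarrow> (\<And>p. p \<in> Q \<Longrightarrow> prime p) \<Longrightarrow> d > 0 \<Longrightarrow> d * \<Prod>Q dvd N \<Longrightarrow>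
    (\<Sum>w\<in>{w \<in> pvec N. d dvd cross v w \<and> (\<forall>p\<in>Q. \<not> d * p dvd cross v w)}. f w) =
    (if d * \<Prod>Q = N then (-1) ^ card Q * (real (ph N) * f v) else 0)"
proof (induction Q arbitrary: d rule: finite_induct)
  case empty
  then show ?case using lnewD[OF f N v, of d] by simp
next
  case (insert p Q)
  have p: "prime p" using insert.prems by auto
  have p1: "p > 1" using p by (simp add: prime_gt_1_int)
  have prodQ: "\<Prod>(insert p Q) = p * \<Prod>Q" using insert.hyps by simp
  have dvd1: "(d * p) * \<Prod>Q dvd N" using insert.prems(3) by (simp add: prodQ mult.assoc)
  then have dvd2: "d * \<Prod>Q dvd N" by (metis dvd_mult_left mult.assoc mult.commute)
  have Qpos: "\<Prod>Q > 0" using insert.prems by (intro prod_pos) (auto intro: prime_gt_0_int)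
  \<comment> \<open>As \<open>d * p * \<Prod>Q\<close> still divides \<open>N\<close>, the product
    without \<open>p\<close> is smaller than \<open>N\<close>. The term for \<open>d\<close>
    therefore vanishes and only that for \<open>d * p\<close> can survive, with a change of
    sign.\<close>
  have ne: "d * \<Prod>Q \<noteq> N"
  proof
    assume eq: "d * \<Prod>Q = N"
    have "d * p * \<Prod>Q \<le> N" using dvd1 N by (rule zdvd_imp_le)
    moreover have "d * p * \<Prod>Q = N * p" unfolding eq[symmetric] by (simp add: mult_ac)
    ultimately have "N * p \<le> N * 1" by simp
    then show False using N p1 by (simp add: mult_le_cancel_left)
  qed
  let ?A = "\<lambda>d. {w \<in> pvec N. d dvd cross v w \<and> (\<forall>q\<in>Q. \<not> d * q dvd cross v w)}"
  have split: "{w \<in> pvec N. d dvd cross v w \<and> (\<forall>q\<in>insert p Q. \<not> d * q dvd cross v w)} = ?A d - ?A (d * p)"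
    and sub: "?A (d * p) \<subseteq> ?A d"
  proof -
    have key: "d * q dvd x \<longleftrightarrow> d * p * q dvd x" if "q \<in> Q" "d * p dvd x" for q x
    proof
      assume dq: "d * q dvd x"
      have "d dvd x" using dq by (rule dvd_mult_left)
      then obtain y where y: "x = d * y" by (elim dvdE)
      have "q dvd y" "p dvd y" using dq that(2) insert.prems(2) unfolding y by auto
      moreover have "coprime p q"
        using p that insert.prems(1) insert.hyps by (intro primes_coprime) auto
      ultimately have "p * q dvd y" using divides_mult by blast
      then show "d * p * q dvd x" by (simp add: y mult.assoc)
    next
      assume "d * p * q dvd x"
      then show "d * q dvd x" by (metis dvd_mult_left mult.assoc mult.commute)
    qed
    have dp: "d dvd x" if "d * p dvd x" for x using that by (rule dvd_mult_left)
    show "{w \<in> pvec N. d dvd cross v w \<and> (\<forall>q\<in>insert p Q. \<not> d * q dvd cross v w)} = ?A d - ?A (d * p)"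
      using key dp by blast
    show "?A (d * p) \<subseteq> ?A d" using key dp by blast
  qed
  have "(\<Sum>w\<in>{w \<in> pvec N. d dvd cross v w \<and> (\<forall>q\<in>insert p Q. \<not> d * q dvd cross v w)}. f w)
      = sum f (?A d) - sum f (?A (d * p))"
    unfolding split by (rule sum_diff) (use sub in auto)
  also have "sum f (?A d) = 0"
    using insert.IH[of d] insert.prems dvd2 ne by simp
  also have "sum f (?A (d * p)) = (if d * p * \<Prod>Q = N then (-1) ^ card Q * (real (ph N) * f v) else 0)"
    using insert.prems dvd1 p1 by (intro insert.IH) auto
  finally show ?case using insert.hyps by (simp add: prodQ mult.assoc)
qed

lemma prod_primes_dvd:
  fixes n :: int
  shows "finite Q \<Longrightarrow> (\<And>p. p \<in> Q \<Longrightarrow> prime p \<and> p dvd n) \<Longrightarrow> \<Prod>Q dvd n"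
proof (induction Q rule: finite_induct)
  case (insert p Q)
  have "coprime p (\<Prod>Q)"
    using insert.hyps insert.prems by (intro prod_coprime_right primes_coprime) auto
  then show ?case using insert by (simp add: divides_mult)
qed simp

text \<open>The gcd equals \<open>d\<close> iff \<open>d\<close> divides the cross product and
  \<open>d * p\<close> does not, for every prime \<open>p\<close> of \<open>N / d\<close>. The sieve
  leaves at most one term, of absolute value \<open>ph N * \<bar>f v\<bar>\<close>.\<close>

lemma lnew_fiber_sum:
  assumes f: "lnew N f" "lev N f" and N: "N > 0" and v: "prim N v" and d: "d > 0" "d dvd N"
  shows "\<bar>\<Sum>w\<in>{w \<in> pvec N. gcd (cross v w) N = d}. f w\<bar> \<le> real (ph N) * \<bar>f v\<bar>"
proof -
  obtain M where M: "N = d * M" using d(2) by (elim dvdE)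
  have M0: "M > 0" using M N d by (simp add: zero_less_mult_iff)
  define Q where "Q = prime_factors M"
  have Q: "finite Q" "\<And>p. p \<in> Q \<Longrightarrow> prime p \<and> p dvd M"
    by (auto simp: Q_def)
  have "\<Prod>Q dvd M" using Q by (intro prod_primes_dvd) auto
  then have "d * \<Prod>Q dvd N" unfolding M by simp
  moreover have "gcd x N = d \<longleftrightarrow> d dvd x \<and> (\<forall>p\<in>Q. \<not> d * p dvd x)" for x
  proof
    assume g: "gcd x N = d"
    have "\<not> d * p dvd x" if "p \<in> Q" for p
    proof
      assume "d * p dvd x"
      moreover have "d * p dvd N" using Q(2)[OF that] unfolding M by simp
      ultimately have "d * p dvd d * 1" using g by (metis gcd_greatest mult.right_neutral)
      then have "p dvd 1" using d(1) by simp
      then show False using Q(2)[OF that] not_prime_unit by blast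
    qed
    then show "d dvd x \<and> (\<forall>p\<in>Q. \<not> d * p dvd x)" using g by auto
  next
    assume h: "d dvd x \<and> (\<forall>p\<in>Q. \<not> d * p dvd x)"
    then obtain y where y: "x = d * y" by (auto elim: dvdE)
    have "gcd y M = 1"
    proof (rule ccontr)
      assume "gcd y M \<noteq> 1"
      then have "\<not> is_unit (gcd y M)" using gcd_ge_0_int[of y M] by (simp add: zdvd1_eq del: is_unit_gcd)
      moreover have "gcd y M \<noteq> 0" using M0 by simp
      ultimately obtain p where "prime p" "p dvd gcd y M" using prime_divisor_exists by blast
      then have "p \<in> Q" "d * p dvd x" using M0 by (auto simp: Q_def in_prime_factors_iff y)
      with h show False by blast
    qed
    then show "gcd x N = d" using d(1) gcd_mult_distrib_int[of d y M] unfolding y M by simp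
  qed
  ultimately have "(\<Sum>w\<in>{w \<in> pvec N. gcd (cross v w) N = d}. f w) =
      (if d * \<Prod>Q = N then (-1) ^ card Q * (real (ph N) * f v) else 0)"
    using lnew_sieve[OF f N v Q(1) _ d(1)] Q(2) by simp
  then show ?thesis by (simp add: abs_mult power_abs)
qed

text \<open>Expanding the square weights each pair \<open>(v, w)\<close> by
  \<open>\<Psi> v w\<close>, a sum over the whole group, which depends only on the orbit of the
  pair, that is on the gcd \<open>d\<close> of \<open>cross v w\<close> and \<open>N\<close>.
  Averaging over the orbit turns the contribution of \<open>d\<close> into
  \<open>card (GL N) * (S d)^2 / card (Ob d)\<close>. Newness bounds \<open>S d\<close>, and there
  are only \<open>ndiv (nat N)\<close> values of \<open>d\<close>.\<close>

theorem lnew_quasirandom: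
  assumes f: "lnew N f" "lev N f" and N: "N > 0"
  shows "(\<Sum>g\<in>GL N. (\<Sum>v\<in>pvec N. f v * f (act g v))\<^sup>2)
    \<le> real_of_int N * real (ph N) ^ 2 * real (ndiv (nat N)) * (sqn N f)\<^sup>2"
proof -
  define \<Psi> where "\<Psi> v w = (\<Sum>g\<in>GL N. f (act g v) * f (act g w))" for v w
  define Y where "Y d = \<Psi> (1, 0) (1, d)" for d
  define cd where "cd v w = gcd (cross v w) N" for v w
  define D where "D = {d. d > 0 \<and> d dvd N}"
  define Ob where "Ob d = {(v, w) \<in> pvec N \<times> pvec N. cd v w = d}" for d
  define S where "S d = (\<Sum>(v, w)\<in>Ob d. f v * f w)" for d
  have finD: "finite D" unfolding D_def
    by (rule finite_subset[of _ "{1..N}"]) (use N in \<open>auto intro: zdvd_imp_le\<close>)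
  have finOb: "finite (Ob d)" for d unfolding Ob_def by (rule finite_subset[of _ "pvec N \<times> pvec N"]) auto
  have fmod: "f (act (mmod N g) v) = f (act g v)" for g v
    using lev_vmod[OF f(2)] vmod_act_mmod by metis
  have \<Psi>Y: "\<Psi> v w = Y (cd v w)" if v: "prim N v" and w: "prim N w" for v w
  proof -
    obtain k where k: "coprime (det2 k) N" "N dvd cross v (act k (1, 0))"
        "vmod N (act k (1, cd v w)) = vmod N w"
      using pair_normal_form[OF N v w] unfolding cd_def .
    have "\<Psi> v w = (\<Sum>g\<in>GL N. f (act (g * k) (1, 0)) * f (act (g * k) (1, cd v w)))"
      unfolding \<Psi>_def
    proof (rule sum.cong[OF refl])
      fix g assume g: "g \<in> GL N"
      then have cg: "coprime (det2 g) N" by (simp add: GL_def)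
      have "f (act g v) = f (act g (act k (1, 0)))"
        using cg k v prim_unit_left[of 1 N 0]
        by (intro lev_eq[OF f(2)]) (auto simp: prim_act_iff cross_act)
      moreover have "f (act g w) = f (act g (act k (1, cd v w)))"
        using lev_vmod[OF f(2)] vmod_act_vmod k(3) by metis
      ultimately show "f (act g v) * f (act g w) = f (act (g * k) (1, 0)) * f (act (g * k) (1, cd v w))"
        by simp
    qed
    also have "\<dots> = Y (cd v w)"
      unfolding Y_def \<Psi>_def by (rule sum_GL_right[OF k(1)]) (simp add: fmod)
    finally show ?thesis .
  qed
  have group: "(\<Sum>v\<in>pvec N. \<Sum>w\<in>pvec N. F v w) = (\<Sum>d\<in>D. \<Sum>(v, w)\<in>Ob d. F v w)"
    for F :: "vec2 \<Rightarrow> vec2 \<Rightarrow> real"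
  proof -
    have "(\<Sum>v\<in>pvec N. \<Sum>w\<in>pvec N. F v w) = (\<Sum>p\<in>pvec N \<times> pvec N. case p of (v, w) \<Rightarrow> F v w)"
      by (rule sum.cartesian_product)
    also have "\<dots> = (\<Sum>d\<in>D. \<Sum>p\<in>{p \<in> pvec N \<times> pvec N. (case p of (v, w) \<Rightarrow> cd v w) = d}. case p of (v, w) \<Rightarrow> F v w)"
      by (rule sum.group[symmetric]) (use finD N in \<open>auto simp: D_def cd_def\<close>)
    also have "\<dots> = (\<Sum>d\<in>D. \<Sum>(v, w)\<in>Ob d. F v w)"
      unfolding Ob_def by (intro sum.cong refl) auto
    finally show ?thesis .
  qed
  have Om: "prim N (fst p) \<and> prim N (snd p) \<and> cd (fst p) (snd p) = d" if "p \<in> Ob d" for p d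
    using that by (auto simp: Ob_def pvec_def)
  \<comment> \<open>The sum of \<open>\<Psi>\<close> over an orbit is computed in two ways:
    \<open>\<Psi>\<close> is constant there, and every group element permutes the orbit.\<close>
  have orbit: "real (card (Ob d)) * Y d = real (card (GL N)) * S d" if d: "d \<in> D" for d
  proof -
    have "real (card (Ob d)) * Y d = (\<Sum>(v, w)\<in>Ob d. \<Psi> v w)"
      using Om \<Psi>Y by (simp add: split_beta)
    also have "\<dots> = (\<Sum>p\<in>Ob d. \<Sum>g\<in>GL N. f (act g (fst p)) * f (act g (snd p)))"
      by (simp add: \<Psi>_def split_beta)
    also have "\<dots> = (\<Sum>g\<in>GL N. \<Sum>p\<in>Ob d. f (act g (fst p)) * f (act g (snd p)))"
      by (rule sum.swap)
    also have "\<dots> = (\<Sum>g\<in>GL N. S d)"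
    proof (rule sum.cong[OF refl])
      fix g assume "g \<in> GL N"
      then have cg: "coprime (det2 g) N" by (simp add: GL_def)
      let ?h = "\<lambda>p. (vmod N (act g (fst p)), vmod N (act g (snd p)))"
      have inj1: "inj_on (\<lambda>v. vmod N (act g v)) (pvec N)"
        using bij_betw_act_pvec[OF N cg] by (simp add: bij_betw_def)
      have "inj_on ?h (Ob d)"
      proof (rule inj_onI)
        fix p q assume pq: "p \<in> Ob d" "q \<in> Ob d" and eq: "?h p = ?h q"
        have "fst p \<in> pvec N" "snd p \<in> pvec N" "fst q \<in> pvec N" "snd q \<in> pvec N"
          using pq by (auto simp: Ob_def)
        moreover have "vmod N (act g (fst p)) = vmod N (act g (fst q))"
          "vmod N (act g (snd p)) = vmod N (act g (snd q))"
          using eq by (simp_all only: prod.inject)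
        ultimately have "fst p = fst q" "snd p = snd q"
          using inj_onD[OF inj1] by blast+
        then show "p = q" by (rule prod_eqI)
      qed
      moreover have "?h ` Ob d \<subseteq> Ob d"
      proof (rule image_subsetI)
        fix p assume p: "p \<in> Ob d"
        have "[cross (vmod N (act g (fst p))) (vmod N (act g (snd p))) = det2 g * cross (fst p) (snd p)] (mod N)"
          using cross_vmod[of N "act g (fst p)" "act g (snd p)"] by (simp add: cross_act)
        then have "cd (vmod N (act g (fst p))) (vmod N (act g (snd p))) = gcd (det2 g * cross (fst p) (snd p)) N"
          unfolding cd_def by (rule cong_gcd_eq)
        also have "\<dots> = cd (fst p) (snd p)"
          unfolding cd_def by (rule gcd_mult_left_left_cancel) (use cg in \<open>simp add: coprime_commute\<close>)
        finally show "?h p \<in> Ob d"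
          using Om[OF p] N cg by (simp add: Ob_def vmod_in_pvec prim_act)
      qed
      ultimately have "bij_betw ?h (Ob d) (Ob d)"
        using finOb by (simp add: bij_betw_def endo_inj_surj)
      then have "(\<Sum>p\<in>Ob d. f (fst (?h p)) * f (snd (?h p))) = (\<Sum>p\<in>Ob d. f (fst p) * f (snd p))"
        by (rule sum.reindex_bij_betw[of ?h "Ob d" "Ob d" "\<lambda>p. f (fst p) * f (snd p)"])
      then show "(\<Sum>p\<in>Ob d. f (act g (fst p)) * f (act g (snd p))) = S d"
        using f(2) by (simp add: S_def split_beta)
    qed
    finally show ?thesis by simp
  qed
  have Osum: "(\<Sum>(v, w)\<in>Ob d. F v w) = (\<Sum>v\<in>pvec N. \<Sum>w\<in>{w \<in> pvec N. cd v w = d}. F v w)"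
    for d and F :: "vec2 \<Rightarrow> vec2 \<Rightarrow> real"
  proof -
    have "Ob d = (SIGMA v:pvec N. {w \<in> pvec N. cd v w = d})" by (auto simp: Ob_def)
    then show ?thesis by (simp add: sum.Sigma)
  qed
  have Sd: "\<bar>S d\<bar> \<le> real (ph N) * sqn N f" if d: "d \<in> D" for d
  proof -
    have "\<bar>S d\<bar> = \<bar>\<Sum>v\<in>pvec N. f v * (\<Sum>w\<in>{w \<in> pvec N. cd v w = d}. f w)\<bar>"
      unfolding S_def Osum by (simp add: sum_distrib_left)
    also have "\<dots> \<le> (\<Sum>v\<in>pvec N. \<bar>f v * (\<Sum>w\<in>{w \<in> pvec N. cd v w = d}. f w)\<bar>)" by (rule sum_abs)
    also have "\<dots> \<le> (\<Sum>v\<in>pvec N. \<bar>f v\<bar> * (real (ph N) * \<bar>f v\<bar>))"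
      unfolding abs_mult cd_def
      using d by (intro sum_mono mult_left_mono lnew_fiber_sum[OF f N]) (auto simp: D_def pvec_def)
    also have "\<dots> = real (ph N) * sqn N f"
      unfolding sqn_def sum_distrib_left by (intro sum.cong refl) (simp add: power2_eq_square)
    finally show ?thesis .
  qed
  have cardO: "card (pvec N) * ph N \<le> card (Ob d)" if d: "d \<in> D" for d
  proof -
    have "card (Ob d) = (\<Sum>v\<in>pvec N. card {w \<in> pvec N. cd v w = d})"
    proof -
      have "Ob d = (SIGMA v:pvec N. {w \<in> pvec N. cd v w = d})" by (auto simp: Ob_def)
      then show ?thesis by simp
    qed
    also have "\<dots> \<ge> (\<Sum>v\<in>pvec N. ph N)"
      unfolding cd_def using d N by (intro sum_mono card_gcd_fiber) (auto simp: D_def pvec_def)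
    finally show ?thesis by simp
  qed
  have "(1 mod N, 0) \<in> pvec N"
    using N prim_unit_left[of "1 mod N" N 0] by (simp add: pvec_def)
  then have cp: "card (pvec N) > 0" using finite_pvec card_gt_0_iff by blast
  have php: "ph N > 0" using N by (rule ph_pos)
  have trm: "Y d * S d \<le> real_of_int N * real (ph N) ^ 2 * (sqn N f)\<^sup>2" if d: "d \<in> D" for d
  proof -
    have cO: "real (card (Ob d)) > 0"
      using cardO[OF d] cp php by (metis gr0I mult_pos_pos not_less of_nat_0_less_iff zero_less_iff_neq_zero less_le_trans)
    have "S d ^ 2 \<le> (real (ph N) * sqn N f)\<^sup>2"
      using Sd[OF d] by (intro abs_le_square_iff[THEN iffD1]) simp
    then have "real (card (GL N)) * S d ^ 2 \<le> real (card (pvec N) * (nat N * ph N)) * (real (ph N) * sqn N f)\<^sup>2"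
      using card_GL_le[OF N] by (intro mult_mono) (simp_all only: of_nat_le_iff, auto)
    also have "\<dots> = real (card (pvec N) * ph N) * (real_of_int N * (real (ph N) * sqn N f)\<^sup>2)"
      using N by simp
    also have "\<dots> \<le> real (card (Ob d)) * (real_of_int N * (real (ph N) * sqn N f)\<^sup>2)"
      using cardO[OF d] N by (intro mult_right_mono) (simp_all only: of_nat_le_iff, auto)
    finally have "real (card (GL N)) * S d ^ 2 \<le> real (card (Ob d)) * (real_of_int N * (real (ph N) * sqn N f)\<^sup>2)" .
    moreover have "real (card (GL N)) * S d ^ 2 = real (card (Ob d)) * (Y d * S d)"
      using orbit[OF d] by (simp add: power2_eq_square)
    ultimately show ?thesis using cO by (simp add: power_mult_distrib mult_ac)
  qed
  have "(\<Sum>g\<in>GL N. (\<Sum>v\<in>pvec N. f v * f (act g v))\<^sup>2) =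
      (\<Sum>g\<in>GL N. \<Sum>v\<in>pvec N. \<Sum>w\<in>pvec N. (f v * f (act g v)) * (f w * f (act g w)))"
    by (simp add: power2_eq_square sum_product)
  also have "\<dots> = (\<Sum>v\<in>pvec N. \<Sum>g\<in>GL N. \<Sum>w\<in>pvec N. (f v * f (act g v)) * (f w * f (act g w)))"
    by (rule sum.swap)
  also have "\<dots> = (\<Sum>v\<in>pvec N. \<Sum>w\<in>pvec N. \<Sum>g\<in>GL N. (f v * f (act g v)) * (f w * f (act g w)))"
    by (intro sum.cong refl sum.swap)
  also have "\<dots> = (\<Sum>v\<in>pvec N. \<Sum>w\<in>pvec N. f v * f w * \<Psi> v w)"
    unfolding \<Psi>_def sum_distrib_left by (intro sum.cong refl) (simp add: mult_ac)
  also have "\<dots> = (\<Sum>d\<in>D. \<Sum>(v, w)\<in>Ob d. f v * f w * \<Psi> v w)" by (rule group)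
  also have "\<dots> = (\<Sum>d\<in>D. Y d * S d)"
    unfolding S_def sum_distrib_left
    using Om \<Psi>Y by (intro sum.cong refl) (auto simp: split_beta)
  also have "\<dots> \<le> (\<Sum>d\<in>D. real_of_int N * real (ph N) ^ 2 * (sqn N f)\<^sup>2)"
    by (intro sum_mono trm)
  also have "\<dots> = real (card D) * (real_of_int N * real (ph N) ^ 2 * (sqn N f)\<^sup>2)" by simp
  also have "card D = ndiv (nat N)"
  proof -
    have "int d \<in> D" if "d dvd nat N" for d
    proof -
      have "int d dvd N" using that N int_dvd_int_iff[of d "nat N"] by simp
      moreover have "d > 0" using that N dvd_pos_nat[of "nat N" d] by simp
      ultimately show ?thesis by (simp add: D_def)
    qed
    then have "bij_betw nat D {d. d dvd nat N}"
      by (intro bij_betw_byWitness[of _ int]) (use N in \<open>auto simp: D_def nat_dvd_iff\<close>)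
    then show ?thesis unfolding ndiv_def by (rule bij_betw_same_card)
  qed
  finally show ?thesis by (simp add: mult_ac)
qed

section \<open>The spectral bound for new functions\<close>

text \<open>Not normalised: the trivial eigenvalue is \<open>card (steps m)\<close>.\<close>

definition Top :: "int \<Rightarrow> (vec2 \<Rightarrow> real) \<Rightarrow> vec2 \<Rightarrow> real" where
  "Top m f v = (\<Sum>w\<in>steps m. f (act w v))"

lemma Top_funpow: "(Top m ^^ n) f v = (\<Sum>ws\<in>wlists m n. f (act (prod_list ws) v))"
proof (induction n arbitrary: f)
  case (Suc n)
  have "(Top m ^^ Suc n) f v = (Top m ^^ n) (Top m f) v"
    by (simp only: funpow_Suc_right comp_def)
  also have "\<dots> = (\<Sum>ws\<in>wlists m n. \<Sum>w\<in>steps m. f (act (prod_list (w # ws)) v))"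
    by (simp add: Suc.IH Top_def)
  also have "\<dots> = (\<Sum>w\<in>steps m. \<Sum>ws\<in>wlists m n. f (act (prod_list (w # ws)) v))"
    by (rule sum.swap)
  also have "\<dots> = (\<Sum>ws\<in>wlists m (Suc n). f (act (prod_list ws) v))"
    by (rule sum_wlists_Suc[symmetric])
  finally show ?case .
qed simp

lemma Top_scale: "Top m (\<lambda>v. c * f v) = (\<lambda>v. c * Top m f v)"
  by (simp add: Top_def sum_distrib_left fun_eq_iff)

lemma Top_eigen_power:
  assumes "Top m (Top m f) = (\<lambda>v. \<mu> * f v)"
  shows "(Top m ^^ (2 * n)) f = (\<lambda>v. \<mu> ^ n * f v)"
proof (induction n)
  case (Suc n)
  have "(Top m ^^ (2 * Suc n)) f = Top m (Top m ((Top m ^^ (2 * n)) f))" by simp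
  also have "\<dots> = (\<lambda>v. \<mu> ^ n * (\<mu> * f v))" by (simp only: Suc.IH Top_scale assms)
  finally show ?case by (simp add: fun_eq_iff mult_ac)
qed simp

lemma det2_smat: "det2 (smat c g) = c * c * det2 g"
  by (simp add: smat_def det2_def algebra_simps)

lemma smat_times: "smat c g * h = smat c (g * h)"
  by (simp add: smat_def mat2.expand algebra_simps)

definition scwords :: "int \<Rightarrow> int \<Rightarrow> nat \<Rightarrow> mat2 list set" where
  "scwords m N n = {ws \<in> wlists m n. scal N (prod_list ws)}"

lemma ph_le: "N > 0 \<Longrightarrow> real (ph N) \<le> real_of_int N"
proof -
  assume "N > 0"
  have "ph N \<le> card {0..<N}" unfolding ph_def by (intro card_mono) auto
  then have "real (ph N) \<le> real (nat N)" by simp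
  also have "real (nat N) = real_of_int N" using \<open>N > 0\<close> by simp
  finally show ?thesis .
qed

text \<open>Summing \<open>F\<close> over words of length \<open>2 * n\<close> gives
  \<open>\<mu>^n * sqn N f\<close>. After grouping the words by their class in \<open>GL N\<close>,
  Cauchy-Schwarz separates the collisions of words from the matrix coefficients \<open>F\<close>.
  Words are first multiplied by all unit scalars, which leaves \<open>F\<close> unchanged:
  collisions then mean equality up to scalars, and one of the two factors \<open>ph N\<close> of
  \<open>lnew_quasirandom\<close> cancels.\<close>

theorem new_eigenvalue_le_words:
  assumes f: "lnew N f" "lev N f" and N: "N > 0" and pos: "sqn N f > 0"
    and eig: "Top m (Top m f) = (\<lambda>v. \<mu> * f v)"
  shows "\<mu> ^ (2 * n) \<le> real_of_int N ^ 2 * real (ndiv (nat N)) * real (card (scwords m N (4 * n)))"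
proof -
  define F where "F g = (\<Sum>v\<in>pvec N. f v * f (act g v))" for g
  define U where "U = {t \<in> {0..<N}. coprime t N}"
  define W where "W = wlists m (2 * n)"
  define h where "h p = mmod N (smat (snd p) (prod_list (fst p)))" for p :: "mat2 list \<times> int"
  define c where "c g = real (card {p \<in> W \<times> U. h p = g})" for g
  have finU: "finite U" unfolding U_def by (rule finite_subset[of _ "{0..<N}"]) auto
  have finW: "finite W" by (simp add: W_def)
  have cU: "card U = ph N" by (simp add: U_def ph_def)
  have php: "real (ph N) > 0" using ph_pos[OF N] by simp
  have WS: "det2 (prod_list ws) = 1" if "ws \<in> W" for ws
    using wlists_SL2 that by (auto simp: W_def SL2_def)
  have hGL: "h p \<in> GL N" if "p \<in> W \<times> U" for p
    unfolding h_def using that WS by (intro mmod_in_GL) (auto simp: det2_smat U_def)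
  have Fh: "F (h p) = F (prod_list (fst p))" if p: "p \<in> W \<times> U" for p
    unfolding F_def
  proof (rule sum.cong[OF refl])
    fix v assume v: "v \<in> pvec N"
    let ?g = "prod_list (fst p)"
    have d: "det2 ?g = 1" "coprime (snd p) N" using p WS by (auto simp: U_def)
    have "f (act (h p) v) = f (act (smat (snd p) ?g) v)"
      unfolding h_def using lev_vmod[OF f(2)] vmod_act_mmod by metis
    also have "\<dots> = f (act ?g v)"
    proof (rule lev_eq[OF f(2)])
      show "prim N (act ?g v)" "prim N (act (smat (snd p) ?g) v)"
        using v d by (auto simp: pvec_def det2_smat intro!: prim_act)
      have "cross (act (smat (snd p) ?g) v) (act ?g v) = 0"
        by (simp add: cross_def act_def smat_def algebra_simps)
      then show "N dvd cross (act (smat (snd p) ?g) v) (act ?g v)" by simp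
    qed
    finally show "f v * f (act (h p) v) = f v * f (act ?g v)" by simp
  qed
  have "(\<Sum>ws\<in>W. F (prod_list ws)) = (\<Sum>v\<in>pvec N. f v * (Top m ^^ (2 * n)) f v)"
    unfolding F_def Top_funpow W_def sum_distrib_left by (rule sum.swap)
  also have "\<dots> = \<mu> ^ n * sqn N f"
    unfolding Top_eigen_power[OF eig] sqn_def sum_distrib_left
    by (intro sum.cong refl) (simp add: power2_eq_square)
  finally have 1: "(\<Sum>ws\<in>W. F (prod_list ws)) = \<mu> ^ n * sqn N f" .
  have "real (ph N) * (\<mu> ^ n * sqn N f) = (\<Sum>ws\<in>W. \<Sum>t\<in>U. F (prod_list ws))"
    using 1 by (simp add: cU sum_distrib_left[symmetric])
  also have "\<dots> = (\<Sum>p\<in>W \<times> U. F (prod_list (fst p)))"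
    unfolding sum.cartesian_product by (rule sum.cong) auto
  also have "\<dots> = (\<Sum>p\<in>W \<times> U. F (h p))" using Fh by (intro sum.cong refl) auto
  also have "\<dots> = (\<Sum>g\<in>GL N. \<Sum>p\<in>{p \<in> W \<times> U. h p = g}. F (h p))"
    by (rule sum.group[symmetric]) (use finW finU N hGL in auto)
  also have "\<dots> = (\<Sum>g\<in>GL N. c g * F g)"
  proof (rule sum.cong[OF refl])
    fix g
    have "(\<Sum>p\<in>{p \<in> W \<times> U. h p = g}. F (h p)) = (\<Sum>p\<in>{p \<in> W \<times> U. h p = g}. F g)"
      by (rule sum.cong) auto
    then show "(\<Sum>p\<in>{p \<in> W \<times> U. h p = g}. F (h p)) = c g * F g" by (simp add: c_def)
  qed
  finally have "(real (ph N) * (\<mu> ^ n * sqn N f))\<^sup>2 = (\<Sum>g\<in>GL N. c g * F g)\<^sup>2" by simp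
  also have "\<dots> \<le> (\<Sum>g\<in>GL N. (c g)\<^sup>2) * (\<Sum>g\<in>GL N. (F g)\<^sup>2)"
    by (rule Cauchy_Schwarz_ineq_sum)
  also have "\<dots> \<le> (real (card (scwords m N (4 * n))) * real (ph N)) *
      (real_of_int N * real (ph N) ^ 2 * real (ndiv (nat N)) * (sqn N f)\<^sup>2)"
  proof (intro mult_mono)
    show "(\<Sum>g\<in>GL N. (F g)\<^sup>2) \<le> real_of_int N * real (ph N) ^ 2 * real (ndiv (nat N)) * (sqn N f)\<^sup>2"
      unfolding F_def by (rule lnew_quasirandom[OF f N])
    let ?E = "SIGMA p:W \<times> U. {q \<in> W \<times> U. h q = h p}"
    \<comment> \<open>A collision of two words of length \<open>2 * n\<close> yields one word of
      length \<open>4 * n\<close> for their quotient, which is scalar modulo \<open>N\<close>. The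
      known lengths tell where to cut it, and the second scalar is recovered from the first, so this
      map is injective.\<close>
    let ?J = "\<lambda>(p, q). (fst p @ rev (map adj2 (fst q)), snd p)"
    have "(\<Sum>g\<in>GL N. (card {p \<in> W \<times> U. h p = g})\<^sup>2) = (\<Sum>g\<in>GL N. \<Sum>p\<in>{p \<in> W \<times> U. h p = g}. card {q \<in> W \<times> U. h q = h p})"
    proof (rule sum.cong[OF refl])
      fix g
      have "(\<Sum>p\<in>{p \<in> W \<times> U. h p = g}. card {q \<in> W \<times> U. h q = h p}) =
          (\<Sum>p\<in>{p \<in> W \<times> U. h p = g}. card {q \<in> W \<times> U. h q = g})"
        by (rule sum.cong) auto
      then show "(card {p \<in> W \<times> U. h p = g})\<^sup>2 = (\<Sum>p\<in>{p \<in> W \<times> U. h p = g}. card {q \<in> W \<times> U. h q = h p})"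
        by (simp add: power2_eq_square)
    qed
    also have "\<dots> = (\<Sum>p\<in>W \<times> U. card {q \<in> W \<times> U. h q = h p})"
      by (rule sum.group) (use finW finU N hGL in auto)
    also have "\<dots> = card ?E" using finW finU by simp
    also have "\<dots> \<le> card (scwords m N (4 * n) \<times> U)"
    proof (rule card_inj_on_le)
      have key: "scal N (prod_list ws * adj2 (prod_list ws')) \<and> t' = (t * m11 (prod_list ws * adj2 (prod_list ws'))) mod N"
        if "ws \<in> W" "ws' \<in> W" "t \<in> U" "t' \<in> U" "h (ws', t') = h (ws, t)" for ws ws' t t'
      proof -
        let ?a = "prod_list ws" and ?b = "prod_list ws'"
        let ?d = "?a * adj2 ?b"
        have "mmod N (mmod N (smat t ?a) * adj2 ?b) = mmod N (mmod N (smat t' ?b) * adj2 ?b)"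
          using that(5) by (simp add: h_def)
        then have "mmod N (smat t ?d) = mmod N (smat t' 1)"
          using adj2_mult_self(2)[OF WS[OF that(2)]] by (simp only: mmod_times_left smat_times)
        then have e: "[t * m11 ?d = t'] (mod N)" "[t * m12 ?d = 0] (mod N)"
          "[t * m21 ?d = 0] (mod N)" "[t * m22 ?d = t'] (mod N)"
          unfolding mmod_eq_iff by (simp_all add: smat_def del: mat2_sel_times)
        have cop: "coprime N t" using that(3) by (simp add: U_def coprime_commute)
        have "N dvd t * m12 ?d" "N dvd t * m21 ?d" using e(2,3) by (simp_all only: cong_0_iff)
        then have "N dvd m12 ?d" "N dvd m21 ?d" using cop coprime_dvd_mult_right_iff by blast+
        moreover have "[t * m11 ?d = t * m22 ?d] (mod N)" using e(1,4) cong_trans cong_sym by blast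
        then have "N dvd t * (m11 ?d - m22 ?d)" by (simp add: cong_iff_dvd_diff right_diff_distrib del: mat2_sel_times)
        then have "N dvd m11 ?d - m22 ?d" using cop coprime_dvd_mult_right_iff by blast
        ultimately have "scal N ?d" unfolding scal_def by blast
        moreover have "t' mod N = (t * m11 ?d) mod N"
          using e(1) by (simp only: cong_unfold)
        moreover have "t' mod N = t'" using that(4) by (simp add: U_def)
        ultimately show ?thesis by simp
      qed
      show "?J ` ?E \<subseteq> scwords m N (4 * n) \<times> U"
      proof (rule image_subsetI)
        fix x assume x: "x \<in> ?E"
        obtain ws t ws' t' where xe: "x = ((ws, t), (ws', t'))" by (metis surj_pair)
        have m: "ws \<in> W" "ws' \<in> W" "t \<in> U" "t' \<in> U" "h (ws', t') = h (ws, t)" using x by (auto simp: xe)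
        have "set (ws @ rev (map adj2 ws')) \<subseteq> steps m" "length (ws @ rev (map adj2 ws')) = 4 * n"
          using m(1,2) by (auto simp: W_def wlists_def adj2_steps)
        then have "ws @ rev (map adj2 ws') \<in> scwords m N (4 * n)"
          using key[OF m] by (simp add: scwords_def wlists_def prod_list_rev_adj2)
        with m show "?J x \<in> scwords m N (4 * n) \<times> U" by (simp add: xe)
      qed
      show "inj_on ?J ?E"
      proof (rule inj_onI)
        fix x y assume x: "x \<in> ?E" and y: "y \<in> ?E" and eq: "?J x = ?J y"
        obtain ws t ws' t' where xe: "x = ((ws, t), (ws', t'))" by (metis surj_pair)
        obtain vs s vs' s' where ye: "y = ((vs, s), (vs', s'))" by (metis surj_pair)
        have m: "ws \<in> W" "ws' \<in> W" "t \<in> U" "t' \<in> U" "h (ws', t') = h (ws, t)" using x by (auto simp: xe)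
        have l: "vs \<in> W" "vs' \<in> W" "s \<in> U" "s' \<in> U" "h (vs', s') = h (vs, s)" using y by (auto simp: ye)
        have "ws @ rev (map adj2 ws') = vs @ rev (map adj2 vs')" and ts: "t = s" using eq by (auto simp: xe ye)
        moreover have "length ws = length vs" using m l by (simp add: W_def wlists_def)
        ultimately have wv: "ws = vs" and "map adj2 ws' = map adj2 vs'" by auto
        then have wv': "ws' = vs'" by (metis (mono_tags, lifting) adj2_adj2 injI map_injective)
        show "x = y" using key[OF m] key[OF l] wv wv' ts by (simp add: xe ye)
      qed
      show "finite (scwords m N (4 * n) \<times> U)" using finU by (simp add: scwords_def)
    qed
    also have "\<dots> = card (scwords m N (4 * n)) * ph N" by (simp add: card_cartesian_product cU)
    finally have "(\<Sum>g\<in>GL N. (card {p \<in> W \<times> U. h p = g})\<^sup>2) \<le> card (scwords m N (4 * n)) * ph N" .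
    then have "real (\<Sum>g\<in>GL N. (card {p \<in> W \<times> U. h p = g})\<^sup>2) \<le> real (card (scwords m N (4 * n)) * ph N)"
      by (simp only: of_nat_le_iff)
    then show "(\<Sum>g\<in>GL N. (c g)\<^sup>2) \<le> real (card (scwords m N (4 * n))) * real (ph N)"
      by (simp add: c_def)
  qed (auto intro!: sum_nonneg)
  finally have "(real (ph N) * sqn N f)\<^sup>2 * (\<mu> ^ n)\<^sup>2 \<le>
      (real (ph N) * sqn N f)\<^sup>2 * (real_of_int N * real (ph N) * real (ndiv (nat N)) * real (card (scwords m N (4 * n))))"
    by (simp add: power2_eq_square mult_ac)
  then have "(real (ph N) * sqn N f)\<^sup>2 * \<mu> ^ (2 * n) \<le>
      (real (ph N) * sqn N f)\<^sup>2 * (real_of_int N * real (ph N) * real (ndiv (nat N)) * real (card (scwords m N (4 * n))))"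
    by (simp only: power_mult[symmetric] mult.commute[of n 2])
  moreover have "(real (ph N) * sqn N f)\<^sup>2 > 0" using php pos by simp
  ultimately have "\<mu> ^ (2 * n) \<le> real_of_int N * real (ph N) * real (ndiv (nat N)) * real (card (scwords m N (4 * n)))"
    by (simp only: mult_le_cancel_left_pos)
  also have "\<dots> \<le> real_of_int N * real_of_int N * real (ndiv (nat N)) * real (card (scwords m N (4 * n)))"
    using ph_le[OF N] N by (intro mult_right_mono mult_left_mono) auto
  finally show ?thesis by (simp add: power2_eq_square)
qed

theorem card_scwords_le:
  assumes m: "m \<ge> 1"
  shows "real (card (scwords m N n)) \<le>
    stepK m ^ n * (\<Sum>g\<in>{g \<in> SL2. nm g \<le> (64 * m) ^ n \<and> scal N g}. 1 / real_of_int (nm g))"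
proof -
  let ?S = "{g \<in> SL2. nm g \<le> (64 * m) ^ n \<and> scal N g}"
  have finS: "finite ?S" by (rule finite_subset[OF _ finite_nm_le[of "(64 * m) ^ n"]]) auto
  have "card (scwords m N n) = (\<Sum>g\<in>?S. card {ws \<in> scwords m N n. prod_list ws = g})"
    using sum.group[of "scwords m N n" ?S prod_list "\<lambda>_. 1::nat"] finS wlists_SL2 wlists_nm[OF m]
    by (force simp: scwords_def)
  also have "\<dots> \<le> (\<Sum>g\<in>?S. card {ws \<in> wlists m n. prod_list ws = g})"
    by (intro sum_mono card_mono) (auto simp: scwords_def)
  finally have "real (card (scwords m N n)) \<le> (\<Sum>g\<in>?S. real (card {ws \<in> wlists m n. prod_list ws = g}))"
    by (simp only: of_nat_le_iff of_nat_sum[symmetric])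
  also have "\<dots> \<le> (\<Sum>g\<in>?S. stepK m ^ n * (1 / real_of_int (nm g)))"
    using card_words_le[OF m] by (intro sum_mono) auto
  finally show ?thesis by (simp add: sum_distrib_left)
qed

section \<open>Choice of the word length and of the exponents\<close>

lemma log_power_eventually:
  assumes "c > 0"
  shows "eventually (\<lambda>x::real. c * (1 + ln x) * x powr (-1/5) \<le> x powr (-1/10)) at_top"
proof -
  have "((\<lambda>x::real. (1 + ln x) * x powr (-1/10)) \<longlongrightarrow> 0) at_top" by real_asymp
  then have "eventually (\<lambda>x::real. (1 + ln x) * x powr (-1/10) < 1 / c) at_top"
    by (rule order_tendstoD) (use assms in simp)
  then show ?thesis using eventually_gt_at_top[of 0]
  proof eventually_elim
    case (elim x)
    then have "c * ((1 + ln x) * x powr (-1/10)) \<le> 1" using assms by (simp add: field_simps)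
    then have "c * ((1 + ln x) * x powr (-1/10)) * x powr (-1/10) \<le> 1 * x powr (-1/10)"
      by (intro mult_right_mono) auto
    moreover have "x powr (-1/5) = x powr (-1/10) * x powr (-1/10)"
      by (simp add: powr_add[symmetric])
    ultimately show ?case by (simp add: mult_ac)
  qed
qed

lemma powr_of_power:
  fixes x :: real
  assumes "x > 0"
  shows "(x ^ n) powr a = x powr (real n * a)"
  by (simp only: powr_realpow[OF assms, symmetric] powr_powr)

lemma power_of_powr:
  fixes x :: real
  assumes "x > 0"
  shows "(x powr a) ^ n = x powr (real n * a)"
proof -
  have "x powr a > 0" using assms by simp
  from powr_realpow[OF this, symmetric, of n] show ?thesis
    by (simp only: powr_powr mult.commute)
qed

lemma exists_power_sandwich:
  fixes X y :: real
  assumes "X > 1" "y > X"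
  obtains n where "n \<ge> 2" "y \<le> X ^ n" "X ^ (n - 1) < y"
proof -
  define n where "n = (LEAST n. y \<le> X ^ n)"
  obtain k where "y < X ^ k" using real_arch_pow[OF assms(1)] by blast
  then have 1: "y \<le> X ^ n" unfolding n_def by (intro LeastI[of "\<lambda>n. y \<le> X ^ n" k]) simp
  have n2: "n \<ge> 2"
  proof (rule ccontr)
    assume "\<not> n \<ge> 2"
    then have "n = 0 \<or> n = 1" by linarith
    then show False using 1 assms by auto
  qed
  then have "n - 1 < n" by simp
  then have "\<not> y \<le> X ^ (n - 1)" unfolding n_def by (rule not_less_Least)
  with 1 n2 show ?thesis by (intro that) auto
qed

text \<open>Words have length \<open>4 * n\<close> and norm at most \<open>R\<close>, where
  \<open>R\<close> is comparable with \<open>N^3\<close>. The exponents of \<open>N\<close> are 2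
  and 1/16 from \<open>new_eigenvalue_le_words\<close>, -27/10 from the power of
  \<open>stepK m\<close>, and 7/16 from \<open>scal_sum\<close>: 6/16 for divisors of numbers up to
  about \<open>R^2\<close> and 1/16 for \<open>sq1\<close>. The total is -1/5, of which half absorbs
  the constants and a logarithm. The cube is the largest power for which the term
  \<open>R / N^3\<close> in \<open>scal_sum\<close> stays bounded.\<close>

theorem new_eigenvalue_bound:
  obtains m :: int and \<theta> :: real and E0 :: int where "m \<ge> 1" "0 < \<theta>" "\<theta> < 1"
    "\<And>N f \<mu>. N \<ge> E0 \<Longrightarrow> N > 1 \<Longrightarrow> lnew N f \<Longrightarrow> lev N f \<Longrightarrow> sqn N f > 0 \<Longrightarrow> \<mu> \<ge> 0 \<Longrightarrow>
      Top m (Top m f) = (\<lambda>v. \<mu> * f v) \<Longrightarrow> \<mu> \<le> \<theta> * real (card (steps m)) ^ 2"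
proof -
  obtain k :: nat where k: "k \<ge> 2" "stepK k \<le> real (card (steps k)) * (64 * real k) powr (-9/10)"
    using exists_good_steps by blast
  define m where "m = int k"
  define X where "X = 64 * real k"
  define M where "M = real (card (steps m))"
  obtain C where C: "C \<ge> 1" "\<And>m. m > 0 \<Longrightarrow> real (ndiv m) \<le> C * real m powr (1/16)"
    using divisor_bound by blast
  have X: "X \<ge> 128" using k(1) by (simp add: X_def)
  have m1: "m \<ge> 1" using k(1) by (simp add: m_def)
  have Xm: "real_of_int (64 * m) = X" by (simp add: X_def m_def)
  have K: "stepK m \<le> M * X powr (-9/10)" using k(2) by (simp add: m_def M_def X_def)
  have K0: "stepK m \<ge> 0"
    using m1 by (auto simp: stepK_def slopeC_def intro!: add_nonneg_nonneg mult_nonneg_nonneg harm_nonneg)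
  have "1 \<in> steps m" by (simp add: steps_def gens_def)
  then have M0: "M > 0" unfolding M_def using finite_steps card_gt_0_iff by (metis empty_iff of_nat_0_less_iff)
  \<comment> \<open>\<open>c1\<close> comes from the divisor bound for numbers up to
    \<open>2 * X^8 * x^6\<close>, \<open>c2\<close> from the harmonic number at \<open>R\<close>,
    \<open>c3\<close> from the count of residues, and \<open>c4\<close> combines them as in
    \<open>scal_sum\<close>.\<close>
  define c1 where "c1 = (2 * X ^ 8) powr (1/16)"
  define c2 where "c2 = 4 + 4 * ln X"
  define c3 where "c3 = 2 * X ^ 4 + 1"
  define c4 where "c4 = 12 * c2 + 96 * C ^ 2 * c1 * c2 * c3"
  have c1: "c1 > 0" using X by (simp add: c1_def)
  have c2: "c2 \<ge> 4" using X by (simp add: c2_def)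
  have c3: "c3 \<ge> 1" using X by (simp add: c3_def)
  have "96 * C ^ 2 * c1 * c2 * c3 \<ge> 0" using C(1) c1 c2 c3 by simp
  then have c4: "c4 > 0" unfolding c4_def using c2 by linarith
  have "C * c4 > 0" using C(1) c4 by simp
  from eventually_conj[OF log_power_eventually[OF this] eventually_gt_at_top[of "X ^ 4 + 1"]]
  obtain x0 where x0: "\<And>x. x \<ge> x0 \<Longrightarrow> C * c4 * (1 + ln x) * x powr (-1/5) \<le> x powr (-1/10) \<and> X ^ 4 + 1 < x"
    unfolding eventually_at_top_linorder by blast
  \<comment> \<open>The remaining exponent -1/10 of \<open>x\<close> is divided by 3 because it is
    \<open>x^3\<close> that is compared with a power of \<open>X\<close>.\<close>
  define \<theta> where "\<theta> = X powr (-1/30)"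
  have \<theta>: "0 < \<theta>" "\<theta> < 1" using X by (auto simp: \<theta>_def powr_less_one)
  have main: "\<mu> \<le> \<theta> * real (card (steps m)) ^ 2"
    if NE: "N \<ge> \<lceil>x0\<rceil>" and N1: "N > 1" and f: "lnew N f" "lev N f" and pos: "sqn N f > 0" and \<mu>: "\<mu> \<ge> 0"
      and eig: "Top m (Top m f) = (\<lambda>v. \<mu> * f v)" for N f \<mu>
  proof -
    define x where "x = real_of_int N"
    have xx0: "x \<ge> x0" using NE by (simp add: x_def ceiling_le_iff)
    have x1: "x \<ge> 2" using N1 by (simp add: x_def)
    have xX: "X ^ 4 < x" using x0[OF xx0] by linarith
    have x3: "x \<le> x ^ 3" using x1 by (simp add: self_le_power)
    have X4: "X ^ 4 > 1" using X by (simp add: one_less_power)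
    obtain n where n: "n \<ge> 2" "x ^ 3 \<le> (X ^ 4) ^ n" "(X ^ 4) ^ (n - 1) < x ^ 3"
      using exists_power_sandwich[OF X4, of "x ^ 3"] xX x3 by (metis less_le_trans)
    define R where "R = (64 * m) ^ (4 * n)"
    have Rr: "real_of_int R = X ^ (4 * n)" by (simp add: R_def Xm[symmetric])
    have R1: "x ^ 3 \<le> real_of_int R" using n(2) by (simp add: Rr power_mult)
    have "X ^ (4 * n) = X ^ 4 * (X ^ 4) ^ (n - 1)"
      using n(1) by (simp add: power_mult power_Suc[symmetric] del: power_Suc)
    then have R2: "real_of_int R \<le> X ^ 4 * x ^ 3"
      using n(3) X by (simp add: Rr mult_left_mono)
    have Rpos: "real_of_int R \<ge> 1" using R1 x1 x3 by linarith
    have R0: "R \<ge> 0" using Rpos by linarith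
    define L where "L = 1 + ln x"
    have L: "L \<ge> 1" using x1 by (simp add: L_def)
    define H where "H = (harm (nat R) :: real)"
    have "H \<le> 1 + ln (real (nat R))" unfolding H_def using Rpos by (intro harm_le_ln) linarith
    also have "real (nat R) = real_of_int R" using R0 by simp
    also have "ln (real_of_int R) \<le> ln (X ^ 4 * x ^ 3)" using R2 Rpos by (intro ln_mono) auto
    also have "ln (X ^ 4 * x ^ 3) = 4 * ln X + 3 * ln x"
      using X x1 by (simp add: ln_mult ln_realpow)
    finally have H1: "H \<le> 1 + 4 * ln X + 3 * ln x" by simp
    have lX: "ln X \<ge> 0" and lx: "ln x \<ge> 0" using X x1 by auto
    have H: "H \<le> c2 * L"
    proof -
      have "c2 * L = 4 + 4 * ln X + 4 * ln x + 4 * (ln X * ln x)" by (simp add: c2_def L_def algebra_simps)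
      moreover have "ln X * ln x \<ge> 0" using lX lx by simp
      ultimately show ?thesis using H1 lx by linarith
    qed
    have H0: "H \<ge> 0" by (simp add: H_def harm_nonneg)
    have cL: "1 \<le> c2 * L" using c2 L mult_mono[of 1 c2 1 L] by simp
    define D where "D = C * c1 * x powr (6/16)"
    have D0: "D \<ge> 0" using C(1) c1 by (simp add: D_def)
    have D: "real (ndiv j) \<le> D" if j: "j > 0" "int j \<le> R * R + 1" for j
    proof -
      have "real j \<le> real_of_int (R * R + 1)" using j(2) by linarith
      also have "\<dots> \<le> 2 * (real_of_int R * real_of_int R)"
        using mult_mono[of 1 "real_of_int R" 1 "real_of_int R"] Rpos by simp
      also have "\<dots> \<le> 2 * ((X ^ 4 * x ^ 3) * (X ^ 4 * x ^ 3))"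
        using R2 Rpos by (intro mult_left_mono mult_mono) auto
      also have "\<dots> = (2 * X ^ 8) * x ^ 6" by (simp add: power_mult_distrib algebra_simps flip: power_add)
      finally have "real j powr (1/16) \<le> ((2 * X ^ 8) * x ^ 6) powr (1/16)"
        by (intro powr_mono2) auto
      also have "\<dots> = c1 * (x ^ 6) powr (1/16)"
        using X x1 by (simp add: powr_mult c1_def)
      also have "(x ^ 6) powr (1/16) = x powr (6/16)"
        using x1 by (simp add: powr_of_power)
      finally have "C * real j powr (1/16) \<le> C * (c1 * x powr (6/16))" using C(1) by (intro mult_left_mono) auto
      then show ?thesis using C(2)[OF j(1)] by (simp add: D_def mult.assoc)
    qed
    have ndN: "real (ndiv (nat N)) \<le> C * x powr (1/16)"
      using C(2)[of "nat N"] N1 by (simp add: x_def)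
    have rho: "real (card (sq1 N)) \<le> 3 * C * x powr (1/16)"
    proof -
      have "real (card (sq1 N)) \<le> real (3 * ndiv (nat N))"
        using card_sq1[of N] N1 by (simp only: of_nat_le_iff)
      then show ?thesis using ndN by simp
    qed
    have frac: "(2 * real_of_int R / x ^ 2 + 1) / x \<le> c3"
    proof -
      have "2 * real_of_int R / x ^ 2 \<le> 2 * (X ^ 4 * x ^ 3) / x ^ 2"
        using R2 by (intro divide_right_mono) auto
      also have "\<dots> = 2 * X ^ 4 * x" using x1 by (simp add: power2_eq_square power3_eq_cube)
      finally have "(2 * real_of_int R / x ^ 2 + 1) / x \<le> (2 * X ^ 4 * x + 1) / x"
        using x1 by (intro divide_right_mono) auto
      also have "\<dots> = 2 * X ^ 4 + 1 / x" using x1 by (simp add: field_simps)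
      also have "\<dots> \<le> c3" using x1 by (simp add: c3_def)
      finally show ?thesis .
    qed
    have frac0: "(2 * real_of_int R / x ^ 2 + 1) / x \<ge> 0" using x1 Rpos by simp
    let ?B = "\<Sum>g\<in>{g \<in> SL2. nm g \<le> R \<and> scal N g}. 1 / real_of_int (nm g)"
    have "?B \<le> 4 * (1 + 2 * H) + 16 * D * real (card (sq1 N)) * (1 + H) * ((2 * real_of_int R / x ^ 2 + 1) / x)"
      using scal_sum[of N R D] N1 R0 D D0 by (simp add: H_def x_def)
    also have "\<dots> \<le> 4 * (3 * (c2 * L)) + 16 * D * (3 * C * x powr (1/16)) * (2 * (c2 * L)) * c3"
      using H cL H0 D0 rho frac frac0 C(1) c2 L
      by (intro add_mono mult_mono mult_left_mono mult_nonneg_nonneg) auto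
    also have "\<dots> = 12 * c2 * L + 96 * C ^ 2 * c1 * c2 * c3 * L * (x powr (6/16) * x powr (1/16))"
      by (simp add: D_def power2_eq_square)
    also have "x powr (6/16) * x powr (1/16) = x powr (7/16)" by (simp add: powr_add[symmetric])
    also have "12 * c2 * L + 96 * C ^ 2 * c1 * c2 * c3 * L * x powr (7/16) \<le> c4 * L * x powr (7/16)"
    proof -
      have "12 * c2 * L * 1 \<le> 12 * c2 * L * x powr (7/16)"
        using x1 c2 L by (intro mult_left_mono ge_one_powr_ge_zero) auto
      then show ?thesis by (simp add: c4_def algebra_simps)
    qed
    finally have B: "?B \<le> c4 * L * x powr (7/16)" .
    have B0: "?B \<ge> 0" by (intro sum_nonneg) auto
    have KR: "stepK m ^ (4 * n) \<le> M ^ (4 * n) * x powr (-27/10)"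
    proof -
      have "stepK m ^ (4 * n) \<le> (M * X powr (-9/10)) ^ (4 * n)" using K K0 by (rule power_mono)
      also have "\<dots> = M ^ (4 * n) * (X powr (-9/10)) ^ (4 * n)" by (rule power_mult_distrib)
      also have "(X powr (-9/10)) ^ (4 * n) = (X ^ (4 * n)) powr (-9/10)"
      proof -
        have "X > 0" using X by linarith
        then show ?thesis by (simp only: powr_of_power power_of_powr)
      qed
      also have "\<dots> \<le> (x ^ 3) powr (-9/10)"
        using R1 x1 by (intro powr_mono2') (auto simp: Rr)
      also have "(x ^ 3) powr (-9/10) = x powr (-27/10)"
        using x1 by (simp add: powr_of_power)
      finally show ?thesis using M0 by (simp add: mult_left_mono)
    qed
    have "\<mu> ^ (2 * n) \<le> x ^ 2 * real (ndiv (nat N)) * real (card (scwords m N (4 * n)))"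
      using new_eigenvalue_le_words[OF f _ pos eig, of n] N1 by (simp add: x_def)
    also have "\<dots> \<le> x ^ 2 * (C * x powr (1/16)) * ((M ^ (4 * n) * x powr (-27/10)) * (c4 * L * x powr (7/16)))"
    proof (intro mult_mono)
      have "real (card (scwords m N (4 * n))) \<le> stepK m ^ (4 * n) * ?B"
        using card_scwords_le[OF m1, of N "4 * n"] by (simp add: R_def)
      also have "\<dots> \<le> (M ^ (4 * n) * x powr (-27/10)) * (c4 * L * x powr (7/16))"
        using KR B B0 M0 by (intro mult_mono) auto
      finally show "real (card (scwords m N (4 * n))) \<le> (M ^ (4 * n) * x powr (-27/10)) * (c4 * L * x powr (7/16))" .
    qed (use ndN C(1) in auto)
    also have "\<dots> = M ^ (4 * n) * (C * c4 * L * (x powr 2 * x powr (1/16) * x powr (-27/10) * x powr (7/16)))"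
    proof -
      have "x powr 2 = x ^ 2" using x1 powr_realpow[of x 2] by simp
      then show ?thesis by (simp add: mult_ac)
    qed
    also have "x powr 2 * x powr (1/16) * x powr (-27/10) * x powr (7/16) = x powr (-1/5)"
      by (simp add: powr_add[symmetric])
    also have "M ^ (4 * n) * (C * c4 * L * x powr (-1/5)) \<le> M ^ (4 * n) * x powr (-1/10)"
      using x0[OF xx0] M0 by (intro mult_left_mono) (auto simp: L_def)
    also have "x powr (-1/10) \<le> \<theta> ^ (2 * n)"
    proof -
      have "x powr (-1/10) = (x ^ 3) powr (-1/30)"
        using x1 by (simp add: powr_of_power)
      also have "\<dots> \<le> ((X ^ 4) ^ (n - 1)) powr (-1/30)"
        using n(3) X by (intro powr_mono2') auto
      also have "\<dots> \<le> (X ^ (2 * n)) powr (-1/30)"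
      proof (intro powr_mono2')
        \<comment> \<open>Here \<open>n \<ge> 2\<close> enters, through
          \<open>2 * n \<le> 4 * (n - 1)\<close>.\<close>
        have "X ^ (2 * n) \<le> X ^ (4 * (n - 1))" using X n(1) by (intro power_increasing) auto
        then show "X ^ (2 * n) \<le> (X ^ 4) ^ (n - 1)" by (simp add: power_mult)
      qed (use X in auto)
      also have "\<dots> = \<theta> ^ (2 * n)"
      proof -
        have "X > 0" using X by linarith
        then show ?thesis by (simp only: \<theta>_def powr_of_power power_of_powr)
      qed
      finally show ?thesis .
    qed
    finally have "\<mu> ^ (2 * n) \<le> M ^ (4 * n) * \<theta> ^ (2 * n)" using M0 by (simp add: mult_left_mono)
    also have "\<dots> = (\<theta> * M ^ 2) ^ (2 * n)"
      by (simp add: power_mult_distrib power_mult[symmetric] mult_ac)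
    finally have "\<mu> ^ (2 * n) \<le> (\<theta> * M ^ 2) ^ (2 * n)" .
    then have "\<mu> \<le> \<theta> * M ^ 2" using \<mu> \<theta> n(1) by (simp add: power_mono_iff)
    then show ?thesis by (simp add: M_def)
  qed
  show ?thesis by (rule that[OF m1 \<theta> main])
qed

section \<open>Maximal eigenvectors and generation of \<open>SL\<^sub>2(\<int>)\<close>\<close>

text \<open>The form \<open>ip (T f) (T f)\<close> is maximised on the unit sphere of
  \<open>E\<close>. The functions may live on an infinite type, but the hypothesis
  \<open>bound\<close> confines the sphere to a product of intervals, which is compact by
  Tychonoff.\<close>

lemma max_eigenvector:
  fixes I :: "'a set" and E :: "('a \<Rightarrow> real) set" and T :: "('a \<Rightarrow> real) \<Rightarrow> 'a \<Rightarrow> real"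
  defines "ip \<equiv> \<lambda>f g. \<Sum>i\<in>I. f i * g i"
  assumes closed: "closed E"
    and lin: "\<And>f g a b. f \<in> E \<Longrightarrow> g \<in> E \<Longrightarrow> (\<lambda>x. a * f x + b * g x) \<in> E"
    and bound: "\<And>f x. f \<in> E \<Longrightarrow> (f x)\<^sup>2 \<le> ip f f"
    and TE: "\<And>f. f \<in> E \<Longrightarrow> T f \<in> E"
    and Tlin: "\<And>f g a b. T (\<lambda>x. a * f x + b * g x) = (\<lambda>x. a * T f x + b * T g x)"
    and Tsym: "\<And>f g. f \<in> E \<Longrightarrow> g \<in> E \<Longrightarrow> ip (T f) g = ip f (T g)"
    and Tcont: "\<And>x. continuous_on UNIV (\<lambda>f. T f x)"
    and ne: "h0 \<in> E" "ip h0 h0 > 0"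
  obtains \<mu> f where "f \<in> E" "ip f f = 1" "\<mu> \<ge> 0" "T (T f) = (\<lambda>x. \<mu> * f x)"
    "\<And>g. g \<in> E \<Longrightarrow> ip (T g) (T g) \<le> \<mu> * ip g g"
proof -
  define S where "S = {f \<in> E. ip f f = 1}"
  define q where "q f = ip (T f) (T f)" for f
  have ip_comb: "ip (\<lambda>x. a * f x + b * g x) (\<lambda>x. a * f x + b * g x) =
      a\<^sup>2 * ip f f + 2 * a * b * ip f g + b\<^sup>2 * ip g g" for a b f g
    by (simp add: ip_def sum.distrib[symmetric] sum_distrib_left power2_eq_square algebra_simps)
  have ip_nonneg: "ip f f \<ge> 0" for f by (simp add: ip_def sum_nonneg)
  have ipcont: "continuous_on UNIV (\<lambda>f. ip f f)"
    unfolding ip_def by (intro continuous_intros continuous_on_product_coordinates)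
  have closedS: "closed S"
    unfolding S_def Collect_conj_eq Collect_mem_eq
    by (intro closed_Int closed closed_Collect_eq ipcont continuous_on_const)
  have "S \<subseteq> PiE UNIV (\<lambda>_. {-1..1})"
  proof
    fix f assume f: "f \<in> S"
    have "\<bar>f x\<bar> \<le> 1" for x
    proof -
      have "(f x)\<^sup>2 \<le> 1\<^sup>2" using bound[of f x] f by (simp add: S_def)
      then show ?thesis by (simp only: abs_le_square_iff[symmetric] abs_one)
    qed
    then show "f \<in> PiE UNIV (\<lambda>_. {-1..1})" by (auto simp: abs_le_iff minus_le_iff)
  qed
  moreover have "compact (PiE UNIV (\<lambda>_::'a. {-1..1::real}))"
  proof -
    have "compactin (product_topology (\<lambda>_. euclidean) UNIV) (PiE UNIV (\<lambda>_::'a. {-1..1::real}))"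
      by (simp add: compactin_PiE)
    then show ?thesis by (simp add: euclidean_product_topology)
  qed
  ultimately have compS: "compact S"
    using closedS compact_Int_closed[of "PiE UNIV (\<lambda>_. {-1..1})" S] by (simp add: Int_absorb1)
  have contq: "continuous_on S q"
    unfolding q_def ip_def
    by (intro continuous_intros continuous_on_subset[OF Tcont]) auto
  have scaleE: "(\<lambda>x. a * f x) \<in> E" if "f \<in> E" for a f
    using lin[OF that that, of a 0] by simp
  have scaleT: "T (\<lambda>x. a * f x) = (\<lambda>x. a * T f x)" for a f
    using Tlin[of a f 0 f] by simp
  have scaleip: "ip (\<lambda>x. a * f x) (\<lambda>x. a * f x) = a\<^sup>2 * ip f f" for a f
    using ip_comb[of a f 0 f] by simp
  have norm1: "(\<lambda>x. (1 / sqrt (ip g g)) * g x) \<in> S" if "g \<in> E" "ip g g > 0" for g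
    unfolding S_def mem_Collect_eq
  proof
    show "(\<lambda>x. (1 / sqrt (ip g g)) * g x) \<in> E" by (rule scaleE[OF that(1)])
    show "ip (\<lambda>x. (1 / sqrt (ip g g)) * g x) (\<lambda>x. (1 / sqrt (ip g g)) * g x) = 1"
      unfolding scaleip using that(2) by (simp add: power_divide)
  qed
  have "S \<noteq> {}" using norm1[OF ne] by blast
  then obtain f where f: "f \<in> S" "\<And>g. g \<in> S \<Longrightarrow> q g \<le> q f"
    using continuous_attains_sup[OF compS _ contq] by blast
  define \<mu> where "\<mu> = q f"
  have fE: "f \<in> E" and f1: "ip f f = 1" using f(1) by (auto simp: S_def)
  have \<mu>0: "\<mu> \<ge> 0" by (simp add: \<mu>_def q_def ip_nonneg)
  have zero: "g = (\<lambda>x. 0)" if "g \<in> E" "ip g g = 0" for g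
  proof
    fix x
    show "g x = 0" using bound[OF that(1), of x] that(2) by simp
  qed
  have max: "q g \<le> \<mu> * ip g g" if g: "g \<in> E" for g
  proof (cases "ip g g = 0")
    case True
    have "T g = (\<lambda>x. 0)" using scaleT[of 0 "\<lambda>x. 0"] zero[OF g True] by simp
    then show ?thesis by (simp add: q_def True) (simp add: ip_def)
  next
    case False
    then have p: "ip g g > 0" using ip_nonneg[of g] by simp
    have "q (\<lambda>x. (1 / sqrt (ip g g)) * g x) \<le> \<mu>" unfolding \<mu>_def by (rule f(2)[OF norm1[OF g p]])
    moreover have "q (\<lambda>x. (1 / sqrt (ip g g)) * g x) = q g / ip g g"
      unfolding q_def scaleT scaleip using p by (simp add: power_divide)
    ultimately have "q g / ip g g \<le> \<mu>" by simp
    then show ?thesis using p by (simp add: field_simps)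
  qed
  \<comment> \<open>The maximiser is perturbed along the residual \<open>r\<close> of the eigenvalue
    equation. The deficit \<open>\<mu> * ip g g - q g\<close> is nonnegative on both sides of
    \<open>t = 0\<close>, so its linear term, which is \<open>2 * t * ip r r\<close>, must
    vanish.\<close>
  define r where "r = (\<lambda>x. \<mu> * f x + (- 1) * T (T f) x)"
  have TfE: "T f \<in> E" and TTfE: "T (T f) \<in> E" using fE TE by auto
  have rE: "r \<in> E" unfolding r_def by (rule lin[OF fE TTfE])
  define a where "a = ip r r"
  define b where "b = \<mu> * ip r r - q r"
  have b0: "b \<ge> 0" using max[OF rE] by (simp add: b_def)
  have ipr: "ip f r * \<mu> - ip (T f) (T r) = a"
  proof -
    have "ip (T f) (T r) = ip (T (T f)) r" using Tsym[OF TfE rE] by simp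
    moreover have "ip r r = \<mu> * ip f r - ip (T (T f)) r"
      by (simp add: r_def ip_def sum_subtractf[symmetric] sum_distrib_left algebra_simps)
    ultimately show ?thesis by (simp add: a_def)
  qed
  have quad: "2 * t * a + t\<^sup>2 * b \<ge> 0" for t
  proof -
    let ?g = "\<lambda>x. 1 * f x + t * r x"
    have gE: "?g \<in> E" by (rule lin[OF fE rE])
    have "q ?g = q f + 2 * t * ip (T f) (T r) + t\<^sup>2 * q r"
      unfolding q_def Tlin ip_comb by simp
    moreover have "ip ?g ?g = 1 + 2 * t * ip f r + t\<^sup>2 * ip r r"
      unfolding ip_comb f1 by simp
    ultimately have "0 \<le> \<mu> * (1 + 2 * t * ip f r + t\<^sup>2 * ip r r) - (\<mu> + 2 * t * ip (T f) (T r) + t\<^sup>2 * q r)"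
      using max[OF gE] by (simp add: \<mu>_def)
    also have "\<dots> = 2 * t * (ip f r * \<mu> - ip (T f) (T r)) + t\<^sup>2 * b"
      by (simp add: b_def algebra_simps)
    finally show ?thesis unfolding ipr .
  qed
  have "a = 0"
  proof (rule ccontr)
    assume "a \<noteq> 0"
    \<comment> \<open>The denominator \<open>b + 1\<close> covers \<open>b = 0\<close>; at
      \<open>t = - s\<close> the linear term outweighs the quadratic one.\<close>
    define s where "s = a / (b + 1)"
    have as: "a = s * (b + 1)" using b0 by (simp add: s_def)
    have "2 * (- s) * a + (- s)\<^sup>2 * b = s\<^sup>2 * (- 2 * (b + 1) + b)"
      by (simp add: as power2_eq_square algebra_simps)
    moreover have "s\<^sup>2 > 0" using \<open>a \<noteq> 0\<close> b0 by (simp add: s_def)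
    then have "s\<^sup>2 * (- 2 * (b + 1) + b) < 0" using b0 by (intro mult_pos_neg) auto
    ultimately show False using quad[of "- s"] by simp
  qed
  then have "r = (\<lambda>x. 0)" using zero[OF rE] by (simp add: a_def)
  then have "T (T f) = (\<lambda>x. \<mu> * f x)" by (auto simp: r_def fun_eq_iff)
  with fE f1 \<mu>0 max show ?thesis by (intro that) (auto simp: q_def)
qed

text \<open>Left multiplication by \<open>matL\<close>, \<open>matU\<close> or an inverse is a
  subtractive Euclidean step on the first column, and it can be undone because \<open>P\<close>
  passes to inverses. The descent ends at a triangular matrix; the rotation \<open>S\<close> treats
  a vanishing upper left entry, and its square supplies the negative of the identity.\<close>

lemma SL2_induct [consumes 1, case_names L U times adj]:
  assumes g: "g \<in> SL2" and L: "P matL" and U: "P matU"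
    and times: "\<And>g h. g \<in> SL2 \<Longrightarrow> h \<in> SL2 \<Longrightarrow> P g \<Longrightarrow> P h \<Longrightarrow> P (g * h)"
    and adj: "\<And>g. g \<in> SL2 \<Longrightarrow> P g \<Longrightarrow> P (adj2 g)"
  shows "P g"
proof -
  have LS: "matL \<in> SL2" and US: "matU \<in> SL2" by (simp_all add: SL2_def matL_def matU_def)
  have cancel: "P g" if "P (h * g)" "P h" "h \<in> SL2" "g \<in> SL2" for g h
  proof -
    have "P (adj2 h * (h * g))" by (rule times[OF SL2_adj2[OF that(3)] SL2_times[OF that(3,4)] adj[OF that(3,2)] that(1)])
    moreover have "adj2 h * h = 1" using that(3) by (simp only: SL2_def mem_Collect_eq adj2_mult_self)
    then have "adj2 h * (h * g) = g" by (simp only: mult.assoc[symmetric] mult_1_left)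
    ultimately show ?thesis by simp
  qed
  have P1: "P 1" using cancel[where g = 1 and h = matL] L LS by simp
  have powU: "P (Mat 1 (int k) 0 1)" for k
  proof (induction k)
    case 0
    show ?case using P1 by (simp add: one_mat2_def)
  next
    case (Suc k)
    have "Mat 1 (int (Suc k)) 0 1 = matU * Mat 1 (int k) 0 1" by (simp add: matU_def mat2.expand)
    then show ?case using times[OF US _ U Suc] by (simp add: SL2_def)
  qed
  have powU': "P (Mat 1 k 0 1)" for k :: int
  proof (cases "k \<ge> 0")
    case True
    then show ?thesis using powU[of "nat k"] by simp
  next
    case False
    then have "P (adj2 (Mat 1 (int (nat (- k))) 0 1))" by (intro adj powU) (simp add: SL2_def)
    then show ?thesis using False by (simp add: adj2_def)
  qed
  define S where "S = matU * adj2 matL * matU"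
  have S: "P S" "S \<in> SL2" unfolding S_def by (intro times adj L U SL2_times SL2_adj2 LS US)+
  have Seq: "S = Mat 0 1 (-1) 0" by (simp add: S_def matU_def matL_def adj2_def mat2.expand)
  have "P (S * S)" by (rule times[OF S(2,2,1,1)])
  moreover have "S * S = Mat (-1) 0 0 (-1)" by (simp add: Seq mat2.expand)
  ultimately have Pm: "P (Mat (-1) 0 0 (-1))" by simp
  have triang: "P g" if "g \<in> SL2" "m21 g = 0" for g
  proof -
    have "m11 g * m22 g = 1" using that by (simp add: SL2_def det2_def)
    then consider "m11 g = 1" "m22 g = 1" | "m11 g = -1" "m22 g = -1"
      using zmult_eq_1_iff[of "m11 g" "m22 g"] by auto
    then show ?thesis
    proof cases
      case 1
      then have "g = Mat 1 (m12 g) 0 1" using that by (simp add: mat2.expand)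
      then show ?thesis using powU'[of "m12 g"] by simp
    next
      case 2
      then have "g = Mat (-1) 0 0 (-1) * Mat 1 (- m12 g) 0 1" using that by (simp add: mat2.expand)
      then show ?thesis using times[OF _ _ Pm powU'[of "- m12 g"]] by (simp add: SL2_def)
    qed
  qed
  show ?thesis using g
  proof (induction "nat (\<bar>m11 g\<bar> + \<bar>m21 g\<bar>)" arbitrary: g rule: less_induct)
    case less
    consider "m21 g = 0" | "m21 g \<noteq> 0" "m11 g = 0" | "m21 g \<noteq> 0" "m11 g \<noteq> 0" "\<bar>m21 g\<bar> \<le> \<bar>m11 g\<bar>"
      | "m21 g \<noteq> 0" "m11 g \<noteq> 0" "\<bar>m11 g\<bar> < \<bar>m21 g\<bar>" by linarith
    then show ?case
    proof cases
      case 1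
      then show ?thesis using triang less.prems by simp
    next
      case 2
      have "P (S * g)" using 2 less.prems S by (intro triang SL2_times) (auto simp: Seq)
      then show ?thesis using cancel S less.prems by blast
    next
      case 3
      have red: "P g" if h: "h \<in> {matU, adj2 matU}" and lt: "\<bar>m11 (h * g)\<bar> < \<bar>m11 g\<bar>" for h
      proof -
        have hS: "h \<in> SL2" "P h" using h US U adj SL2_adj2 by auto
        have "m21 (h * g) = m21 g" using h by (auto simp: matU_def adj2_def)
        then have "P (h * g)" using lt less.prems hS by (intro less.hyps) (auto intro: SL2_times)
        then show ?thesis using cancel hS less.prems by blast
      qed
      have "\<bar>m11 (matU * g)\<bar> < \<bar>m11 g\<bar> \<or> \<bar>m11 (adj2 matU * g)\<bar> < \<bar>m11 g\<bar>"
        using 3 by (auto simp: matU_def adj2_def)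
      then show ?thesis using red by blast
    next
      case 4
      have red: "P g" if h: "h \<in> {matL, adj2 matL}" and lt: "\<bar>m21 (h * g)\<bar> < \<bar>m21 g\<bar>" for h
      proof -
        have hS: "h \<in> SL2" "P h" using h LS L adj SL2_adj2 by auto
        have "m11 (h * g) = m11 g" using h by (auto simp: matL_def adj2_def)
        then have "P (h * g)" using lt less.prems hS by (intro less.hyps) (auto intro: SL2_times)
        then show ?thesis using cancel hS less.prems by blast
      qed
      have "\<bar>m21 (matL * g)\<bar> < \<bar>m21 g\<bar> \<or> \<bar>m21 (adj2 matL * g)\<bar> < \<bar>m21 g\<bar>"
        using 4 by (auto simp: matL_def adj2_def)
      then show ?thesis using red by blast
    qed
  qed
qed

section \<open>The uniform spectral gap\<close>

definition lev0 :: "int \<Rightarrow> (vec2 \<Rightarrow> real) set" where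
  "lev0 N = {f. lev N f \<and> (\<Sum>v\<in>pvec N. f v) = 0}"

lemma sqn_eq_ip: "sqn N f = (\<Sum>v\<in>pvec N. f v * f v)"
  by (simp add: sqn_def power2_eq_square)

lemma lev_combine:
  assumes f: "lev N f" and g: "lev N g" and P: "P 0 0 = (0::real)"
  shows "lev N (\<lambda>v. P (f v) (g v))"
  unfolding lev_def
proof (intro conjI allI impI)
  fix v assume v: "\<not> prim N v"
  show "P (f v) (g v) = 0" unfolding lev_zero[OF f v] lev_zero[OF g v] by (rule P)
next
  fix v w assume vw: "prim N v" "prim N w" "N dvd cross v w"
  show "P (f v) (g v) = P (f w) (g w)" unfolding lev_eq[OF f vw] lev_eq[OF g vw] ..
qed

lemma lev_lincomb: "lev N f \<Longrightarrow> lev N g \<Longrightarrow> lev N (\<lambda>v. a * f v + b * g v)"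
  by (rule lev_combine) simp_all

lemma lev_sum:
  assumes "\<And>w. w \<in> W \<Longrightarrow> lev N (F w)"
  shows "lev N (\<lambda>v. \<Sum>w\<in>W. F w v)"
  unfolding lev_def
proof (intro conjI allI impI)
  fix v assume "\<not> prim N v"
  then show "(\<Sum>w\<in>W. F w v) = 0" by (intro sum.neutral ballI lev_zero[OF assms])
next
  fix u v assume "prim N u" "prim N v" "N dvd cross u v"
  then show "(\<Sum>w\<in>W. F w u) = (\<Sum>w\<in>W. F w v)"
    by (intro sum.cong refl lev_eq[OF assms])
qed

lemma SL2_coprime: "g \<in> SL2 \<Longrightarrow> coprime (det2 g) N"
  by (simp add: SL2_def)

lemma lev_act_SL2: "lev N f \<Longrightarrow> g \<in> SL2 \<Longrightarrow> lev N (\<lambda>v. f (act g v))"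
  by (intro lev_act SL2_coprime)

lemma lev_Top: "lev N f \<Longrightarrow> lev N (Top m f)"
  unfolding Top_def[abs_def] using steps_SL2 by (intro lev_sum lev_act_SL2) auto

lemma sum_act:
  assumes "N > 0" "lev N f" "g \<in> SL2"
  shows "(\<Sum>v\<in>pvec N. f (act g v)) = (\<Sum>v\<in>pvec N. f v)"
  using assms by (intro sum_pvec_act SL2_coprime) auto

lemma lev_mult: "lev N f \<Longrightarrow> lev N g \<Longrightarrow> lev N (\<lambda>v. f v * g v)"
  by (rule lev_combine) simp_all

lemma sqn_act:
  assumes "N > 0" "lev N f" "g \<in> SL2"
  shows "sqn N (\<lambda>v. f (act g v)) = sqn N f"
  unfolding sqn_eq_ip using sum_act[OF assms(1) lev_mult[OF assms(2,2)] assms(3)] by simp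

lemma ip_act:
  assumes N: "N > 0" and f: "lev N f" and h: "lev N h" and g: "g \<in> SL2"
  shows "(\<Sum>v\<in>pvec N. f (act g v) * h v) = (\<Sum>v\<in>pvec N. f v * h (act (adj2 g) v))"
proof -
  have "(\<Sum>v\<in>pvec N. f v * h (act (adj2 g) v)) = (\<Sum>v\<in>pvec N. f (act g v) * h (act (adj2 g) (act g v)))"
    using sum_act[OF N lev_mult[OF f lev_act_SL2[OF h SL2_adj2[OF g]]] g] by simp
  then show ?thesis using g by (simp add: act_adj2_SL2 SL2_def)
qed

lemma Top_symmetric:
  assumes N: "N > 0" and f: "lev N f" and h: "lev N h"
  shows "(\<Sum>v\<in>pvec N. Top m f v * h v) = (\<Sum>v\<in>pvec N. f v * Top m h v)"
proof -
  have "(\<Sum>v\<in>pvec N. Top m f v * h v) = (\<Sum>w\<in>steps m. \<Sum>v\<in>pvec N. f (act w v) * h v)"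
    unfolding Top_def sum_distrib_right by (rule sum.swap)
  also have "\<dots> = (\<Sum>w\<in>steps m. \<Sum>v\<in>pvec N. f v * h (act (adj2 w) v))"
    using steps_SL2 by (intro sum.cong refl ip_act[OF N f h]) auto
  also have "\<dots> = (\<Sum>w\<in>steps m. \<Sum>v\<in>pvec N. f v * h (act w v))"
    by (rule sum.reindex_bij_witness[of _ adj2 adj2]) (auto simp: adj2_steps)
  also have "\<dots> = (\<Sum>v\<in>pvec N. f v * Top m h v)"
    unfolding Top_def sum_distrib_left by (rule sum.swap)
  finally show ?thesis .
qed

lemma Top_lev0:
  assumes "N > 0" "f \<in> lev0 N"
  shows "Top m f \<in> lev0 N"
proof -
  have f: "lev N f" "(\<Sum>v\<in>pvec N. f v) = 0" using assms by (auto simp: lev0_def)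
  have "(\<Sum>v\<in>pvec N. Top m f v) = (\<Sum>w\<in>steps m. \<Sum>v\<in>pvec N. f (act w v))"
    unfolding Top_def by (rule sum.swap)
  also have "\<dots> = (\<Sum>w\<in>steps m. \<Sum>v\<in>pvec N. f v)"
    using steps_SL2 by (intro sum.cong refl sum_act[OF assms(1) f(1)]) auto
  finally show ?thesis using f lev_Top by (simp add: lev0_def)
qed

lemma lev_bound:
  assumes "N > 0" "lev N f"
  shows "(f v)\<^sup>2 \<le> sqn N f"
proof (cases "prim N v")
  case True
  then have "vmod N v \<in> pvec N" using assms vmod_in_pvec by blast
  then have "(f (vmod N v))\<^sup>2 \<le> sqn N f"
    unfolding sqn_def by (rule member_le_sum[of _ _ "\<lambda>v. (f v)\<^sup>2"]) auto
  then show ?thesis using assms by simp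
next
  case False
  then show ?thesis using assms by (simp add: lev_zero)
qed

lemma sqn_Top_eigen:
  assumes N: "N > 0" and f: "lev N f" and eig: "Top m (Top m f) = (\<lambda>v. \<mu> * f v)"
  shows "sqn N (Top m f) = \<mu> * sqn N f"
proof -
  have "sqn N (Top m f) = (\<Sum>v\<in>pvec N. f v * Top m (Top m f) v)"
    unfolding sqn_eq_ip by (rule Top_symmetric[OF N f lev_Top[OF f]])
  also have "\<dots> = \<mu> * sqn N f" unfolding eig sqn_eq_ip sum_distrib_left by (intro sum.cong) auto
  finally show ?thesis .
qed

lemma closed_lev0: "closed (lev0 N)"
proof -
  have *: "closed {f :: vec2 \<Rightarrow> real. f v = 0}" for v
    by (intro closed_Collect_eq continuous_on_product_coordinates continuous_on_const)
  have **: "closed {f :: vec2 \<Rightarrow> real. f v = f w}" for v w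
    by (intro closed_Collect_eq continuous_on_product_coordinates)
  have ***: "closed {f :: vec2 \<Rightarrow> real. (\<Sum>v\<in>pvec N. f v) = 0}"
    by (intro closed_Collect_eq continuous_on_sum continuous_on_product_coordinates continuous_on_const)
  have "lev0 N = (\<Inter>v\<in>{v. \<not> prim N v}. {f. f v = 0}) \<inter>
      (\<Inter>v\<in>{v. prim N v}. \<Inter>w\<in>{w. prim N w \<and> N dvd cross v w}. {f. f v = f w}) \<inter>
      {f. (\<Sum>v\<in>pvec N. f v) = 0}"
    unfolding lev0_def lev_def by blast
  also have "closed \<dots>" by (intro closed_Int closed_INT ballI * ** ***)
  finally show ?thesis .
qed

lemma Top_max_eigenvector:
  assumes N: "N > 0" and ne: "h0 \<in> lev0 N" "sqn N h0 > 0"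
  obtains \<mu> f where "f \<in> lev0 N" "sqn N f = 1" "\<mu> \<ge> 0" "Top m (Top m f) = (\<lambda>v. \<mu> * f v)"
    "\<And>g. g \<in> lev0 N \<Longrightarrow> sqn N (Top m g) \<le> \<mu> * sqn N g"
proof -
  have lin: "(\<lambda>x. a * f x + b * g x) \<in> lev0 N" if "f \<in> lev0 N" "g \<in> lev0 N" for f g a b
    using that by (auto simp: lev0_def sum.distrib sum_distrib_left[symmetric] intro: lev_lincomb)
  have Tlin: "Top m (\<lambda>x. a * f x + b * g x) = (\<lambda>x. a * Top m f x + b * Top m g x)" for f g a b
    by (simp add: Top_def fun_eq_iff sum.distrib sum_distrib_left)
  have Tcont: "continuous_on UNIV (\<lambda>f. Top m f x)" for x
    unfolding Top_def by (intro continuous_on_sum continuous_on_product_coordinates)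
  show ?thesis
    by (rule max_eigenvector[of "lev0 N" "pvec N" "Top m" h0, folded sqn_eq_ip, OF closed_lev0 lin _ _ Tlin _ Tcont ne])
       (use N lev_bound Top_lev0 Top_symmetric that in \<open>auto simp: lev0_def\<close>)
qed

section \<open>The defect of averaging and displacements\<close>

lemma square_sum_variance:
  fixes x :: "'a \<Rightarrow> real"
  assumes "finite W"
  shows "2 * (\<Sum>w\<in>W. x w)\<^sup>2 = 2 * real (card W) * (\<Sum>w\<in>W. (x w)\<^sup>2) - (\<Sum>w\<in>W. \<Sum>u\<in>W. (x w - x u)\<^sup>2)"
proof -
  have "(\<Sum>w\<in>W. \<Sum>u\<in>W. (x w - x u)\<^sup>2) = (\<Sum>w\<in>W. \<Sum>u\<in>W. (x w)\<^sup>2 + (x u)\<^sup>2 - 2 * (x w * x u))"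
    by (simp add: power2_diff algebra_simps)
  also have "\<dots> = 2 * real (card W) * (\<Sum>w\<in>W. (x w)\<^sup>2) - 2 * (\<Sum>w\<in>W. x w)\<^sup>2"
    by (simp add: sum.distrib sum_subtractf sum_distrib_left[symmetric] power2_eq_square sum_product)
  finally show ?thesis by simp
qed

text \<open>Pointwise this is the variance identity, and all translates have the norm of
  \<open>f\<close>. The averaging operator therefore comes close to its trivial norm only on almost
  invariant functions.\<close>

lemma sqn_Top:
  assumes N: "N > 0" and f: "lev N f"
  shows "2 * sqn N (Top m f) = 2 * real (card (steps m)) ^ 2 * sqn N f -
    (\<Sum>w\<in>steps m. \<Sum>u\<in>steps m. sqn N (\<lambda>v. f (act w v) - f (act u v)))"
proof -
  have "2 * sqn N (Top m f) = (\<Sum>v\<in>pvec N. 2 * real (card (steps m)) * (\<Sum>w\<in>steps m. (f (act w v))\<^sup>2)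
      - (\<Sum>w\<in>steps m. \<Sum>u\<in>steps m. (f (act w v) - f (act u v))\<^sup>2))"
    unfolding sqn_def Top_def sum_distrib_left
    by (intro sum.cong refl) (simp add: square_sum_variance sum_distrib_left)
  also have "\<dots> = 2 * real (card (steps m)) * (\<Sum>v\<in>pvec N. \<Sum>w\<in>steps m. (f (act w v))\<^sup>2)
      - (\<Sum>v\<in>pvec N. \<Sum>w\<in>steps m. \<Sum>u\<in>steps m. (f (act w v) - f (act u v))\<^sup>2)"
    by (simp add: sum_subtractf sum_distrib_left)
  also have "(\<Sum>v\<in>pvec N. \<Sum>w\<in>steps m. (f (act w v))\<^sup>2) = (\<Sum>w\<in>steps m. sqn N (\<lambda>v. f (act w v)))"
    unfolding sqn_def by (rule sum.swap)
  also have "\<dots> = (\<Sum>w\<in>steps m. sqn N f)"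
    using steps_SL2 by (intro sum.cong refl sqn_act[OF N f]) auto
  also have "(\<Sum>v\<in>pvec N. \<Sum>w\<in>steps m. \<Sum>u\<in>steps m. (f (act w v) - f (act u v))\<^sup>2) =
      (\<Sum>w\<in>steps m. \<Sum>u\<in>steps m. sqn N (\<lambda>v. f (act w v) - f (act u v)))"
    unfolding sqn_def by (subst sum.swap, intro sum.cong refl, rule sum.swap)
  finally show ?thesis by (simp add: power2_eq_square)
qed

lemma sqn_add_le: "sqn N (\<lambda>v. f v + g v) \<le> 2 * sqn N f + 2 * sqn N g"
  unfolding sqn_def sum_distrib_left sum.distrib[symmetric]
proof (rule sum_mono)
  fix v
  have "2 * (f v)\<^sup>2 + 2 * (g v)\<^sup>2 - (f v + g v)\<^sup>2 = (f v - g v)\<^sup>2" by (simp add: power2_eq_square algebra_simps)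
  then show "(f v + g v)\<^sup>2 \<le> 2 * (f v)\<^sup>2 + 2 * (g v)\<^sup>2" using zero_le_power2[of "f v - g v"] by linarith
qed

definition disp :: "int \<Rightarrow> mat2 \<Rightarrow> (vec2 \<Rightarrow> real) \<Rightarrow> real" where
  "disp N g f = sqn N (\<lambda>v. f (act g v) - f v)"

lemma lev_disp: "lev N f \<Longrightarrow> g \<in> SL2 \<Longrightarrow> lev N (\<lambda>v. f (act g v) - f v)"
  using lev_lincomb[OF lev_act_SL2, of N f g f 1 "-1"] by simp

lemma disp_times:
  assumes "N > 0" "lev N f" "g \<in> SL2" "h \<in> SL2"
  shows "disp N (g * h) f \<le> 2 * disp N g f + 2 * disp N h f"
proof -
  have "disp N (g * h) f = sqn N (\<lambda>v. (f (act g (act h v)) - f (act h v)) + (f (act h v) - f v))"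
    by (simp add: disp_def)
  also have "\<dots> \<le> 2 * sqn N (\<lambda>v. f (act g (act h v)) - f (act h v)) + 2 * disp N h f"
    unfolding disp_def by (rule sqn_add_le)
  also have "sqn N (\<lambda>v. f (act g (act h v)) - f (act h v)) = disp N g f"
    unfolding disp_def using sqn_act[OF assms(1) lev_disp[OF assms(2,3)] assms(4)] by simp
  finally show ?thesis .
qed

lemma disp_adj2:
  assumes "N > 0" "lev N f" "g \<in> SL2"
  shows "disp N (adj2 g) f = disp N g f"
proof -
  have "disp N (adj2 g) f = sqn N (\<lambda>v. f (act (adj2 g) (act g v)) - f (act g v))"
    unfolding disp_def using sqn_act[OF assms(1) lev_disp[OF assms(2) SL2_adj2[OF assms(3)]] assms(3)] by simp
  also have "\<dots> = sqn N (\<lambda>v. f v - f (act g v))"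
    using assms(3) by (simp add: act_adj2_SL2 SL2_def)
  also have "\<dots> = disp N g f" unfolding disp_def sqn_def by (simp add: power2_commute)
  finally show ?thesis .
qed

text \<open>The order of the quantifiers is the point: \<open>C\<close> depends on how
  \<open>g\<close> is generated, but neither on \<open>N\<close> nor on \<open>f\<close>.\<close>

lemma disp_generated:
  assumes "g \<in> SL2"
  shows "\<exists>C\<ge>0. \<forall>N>0. \<forall>f. lev N f \<longrightarrow> disp N g f \<le> C * (disp N matL f + disp N matU f)"
  using assms
proof (induction g rule: SL2_induct)
  case L
  show ?case by (intro exI[of _ 1]) (simp add: disp_def)
next
  case U
  show ?case by (intro exI[of _ 1]) (simp add: disp_def)
next
  case (times g h)
  obtain C1 where C1: "C1 \<ge> 0" "\<And>N f. N > 0 \<Longrightarrow> lev N f \<Longrightarrow> disp N g f \<le> C1 * (disp N matL f + disp N matU f)"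
    using times.IH(1) by blast
  obtain C2 where C2: "C2 \<ge> 0" "\<And>N f. N > 0 \<Longrightarrow> lev N f \<Longrightarrow> disp N h f \<le> C2 * (disp N matL f + disp N matU f)"
    using times.IH(2) by blast
  show ?case
  proof (intro exI[of _ "2 * C1 + 2 * C2"] conjI allI impI)
    fix N :: int and f assume N: "N > 0" and f: "lev N f"
    have "disp N (g * h) f \<le> 2 * disp N g f + 2 * disp N h f" by (rule disp_times[OF N f times.hyps])
    with C1(2)[OF N f] C2(2)[OF N f]
    show "disp N (g * h) f \<le> (2 * C1 + 2 * C2) * (disp N matL f + disp N matU f)"
      by (simp add: algebra_simps)
  qed (use C1 C2 in auto)
next
  case (adj g)
  then show ?case using disp_adj2 by metis
qed

text \<open>Without displacement \<open>f\<close> is invariant under all of \<open>SL2\<close>,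
  hence constant by transitivity on primitive vectors, and a constant with sum zero
  vanishes.\<close>

lemma lev0_invariant_zero:
  assumes N: "N > 0" and f: "f \<in> lev0 N" and L: "disp N matL f = 0" and U: "disp N matU f = 0"
  shows "sqn N f = 0"
proof -
  have lf: "lev N f" and s0: "(\<Sum>v\<in>pvec N. f v) = 0" using f by (auto simp: lev0_def)
  have inv: "f (act g v) = f v" if g: "g \<in> SL2" and v: "v \<in> pvec N" for g v
  proof -
    obtain C where "disp N g f \<le> C * (disp N matL f + disp N matU f)"
      using disp_generated[OF g] N lf by blast
    then have "sqn N (\<lambda>v. f (act g v) - f v) \<le> 0" using L U by (simp add: disp_def)
    moreover have "(f (act g v) - f v)\<^sup>2 \<le> sqn N (\<lambda>v. f (act g v) - f v)"
      by (rule lev_bound[OF N lev_disp[OF lf g]])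
    ultimately have "(f (act g v) - f v)\<^sup>2 \<le> 0" by linarith
    then show ?thesis by simp
  qed
  define e where "e = vmod N (1, 0)"
  have e: "e \<in> pvec N" unfolding e_def by (rule vmod_in_pvec[OF N prim_unit_left]) simp
  have "f v = f e" if v: "v \<in> pvec N" for v
  proof -
    obtain g where g: "det2 g = 1" "vmod N v = vmod N (act g (1, 0))"
      using prim_transitive[of N v] v N by (auto simp: pvec_def)
    then have "f v = f (act g (1, 0))" using lev_vmod[OF lf] by metis
    also have "\<dots> = f (act g e)" unfolding e_def using lev_vmod[OF lf] vmod_act_vmod by metis
    also have "\<dots> = f e" using inv[OF _ e] g by (simp add: SL2_def)
    finally show ?thesis .
  qed
  then have "(\<Sum>v\<in>pvec N. f v) = (\<Sum>v\<in>pvec N. f e)" by (intro sum.cong) auto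
  then have "real (card (pvec N)) * f e = 0" using s0 by simp
  moreover have "card (pvec N) \<noteq> 0" using e finite_pvec card_eq_0_iff by blast
  then have "real (card (pvec N)) \<noteq> 0" unfolding of_nat_eq_0_iff .
  ultimately have "f e = 0" using mult_eq_0_iff by blast
  then have "f v = 0" if "v \<in> pvec N" for v using that \<open>\<And>v. v \<in> pvec N \<Longrightarrow> f v = f e\<close> by simp
  then show ?thesis unfolding sqn_def by simp
qed

text \<open>Here \<open>c\<close> may depend on \<open>N\<close>, which is enough for finitely many
  levels. If the largest eigenvalue were the trivial one, all differences in \<open>sqn_Top\<close>
  would vanish for its eigenvector, which would then be invariant.\<close>

lemma gap_each_level:
  assumes m: "m \<ge> 1" and N: "N > 0"
  shows "\<exists>c<1. c \<ge> 0 \<and> (\<forall>f\<in>lev0 N. sqn N (Top m f) \<le> c * real (card (steps m)) ^ 2 * sqn N f)"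
proof (cases "\<exists>h\<in>lev0 N. sqn N h > 0")
  case False
  have z: "sqn N f = 0" if "f \<in> lev0 N" for f
  proof -
    have "\<not> sqn N f > 0" using False that by blast
    then show ?thesis using sqn_nonneg[of N f] by linarith
  qed
  show ?thesis using z Top_lev0[OF N] by (intro exI[of _ 0]) auto
next
  case True
  then obtain h where h: "h \<in> lev0 N" "sqn N h > 0" by blast
  obtain \<mu> f where f: "f \<in> lev0 N" "sqn N f = 1" "\<mu> \<ge> 0" "Top m (Top m f) = (\<lambda>v. \<mu> * f v)"
    "\<And>g. g \<in> lev0 N \<Longrightarrow> sqn N (Top m g) \<le> \<mu> * sqn N g"
    by (rule Top_max_eigenvector[OF N h, where m = m], rule that)
  have lf: "lev N f" using f(1) by (simp add: lev0_def)
  let ?M = "real (card (steps m))"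
  have one: "1 \<in> steps m" "matL \<in> steps m" "matU \<in> steps m" by (auto simp: steps_def gens_def)
  then have M0: "?M > 0" using finite_steps card_gt_0_iff by (metis empty_iff of_nat_0_less_iff)
  have \<mu>T: "sqn N (Top m f) = \<mu>" using sqn_Top_eigen[OF N lf f(4)] f(2) by simp
  let ?V = "\<Sum>w\<in>steps m. \<Sum>u\<in>steps m. sqn N (\<lambda>v. f (act w v) - f (act u v))"
  have eq: "2 * \<mu> = 2 * ?M ^ 2 - ?V" using sqn_Top[OF N lf, of m] f(2) \<mu>T by simp
  have "?V > 0"
  proof (rule ccontr)
    assume "\<not> ?V > 0"
    have le: "disp N g f \<le> ?V" if g: "g \<in> steps m" for g
    proof -
      have "disp N g f = sqn N (\<lambda>v. f (act g v) - f (act 1 v))" by (simp add: disp_def)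
      also have "\<dots> \<le> (\<Sum>u\<in>steps m. sqn N (\<lambda>v. f (act g v) - f (act u v)))"
        using one(1) by (intro member_le_sum[of _ _ "\<lambda>u. sqn N (\<lambda>v. f (act g v) - f (act u v))"]) auto
      also have "\<dots> \<le> ?V"
        using g by (intro member_le_sum[of g _ "\<lambda>w. \<Sum>u\<in>steps m. sqn N (\<lambda>v. f (act w v) - f (act u v))"]) (auto intro: sum_nonneg)
      finally show ?thesis .
    qed
    have "disp N g f = 0" if "g \<in> steps m" for g
      using le[OF that] \<open>\<not> ?V > 0\<close> sqn_nonneg[of N "\<lambda>v. f (act g v) - f v"]
      unfolding disp_def by linarith
    then have "sqn N f = 0" using lev0_invariant_zero[OF N f(1)] one by blast
    then show False using f(2) by simp
  qed
  then have lt: "\<mu> < ?M ^ 2" using eq by linarith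
  show ?thesis
  proof (intro exI[of _ "\<mu> / ?M ^ 2"] conjI ballI)
    show "\<mu> / ?M ^ 2 < 1" using lt zero_less_power[OF M0, of 2] by (simp only: divide_less_eq_1_pos)
    show "0 \<le> \<mu> / ?M ^ 2" using f(3) by simp
    fix g assume "g \<in> lev0 N"
    then have "sqn N (Top m g) \<le> \<mu> * sqn N g" by (rule f(5))
    moreover have "\<mu> / q * q = \<mu>" if "q > 0" for q :: real using that by simp
    ultimately show "sqn N (Top m g) \<le> \<mu> / ?M ^ 2 * ?M ^ 2 * sqn N g"
      using zero_less_power[OF M0, of 2] by presburger
  qed
qed

section \<open>Push-forward of functions to lower levels\<close>

definition lower :: "int \<Rightarrow> int \<Rightarrow> (vec2 \<Rightarrow> real) \<Rightarrow> vec2 \<Rightarrow> real" where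
  "lower N e f v = (if prim e v then \<Sum>w\<in>{w \<in> pvec N. e dvd cross v w}. f w else 0)"

lemma cross_dvd_transfer:
  assumes "prim e v" "prim e v'" "e dvd cross v v'"
  shows "e dvd cross v w \<longleftrightarrow> e dvd cross v' w"
  using dvd_cross_trans[OF assms(1,3), of w] dvd_cross_trans[OF assms(2), of v w] assms(3)
    dvd_cross_swap[of e v v'] by blast

lemma lev_lower: "lev e (lower N e f)"
  unfolding lev_def
proof (intro conjI allI impI)
  fix v v' assume v: "prim e v" "prim e v'" "e dvd cross v v'"
  show "lower N e f v = lower N e f v'"
    unfolding lower_def using v(1,2) cross_dvd_transfer[OF v] by simp
qed (simp add: lower_def)

lemma lower_act:
  assumes N: "N > 0" and e: "e dvd N" and f: "lev N f" and g: "g \<in> SL2"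
  shows "lower N e f (act g v) = lower N e (\<lambda>v. f (act g v)) v"
proof (cases "prim e v")
  case True
  then have pg: "prim e (act g v)" using g SL2_coprime prim_act by blast
  have edvd: "e dvd cross u (vmod N w) \<longleftrightarrow> e dvd cross u w" for u w
  proof -
    have "[cross u (vmod N w) = cross u w] (mod N)" by (rule cross_cong) auto
    then have "[cross u (vmod N w) = cross u w] (mod e)" using e by (rule cong_dvd_modulus)
    then show ?thesis by (rule cong_dvd_iff)
  qed
  have "(\<Sum>w\<in>{w \<in> pvec N. e dvd cross (act g v) w}. f w) = (\<Sum>w\<in>pvec N. if e dvd cross (act g v) w then f w else 0)"
    by (simp add: sum.inter_filter)
  also have "\<dots> = (\<Sum>w\<in>pvec N. if e dvd cross (act g v) (act g w) then f (act g w) else 0)"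
    using N g f edvd by (intro sum_pvec_act[symmetric] SL2_coprime) auto
  also have "\<dots> = (\<Sum>w\<in>{w \<in> pvec N. e dvd cross v w}. f (act g w))"
    using g by (simp add: sum.inter_filter cross_act SL2_def)
  finally show ?thesis using True pg by (simp add: lower_def)
next
  case False
  then have "\<not> prim e (act g v)" using g SL2_coprime prim_act_iff by blast
  with False show ?thesis by (simp add: lower_def)
qed

lemma Top_lower:
  assumes N: "N > 0" and e: "e dvd N" and f: "lev N f"
  shows "Top m (lower N e f) = lower N e (Top m f)"
proof
  fix v
  have "Top m (lower N e f) v = (\<Sum>w\<in>steps m. lower N e (\<lambda>v. f (act w v)) v)"
    unfolding Top_def using steps_SL2 by (intro sum.cong refl lower_act[OF N e f]) auto
  also have "\<dots> = lower N e (Top m f) v"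
    unfolding lower_def Top_def by (auto intro: sum.swap)
  finally show "Top m (lower N e f) v = lower N e (Top m f) v" .
qed

lemma lower_scale: "lower N e (\<lambda>v. c * f v) = (\<lambda>v. c * lower N e f v)"
  by (auto simp: lower_def sum_distrib_left fun_eq_iff)

text \<open>Push-forwards compose: summing the one to level \<open>e\<close> over a fibre above
  level \<open>d\<close> counts every vector of the fibre \<open>ph e\<close> times, which gives
  \<open>ph e\<close> times the push-forward to \<open>d\<close>. That one vanishes by minimality of
  \<open>e\<close>.\<close>

lemma lower_new:
  assumes N: "N > 0" and e: "e dvd N" "e > 0"
    and min: "\<And>d v. d dvd e \<Longrightarrow> d > 0 \<Longrightarrow> d \<noteq> e \<Longrightarrow> lower N d f v = 0"
  shows "lnew e (lower N e f)"
  unfolding lnew_def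
proof (intro allI impI)
  fix d v assume d: "d > 0" "d dvd e" "d \<noteq> e" and v: "prim e v"
  have pz: "prim e z" if "z \<in> pvec e" for z using that by (simp add: pvec_def)
  have pw: "prim e w" if "w \<in> pvec N" for w using that e(1) prim_dvd by (auto simp: pvec_def)
  have "(\<Sum>z\<in>{z \<in> pvec e. d dvd cross v z}. lower N e f z) =
      (\<Sum>z\<in>pvec e. \<Sum>w\<in>pvec N. if d dvd cross v z \<and> e dvd cross z w then f w else 0)"
    unfolding sum.inter_filter[OF finite_pvec]
    by (intro sum.cong refl) (simp add: lower_def pz sum.inter_filter[symmetric])
  also have "\<dots> = (\<Sum>w\<in>pvec N. \<Sum>z\<in>pvec e. if d dvd cross v z \<and> e dvd cross z w then f w else 0)"
    by (rule sum.swap)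
  also have "\<dots> = (\<Sum>w\<in>pvec N. if d dvd cross v w then real (ph e) * f w else 0)"
  proof (rule sum.cong[OF refl])
    fix w assume w: "w \<in> pvec N"
    have key: "d dvd cross v z \<and> e dvd cross z w \<longleftrightarrow> d dvd cross v w \<and> e dvd cross w z" if z: "z \<in> pvec e" for z
    proof (cases "e dvd cross w z")
      case True
      then have "d dvd cross w z" using d(2) dvd_trans by blast
      moreover have "prim d w" "prim d z" using pw[OF w] pz[OF z] d(2) prim_dvd by auto
      ultimately have "d dvd cross w v \<longleftrightarrow> d dvd cross z v" by (intro cross_dvd_transfer)
      then show ?thesis using True dvd_cross_swap by blast
    next
      case False
      then show ?thesis using dvd_cross_swap by blast
    qed
    have "(\<Sum>z\<in>pvec e. if d dvd cross v z \<and> e dvd cross z w then f w else 0) =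
        (\<Sum>z\<in>pvec e. if d dvd cross v w \<and> e dvd cross w z then f w else 0)"
      using key by (intro sum.cong refl) auto
    also have "\<dots> = (if d dvd cross v w then real (card {z \<in> pvec e. e dvd cross w z}) * f w else 0)"
      by (simp add: sum.inter_filter[symmetric])
    also have "card {z \<in> pvec e. e dvd cross w z} = ph e"
      by (rule card_line[OF e(2) pw[OF w]])
    finally show "(\<Sum>z\<in>pvec e. if d dvd cross v z \<and> e dvd cross z w then f w else 0) =
        (if d dvd cross v w then real (ph e) * f w else 0)" .
  qed
  also have "\<dots> = real (ph e) * lower N d f v"
    using prim_dvd[OF v d(2)] by (simp add: lower_def sum.inter_filter sum_distrib_left if_distrib cong: if_cong)
  also have "\<dots> = 0" using min[OF d(2,1,3)] by simp
  finally show "(\<Sum>z\<in>{z \<in> pvec e. d dvd cross v z}. lower N e f z) = 0" .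
qed

text \<open>Take the smallest divisor \<open>e\<close> of \<open>N\<close> with a nonzero
  push-forward. Push-forward commutes with the action, so the eigenvalue persists, and minimality
  makes the image new. Level 1 is excluded because the push-forward there is the sum of
  \<open>f\<close>.\<close>

lemma eigenvalue_descends:
  assumes N: "N > 1" and f: "f \<in> lev0 N" "sqn N f > 0" and eig: "Top m (Top m f) = (\<lambda>v. \<mu> * f v)"
  obtains e h where "e > 1" "lnew e h" "h \<in> lev0 e" "sqn e h > 0" "Top m (Top m h) = (\<lambda>v. \<mu> * h v)"
proof -
  have lf: "lev N f" and s0: "(\<Sum>v\<in>pvec N. f v) = 0" using f by (auto simp: lev0_def)
  have N0: "N > 0" using N by simp
  define Q where "Q k \<longleftrightarrow> k > 0 \<and> int k dvd N \<and> (\<exists>v. lower N (int k) f v \<noteq> 0)" for k :: nat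
  have "Q (nat N)"
  proof -
    have "\<exists>v\<in>pvec N. f v \<noteq> 0"
    proof (rule ccontr)
      assume "\<not> ?thesis"
      then have "sqn N f = 0" by (simp add: sqn_def)
      with f(2) show False by simp
    qed
    then obtain v where v: "v \<in> pvec N" "f v \<noteq> 0" by blast
    then have "prim N v" by (simp add: pvec_def)
    then have "lower N N f v = real (ph N) * f v" using sum_line[OF N0 lf] by (simp add: lower_def)
    then have "lower N N f v \<noteq> 0" using v(2) ph_pos[OF N0] by simp
    then show ?thesis using N unfolding Q_def by (intro conjI exI[of _ v]) auto
  qed
  define k where "k = (LEAST k. Q k)"
  have Qk: "Q k" unfolding k_def by (rule LeastI[of Q, OF \<open>Q (nat N)\<close>])
  define e where "e = int k"
  have e: "e > 0" "e dvd N" using Qk by (auto simp: Q_def e_def)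
  obtain v0 where v0: "lower N e f v0 \<noteq> 0" using Qk by (auto simp: Q_def e_def)
  have min: "lower N d f v = 0" if d: "d dvd e" "d > 0" "d \<noteq> e" for d v
  proof (rule ccontr)
    assume ne: "lower N d f v \<noteq> 0"
    have "d < e" using d e(1) zdvd_imp_le[of d e] by simp
    then have "nat d < k" using d(2) by (simp add: e_def)
    then have "\<not> Q (nat d)" unfolding k_def by (rule not_less_Least)
    moreover have "int (nat d) = d" using d(2) by simp
    moreover have "d dvd N" using d(1) e(2) by (rule dvd_trans)
    ultimately have "\<not> (nat d > 0 \<and> d dvd N \<and> (\<exists>v. lower N d f v \<noteq> 0))" unfolding Q_def by simp
    then show False using ne d(2) \<open>d dvd N\<close> by (metis zero_less_nat_eq)
  qed
  let ?h = "lower N e f"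
  have new: "lnew e ?h" by (rule lower_new[OF N0 e(2,1) min])
  have "e \<noteq> 1"
  proof
    assume "e = 1"
    then have "?h v0 = (\<Sum>w\<in>pvec N. f w)" by (simp add: lower_def prim_def)
    with v0 s0 show False by simp
  qed
  then have e1: "e > 1" using e(1) by simp
  have le: "lev e ?h" by (rule lev_lower)
  have p10: "prim e (1, 0)" by (rule prim_unit_left) simp
  have "(\<Sum>w\<in>{w \<in> pvec e. 1 dvd cross (1, 0) w}. ?h w) = 0"
    using new e1 p10 unfolding lnew_def by (metis zero_less_one one_dvd less_irrefl)
  then have "?h \<in> lev0 e" using le by (simp add: lev0_def)
  moreover have "sqn e ?h > 0"
  proof -
    have "0 < (?h v0)\<^sup>2" using v0 by simp
    also have "\<dots> \<le> sqn e ?h" by (rule lev_bound[OF e(1) le])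
    finally show ?thesis .
  qed
  moreover have "Top m (Top m ?h) = (\<lambda>v. \<mu> * ?h v)"
    unfolding Top_lower[OF N0 e(2) lf] Top_lower[OF N0 e(2) lev_Top[OF lf]] eig lower_scale ..
  ultimately show ?thesis using that e1 new by blast
qed

text \<open>The largest eigenvalue at level \<open>N\<close> already occurs on a new function of
  some level \<open>e > 1\<close>. Large \<open>e\<close> fall under the trace bound, the finitely
  many others under \<open>gap_each_level\<close>, and finitely many constants below 1 have a
  maximum below 1.\<close>

theorem uniform_gap:
  obtains m :: int and c :: real where "m \<ge> 1" "c < 1"
    "\<And>N f. N > 1 \<Longrightarrow> f \<in> lev0 N \<Longrightarrow> sqn N (Top m f) \<le> c * real (card (steps m)) ^ 2 * sqn N f"
proof -
  obtain m :: int and \<theta> :: real and E0 :: int where m: "m \<ge> 1" "0 < \<theta>" "\<theta> < 1" and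
    bd: "\<And>N f \<mu>. N \<ge> E0 \<Longrightarrow> N > 1 \<Longrightarrow> lnew N f \<Longrightarrow> lev N f \<Longrightarrow> sqn N f > 0 \<Longrightarrow> \<mu> \<ge> 0 \<Longrightarrow>
      Top m (Top m f) = (\<lambda>v. \<mu> * f v) \<Longrightarrow> \<mu> \<le> \<theta> * real (card (steps m)) ^ 2"
    using new_eigenvalue_bound by blast
  let ?M = "real (card (steps m))"
  have "\<forall>N>0. \<exists>c<1. c \<ge> 0 \<and> (\<forall>f\<in>lev0 N. sqn N (Top m f) \<le> c * ?M ^ 2 * sqn N f)"
    using gap_each_level[OF m(1)] by blast
  then obtain c where c: "\<And>N. N > 0 \<Longrightarrow> c N < 1 \<and> c N \<ge> 0 \<and> (\<forall>f\<in>lev0 N. sqn N (Top m f) \<le> c N * ?M ^ 2 * sqn N f)"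
    by metis
  define c0 where "c0 = Max (insert \<theta> (c ` {1..E0}))"
  have fin: "finite (insert \<theta> (c ` {1..E0}))" by simp
  have c01: "c0 < 1" unfolding c0_def using fin c m by (subst Max_less_iff) auto
  have c\<theta>: "\<theta> \<le> c0" unfolding c0_def by (rule Max_ge[OF fin]) simp
  have cE: "c e \<le> c0" if "1 \<le> e" "e \<le> E0" for e
  proof -
    have "c e \<in> insert \<theta> (c ` {1..E0})" using that by auto
    then show ?thesis unfolding c0_def by (rule Max_ge[OF fin])
  qed
  have "sqn N (Top m f) \<le> c0 * ?M ^ 2 * sqn N f" if N: "N > 1" and f: "f \<in> lev0 N" for N f
  proof (cases "sqn N f > 0")
    case False
    then have z: "sqn N f = 0" using sqn_nonneg[of N f] by linarith
    moreover have "sqn N (Top m f) \<le> c N * ?M ^ 2 * sqn N f" using c[of N] N f by simp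
    ultimately show ?thesis by simp
  next
    case True
    obtain \<mu> g where g: "g \<in> lev0 N" "sqn N g = 1" "\<mu> \<ge> 0" "Top m (Top m g) = (\<lambda>v. \<mu> * g v)"
      "\<And>h. h \<in> lev0 N \<Longrightarrow> sqn N (Top m h) \<le> \<mu> * sqn N h"
      using Top_max_eigenvector[OF _ f True] N by (metis dual_order.strict_trans zero_less_one)
    obtain e h where e: "e > 1" "lnew e h" "h \<in> lev0 e" "sqn e h > 0" "Top m (Top m h) = (\<lambda>v. \<mu> * h v)"
      using eigenvalue_descends[OF N g(1) _ g(4)] g(2) by auto
    have lh: "lev e h" using e(3) by (simp add: lev0_def)
    have "\<mu> \<le> c0 * ?M ^ 2"
    proof (cases "e \<ge> E0")
      case True
      have "\<mu> \<le> \<theta> * ?M ^ 2" by (rule bd[OF True e(1,2) lh e(4) g(3) e(5)])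
      also have "\<dots> \<le> c0 * ?M ^ 2" using c\<theta> by (intro mult_right_mono) auto
      finally show ?thesis .
    next
      case False
      have "\<mu> * sqn e h \<le> c e * ?M ^ 2 * sqn e h"
        using sqn_Top_eigen[OF _ lh e(5)] c[of e] e(1,3) by auto
      then have "\<mu> \<le> c e * ?M ^ 2" using e(4) by (simp only: mult_le_cancel_right_pos)
      also have "\<dots> \<le> c0 * ?M ^ 2" using cE[of e] False e(1) by (intro mult_right_mono) auto
      finally show ?thesis .
    qed
    then have "\<mu> * sqn N f \<le> c0 * ?M ^ 2 * sqn N f" by (intro mult_right_mono) auto
    with g(5)[OF f] show ?thesis by linarith
  qed
  then show ?thesis using that m(1) c01 by blast
qed

text \<open>By \<open>sqn_Top\<close> the gap forces the differences of translates over
  \<open>steps m\<close> to be a definite fraction of the norm. Each of them is bounded by the two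
  elementary displacements with a constant independent of \<open>N\<close>.\<close>

theorem no_almost_invariant:
  obtains \<epsilon> :: real where "\<epsilon> > 0"
    "\<And>N f. N > 1 \<Longrightarrow> f \<in> lev0 N \<Longrightarrow> \<epsilon> * sqn N f \<le> disp N matL f + disp N matU f"
proof -
  obtain m :: int and c :: real where m: "m \<ge> 1" and c: "c < 1" and
    gap: "\<And>N f. N > 1 \<Longrightarrow> f \<in> lev0 N \<Longrightarrow> sqn N (Top m f) \<le> c * real (card (steps m)) ^ 2 * sqn N f"
    using uniform_gap by blast
  let ?M = "real (card (steps m))"
  have "1 \<in> steps m" by (simp add: steps_def gens_def)
  then have "card (steps m) > 0" using finite_steps card_gt_0_iff by blast
  then have "?M > 0" by (simp only: of_nat_0_less_iff)
  then have M0: "?M ^ 2 > 0" by (rule zero_less_power)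
  have "\<forall>g\<in>steps m. \<exists>C\<ge>0. \<forall>N>0. \<forall>f. lev N f \<longrightarrow> disp N g f \<le> C * (disp N matL f + disp N matU f)"
    using disp_generated steps_SL2 by blast
  then obtain C where C: "\<And>g. g \<in> steps m \<Longrightarrow> C g \<ge> 0"
    "\<And>g N f. g \<in> steps m \<Longrightarrow> N > 0 \<Longrightarrow> lev N f \<Longrightarrow> disp N g f \<le> C g * (disp N matL f + disp N matU f)"
    by metis
  define B where "B = (\<Sum>w\<in>steps m. \<Sum>u\<in>steps m. 2 * C w + 2 * C u)"
  have B0: "B \<ge> 0" unfolding B_def using C(1) by (intro sum_nonneg) auto
  define \<epsilon> where "\<epsilon> = 2 * (1 - c) * ?M ^ 2 / (B + 1)"
  have \<epsilon>: "\<epsilon> > 0" unfolding \<epsilon>_def using c M0 B0 by (intro divide_pos_pos mult_pos_pos) auto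
  have "\<epsilon> * sqn N f \<le> disp N matL f + disp N matU f" if N: "N > 1" and f: "f \<in> lev0 N" for N f
  proof -
    have lf: "lev N f" using f by (simp add: lev0_def)
    let ?D = "disp N matL f + disp N matU f"
    have D0: "?D \<ge> 0" by (simp add: disp_def)
    have "2 * ?M ^ 2 * sqn N f - 2 * sqn N (Top m f) =
        (\<Sum>w\<in>steps m. \<Sum>u\<in>steps m. sqn N (\<lambda>v. f (act w v) - f (act u v)))"
      using sqn_Top[OF _ lf, of m] N by simp
    also have "\<dots> \<le> (\<Sum>w\<in>steps m. \<Sum>u\<in>steps m. (2 * C w + 2 * C u) * ?D)"
    proof (intro sum_mono)
      fix w u assume wu: "w \<in> steps m" "u \<in> steps m"
      have "sqn N (\<lambda>v. f (act w v) - f (act u v)) = sqn N (\<lambda>v. (f (act w v) - f v) + (f v - f (act u v)))" by simp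
      also have "\<dots> \<le> 2 * disp N w f + 2 * sqn N (\<lambda>v. f v - f (act u v))"
        unfolding disp_def by (rule sqn_add_le)
      also have "sqn N (\<lambda>v. f v - f (act u v)) = disp N u f"
        unfolding disp_def sqn_def by (simp add: power2_commute)
      also have "2 * disp N w f + 2 * disp N u f \<le> 2 * (C w * ?D) + 2 * (C u * ?D)"
        using C(2)[OF wu(1) _ lf] C(2)[OF wu(2) _ lf] N by (intro add_mono mult_left_mono) auto
      finally show "sqn N (\<lambda>v. f (act w v) - f (act u v)) \<le> (2 * C w + 2 * C u) * ?D"
        by (simp add: algebra_simps)
    qed
    also have "\<dots> = B * ?D" unfolding B_def sum_distrib_right ..
    also have "\<dots> \<le> (B + 1) * ?D" using D0 by (intro mult_right_mono) auto
    finally have "2 * ?M ^ 2 * sqn N f - 2 * (c * ?M ^ 2 * sqn N f) \<le> (B + 1) * ?D"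
      using gap[OF N f] by linarith
    then have "2 * (1 - c) * ?M ^ 2 * sqn N f \<le> (B + 1) * ?D" by (simp add: algebra_simps)
    then show ?thesis using B0 by (simp add: \<epsilon>_def divide_simps mult_ac)
  qed
  with \<epsilon> show ?thesis by (rule that)
qed

section \<open>The semigroup of continued fractions\<close>

definition matA :: "int \<Rightarrow> mat2" where
  "matA a = Mat 1 1 a (a + 1)"

text \<open>Not normalised: the trivial eigenvalue is 2, so squared norms grow at most by a factor 4
  per application.\<close>

definition Sop :: "(vec2 \<Rightarrow> real) \<Rightarrow> vec2 \<Rightarrow> real" where
  "Sop f v = f (act (matA 1) v) + f (act (matA 2) v)"

lemma matA_SL2: "matA a \<in> SL2"
  by (simp add: matA_def SL2_def)

lemma matL_SL2: "matL \<in> SL2" and matU_SL2: "matU \<in> SL2"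
  by (simp_all add: matL_def matU_def SL2_def)

lemma matA_2: "matA 2 = matL * matA 1"
  by (simp add: matA_def matL_def mat2.expand)

text \<open>This places \<open>matU\<close> in the group generated by \<open>matL\<close> and its
  conjugate under \<open>matA 1\<close>, the two elements whose displacements are visible in two
  steps of \<open>Sop\<close>.\<close>

lemma matU_conj:
  "adj2 matU = adj2 matL * (adj2 matL * ((matA 1 * matL * adj2 (matA 1)) * (matL * matL)))"
  by (simp add: matA_def matL_def matU_def adj2_def mat2.expand)

lemma lev_Sop: "lev N f \<Longrightarrow> lev N (Sop f)"
  unfolding Sop_def[abs_def] by (rule lev_combine) (auto intro: lev_act_SL2 matA_SL2)

lemma Sop_funpow_Suc:
  "(Sop ^^ Suc n) f v = (Sop ^^ n) f (act (matA 1) v) + (Sop ^^ n) f (act (matA 2) v)"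
proof -
  have "(Sop ^^ Suc n) f v = Sop ((Sop ^^ n) f) v" by simp
  then show ?thesis by (simp only: Sop_def[of "(Sop ^^ n) f" v])
qed

lemma Sop_lev0:
  assumes "N > 0" "f \<in> lev0 N"
  shows "Sop f \<in> lev0 N"
proof -
  have f: "lev N f" "(\<Sum>v\<in>pvec N. f v) = 0" using assms by (auto simp: lev0_def)
  then show ?thesis
    using sum_act[OF assms(1) f(1) matA_SL2] lev_Sop by (simp add: lev0_def Sop_def sum.distrib)
qed

text \<open>The parallelogram law for the two translates of \<open>f\<close>. Since
  \<open>matA 2 = matL * matA 1\<close>, their difference has the norm of the displacement under
  \<open>matL\<close>.\<close>

lemma sqn_Sop:
  assumes N: "N > 0" and f: "lev N f"
  shows "sqn N (Sop f) = 4 * sqn N f - disp N matL f"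
proof -
  let ?A = "matA 1"
  have "disp N matL f = sqn N (\<lambda>v. f (act matL (act ?A v)) - f (act ?A v))"
    unfolding disp_def using sqn_act[OF N lev_disp[OF f matL_SL2] matA_SL2] by simp
  also have "\<dots> = sqn N (\<lambda>v. f (act (matA 2) v) - f (act ?A v))" by (simp add: matA_2)
  finally have d: "disp N matL f = sqn N (\<lambda>v. f (act (matA 2) v) - f (act ?A v))" .
  have "sqn N (Sop f) + sqn N (\<lambda>v. f (act (matA 2) v) - f (act ?A v)) =
      2 * sqn N (\<lambda>v. f (act ?A v)) + 2 * sqn N (\<lambda>v. f (act (matA 2) v))"
    unfolding sqn_def Sop_def sum_distrib_left sum.distrib[symmetric]
    by (intro sum.cong refl) (simp add: power2_eq_square algebra_simps)
  then show ?thesis using d sqn_act[OF N f matA_SL2] by simp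
qed

text \<open>Up to the error \<open>k\<close>, whose norm is the displacement under
  \<open>matL\<close>, \<open>Sop f\<close> is twice the translate of \<open>f\<close> by
  \<open>matA 1\<close>. Its displacement under \<open>matL\<close> thus controls that of
  \<open>f\<close> under \<open>matA 1 * matL * adj2 (matA 1)\<close>, and \<open>matU_conj\<close>
  leads from there to \<open>matU\<close>; each product at most doubles the bounds.\<close>

lemma disp_matU_le:
  assumes N: "N > 0" and f: "lev N f"
  shows "disp N matU f \<le> 66 * disp N matL f + 4 * disp N matL (Sop f)"
proof -
  let ?A = "matA 1" and ?\<delta> = "disp N matL f" and ?\<delta>' = "disp N matL (Sop f)"
  let ?G = "?A * matL * adj2 ?A"
  define k where "k v = f (act matL v) - f v" for v
  have lk: "lev N k" unfolding k_def[abs_def] by (rule lev_disp[OF f matL_SL2])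
  have sk: "sqn N k = ?\<delta>" by (simp add: k_def[abs_def] disp_def)
  have Sk: "Sop f v = 2 * f (act ?A v) + k (act ?A v)" for v
    by (simp add: Sop_def k_def matA_2)
  define F where "F v = f (act ?A (act matL v)) - f (act ?A v)" for v
  have "4 * sqn N F = sqn N (\<lambda>v. 2 * F v)"
    by (simp add: sqn_def sum_distrib_left power_mult_distrib)
  also have "\<dots> = sqn N (\<lambda>v. (Sop f (act matL v) - Sop f v) + (k (act ?A v) - k (act ?A (act matL v))))"
    by (simp add: Sk F_def algebra_simps)
  also have "\<dots> \<le> 2 * ?\<delta>' + 2 * sqn N (\<lambda>v. k (act ?A v) - k (act ?A (act matL v)))"
    unfolding disp_def by (rule sqn_add_le)
  also have "sqn N (\<lambda>v. k (act ?A v) - k (act ?A (act matL v))) \<le>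
      2 * sqn N (\<lambda>v. k (act ?A v)) + 2 * sqn N (\<lambda>v. - k (act (?A * matL) v))"
    using sqn_add_le[of N "\<lambda>v. k (act ?A v)" "\<lambda>v. - k (act (?A * matL) v)"] by simp
  also have "sqn N (\<lambda>v. - k (act (?A * matL) v)) = ?\<delta>"
    using sqn_act[OF N lk SL2_times[OF matA_SL2 matL_SL2]] sk by (simp add: sqn_def)
  also have "sqn N (\<lambda>v. k (act ?A v)) = ?\<delta>" using sqn_act[OF N lk matA_SL2] sk by simp
  finally have 1: "4 * sqn N F \<le> 2 * ?\<delta>' + 8 * ?\<delta>" by simp
  have GS: "?G \<in> SL2" by (intro SL2_times SL2_adj2 matA_SL2 matL_SL2)
  have "disp N ?G f = sqn N (\<lambda>v. f (act ?G (act ?A v)) - f (act ?A v))"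
    unfolding disp_def using sqn_act[OF N lev_disp[OF f GS] matA_SL2] by simp
  also have "\<dots> = sqn N F"
  proof -
    have "act ?G (act ?A v) = act ?A (act matL v)" for v
      using act_adj2_SL2(1)[of ?A v] matA_SL2 by (simp add: SL2_def)
    then show ?thesis by (simp add: F_def[abs_def])
  qed
  finally have G: "disp N ?G f \<le> ?\<delta>' / 2 + 2 * ?\<delta>" using 1 by simp
  note t = disp_times[OF N f]
  have LS: "adj2 matL \<in> SL2" by (rule SL2_adj2[OF matL_SL2])
  have dL: "disp N (adj2 matL) f = ?\<delta>" by (rule disp_adj2[OF N f matL_SL2])
  have a1: "disp N (matL * matL) f \<le> 4 * ?\<delta>" using t[OF matL_SL2 matL_SL2] by simp
  have a2: "disp N (?G * (matL * matL)) f \<le> 2 * disp N ?G f + 8 * ?\<delta>"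
    using t[OF GS SL2_times[OF matL_SL2 matL_SL2]] a1 by linarith
  have a3: "disp N (adj2 matL * (?G * (matL * matL))) f \<le> 4 * disp N ?G f + 18 * ?\<delta>"
    using t[OF LS SL2_times[OF GS SL2_times[OF matL_SL2 matL_SL2]]] a2 dL by linarith
  have a4: "disp N (adj2 matU) f \<le> 8 * disp N ?G f + 38 * ?\<delta>"
    unfolding matU_conj
    using t[OF LS SL2_times[OF LS SL2_times[OF GS SL2_times[OF matL_SL2 matL_SL2]]]] a3 dL by linarith
  have "disp N matU f = disp N (adj2 matU) f" by (rule disp_adj2[OF N f matU_SL2, symmetric])
  moreover have "?\<delta> \<ge> 0" by (simp add: disp_def)
  ultimately show ?thesis using a4 G by linarith
qed

text \<open>One step detects only the displacement under \<open>matL\<close>, which has nonconstant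
  invariant functions; hence two steps. They lose
  \<open>4 * disp N matL f + disp N matL (Sop f)\<close> against 16 times the norm, and
  \<open>disp_matU_le\<close> reduces the gap to these two terms. The 67 is 66 + 1.\<close>

theorem semigroup_contraction:
  obtains \<rho> :: real where "1 \<le> \<rho>" "\<rho> < 16"
    "\<And>N f. N > 1 \<Longrightarrow> f \<in> lev0 N \<Longrightarrow> sqn N (Sop (Sop f)) \<le> \<rho> * sqn N f"
proof -
  obtain \<epsilon> :: real where \<epsilon>: "\<epsilon> > 0" and
    gap: "\<And>N f. N > 1 \<Longrightarrow> f \<in> lev0 N \<Longrightarrow> \<epsilon> * sqn N f \<le> disp N matL f + disp N matU f"
    using no_almost_invariant by blast
  \<comment> \<open>The maximum with 1 keeps the powers of \<rho> positive when the contraction is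
    iterated.\<close>
  define \<rho> where "\<rho> = max 1 (16 - \<epsilon> / 67)"
  have "sqn N (Sop (Sop f)) \<le> \<rho> * sqn N f" if N: "N > 1" and f: "f \<in> lev0 N" for N f
  proof -
    have N0: "N > 0" and lf: "lev N f" using N f by (auto simp: lev0_def)
    have d: "disp N matL f \<ge> 0" "disp N matL (Sop f) \<ge> 0" by (simp_all add: disp_def)
    have "sqn N (Sop (Sop f)) = 16 * sqn N f - (4 * disp N matL f + disp N matL (Sop f))"
      using sqn_Sop[OF N0 lev_Sop[OF lf]] sqn_Sop[OF N0 lf] by simp
    moreover have "\<epsilon> * sqn N f \<le> 67 * (4 * disp N matL f + disp N matL (Sop f))"
    proof -
      have "a \<le> 67 * (4 * D + E)" if "a \<le> D + U" "U \<le> 66 * D + 4 * E" "D \<ge> 0" "E \<ge> 0" for a D U E :: real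
      proof -
        have "67 * (4 * D + E) = 67 * D + 4 * E + (201 * D + 63 * E)" by simp
        moreover have "201 * D + 63 * E \<ge> 0" using that(3,4) by simp
        ultimately show ?thesis using that(1,2) by linarith
      qed
      from this[OF gap[OF N f] disp_matU_le[OF N0 lf] d] show ?thesis .
    qed
    ultimately have "sqn N (Sop (Sop f)) \<le> (16 - \<epsilon> / 67) * sqn N f"
      by (simp add: algebra_simps)
    also have "\<dots> \<le> \<rho> * sqn N f" unfolding \<rho>_def by (intro mult_right_mono) auto
    finally show ?thesis .
  qed
  moreover have "1 \<le> \<rho>" "\<rho> < 16" using \<epsilon> by (auto simp: \<rho>_def)
  ultimately show ?thesis using that by blast
qed

section \<open>From contraction to continued fractions\<close>

lemma Sop_power_word:
  assumes "(Sop ^^ n) f v > 0"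
  shows "\<exists>as. length as = n \<and> set as \<subseteq> {1, 2} \<and> f (act (prod_list (map matA as)) v) > 0"
  using assms
proof (induction n arbitrary: v)
  case 0
  then show ?case by (intro exI[of _ "[]"]) simp
next
  case (Suc n)
  then have "(Sop ^^ n) f (act (matA 1) v) + (Sop ^^ n) f (act (matA 2) v) > 0" by (simp only: Sop_funpow_Suc)
  then obtain a where a: "a \<in> {1, 2}" "(Sop ^^ n) f (act (matA a) v) > 0"
    by (metis add_nonpos_nonpos insertI1 insertI2 not_less singletonI)
  from Suc.IH[OF a(2)] obtain as where as: "length as = n" "set as \<subseteq> {1, 2}"
    "f (act (prod_list (map matA as)) (act (matA a) v)) > 0" by blast
  \<comment> \<open>The letter chosen in the outermost unfolding is the first to act on
    \<open>v\<close>, so it goes to the end of the list.\<close>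
  show ?case using as a(1) by (intro exI[of _ "as @ [a]"]) simp
qed

text \<open>The vector \<open>(0, 1)\<close> stands for the empty continued fraction 0. The
  conditions \<open>p \<ge> 0\<close> and \<open>q > 0\<close> are carried along so that no
  denominator vanishes and division never takes its default value.\<close>

lemma cfrac_word:
  assumes "set as \<subseteq> {1, 2}" "act (prod_list (map matA as)) (0, 1) = (p, q)"
  shows "p \<ge> 0 \<and> q > 0 \<and> cfrac (interleave_ones as) = of_int p / of_int q"
  using assms
proof (induction as arbitrary: p q)
  case Nil
  then show ?case by (simp add: interleave_ones_def)
next
  case (Cons a as)
  obtain p' q' where pq': "act (prod_list (map matA as)) (0, 1) = (p', q')"
    by (cases "act (prod_list (map matA as)) (0, 1)")
  have IH: "p' \<ge> 0" "q' > 0" "cfrac (interleave_ones as) = of_int p' / of_int q'"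
    using Cons.IH[OF _ pq'] Cons.prems(1) by auto
  have a: "a \<ge> 1" using Cons.prems(1) by auto
  have "act (matA a) (p', q') = (p, q)" using Cons.prems(2) pq' by simp
  then have pq: "p = p' + q'" "q = a * (p' + q') + q'"
    by (auto simp: matA_def act_def algebra_simps)
  have p: "p > 0" using pq IH by simp
  moreover have "a * p > 0" using a p by simp
  then have q: "q > 0" using pq IH by simp
  moreover have "cfrac (interleave_ones (a # as)) = of_int p / of_int q"
  proof -
    let ?x = "of_int p' / of_int q' :: rat"
    have q'0: "(of_int q' :: rat) > 0" and p0: "(of_int p :: rat) > 0" and q0: "(of_int q :: rat) > 0"
      using IH p q by simp_all
    have 1: "1 + ?x = of_int p / of_int q'" using q'0 pq by (simp add: field_simps)
    have "cfrac (interleave_ones (a # as)) = 1 / (of_int a + 1 / (1 + ?x))"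
      by (simp add: interleave_ones_def[of "a # as"] IH(3)[unfolded interleave_ones_def])
    also have "\<dots> = 1 / (of_int a + of_int q' / of_int p)" by (simp add: 1)
    also have "of_int a + of_int q' / of_int p = (of_int q / of_int p :: rat)"
      using p0 pq by (simp add: field_simps)
    finally show ?thesis by simp
  qed
  ultimately show ?case by simp
qed

text \<open>Lying on the line of \<open>(u, 1)\<close> means that \<open>p\<close> is
  \<open>u * q\<close> modulo \<open>N\<close>. A common divisor of \<open>q\<close> and
  \<open>N\<close> would then divide \<open>p\<close> as well, against primitivity, so
  \<open>q\<close> is invertible.\<close>

lemma rat_cong_word:
  assumes N: "N > 0" and as: "set as \<subseteq> {1, 2}" and pq: "act (prod_list (map matA as)) (0, 1) = (p, q)"
    and prm: "prim N (p, q)" and c: "N dvd cross (u, 1) (p, q)"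
  shows "rat_cong (cfrac (interleave_ones as)) u N"
proof -
  have w: "q > 0" "cfrac (interleave_ones as) = of_int p / of_int q" using cfrac_word[OF as pq] by auto
  have puq: "[p = u * q] (mod N)"
    using c by (simp add: cross_def cong_iff_dvd_diff dvd_diff_commute)
  have cop: "coprime q N"
  proof (rule coprimeI)
    fix d assume d: "d dvd q" "d dvd N"
    have "[p = u * q] (mod d)" using puq d(2) by (rule cong_dvd_modulus)
    then have "d dvd p" using d(1) cong_dvd_iff by fastforce
    then show "is_unit d" using primD[OF prm, of d] d by simp
  qed
  have "[q * modular_inverse N q = 1] (mod N)"
    using cong_modular_inverse1[of q N] cop by simp
  then have "[u * (q * modular_inverse N q) = u * 1] (mod N)" by (rule cong_scalar_left)
  moreover have "[p * modular_inverse N q = u * q * modular_inverse N q] (mod N)"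
    using puq by (rule cong_scalar_right)
  ultimately have "[p * modular_inverse N q = u] (mod N)"
    by (metis cong_trans mult.assoc mult.right_neutral)
  with w cop show ?thesis unfolding rat_cong_def by (intro exI[of _ p] exI[of _ q]) auto
qed

text \<open>The iterated operator, applied to the indicator of the line of \<open>(u, 1)\<close> and
  evaluated at \<open>(0, 1)\<close>, counts the words that reach this line. The constant part
  contributes \<open>4^j * \<kappa>\<close>, at least \<open>4^j / N^2\<close>; the square of the
  mean-zero part is at most \<open>\<rho>^j * N^2\<close>. The hypothesis with \<open>N^6\<close>
  lets the former win.\<close>

lemma exists_word:
  assumes N: "N > 1" and \<rho>: "1 \<le> \<rho>"
    and contr: "\<And>f. f \<in> lev0 N \<Longrightarrow> sqn N (Sop (Sop f)) \<le> \<rho> * sqn N f"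
    and j: "real_of_int N ^ 6 * \<rho> ^ j < 16 ^ j"
  shows "\<exists>as. length as = 2 * j \<and> set as \<subseteq> {1, 2} \<and> rat_cong (cfrac (interleave_ones as)) u N"
proof -
  have N0: "N > 0" using N by simp
  define f1 where "f1 v = (if prim N v \<and> N dvd cross (u, 1) v then 1 else 0 :: real)" for v
  define one where "one v = (if prim N v then 1 else 0 :: real)" for v
  \<comment> \<open>The proportion of primitive vectors that lie on the line of
    \<open>(u, 1)\<close>, so that \<open>f0\<close> has sum zero.\<close>
  define \<kappa> where "\<kappa> = real (ph N) / real (card (pvec N))"
  define f0 where "f0 v = 1 * f1 v + (- \<kappa>) * one v" for v
  have pu: "prim N (u, 1)" by (rule prim_unit_right) simp
  have l1: "lev N f1" unfolding lev_def
  proof (intro conjI allI impI)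
    fix v w assume vw: "prim N v" "prim N w" "N dvd cross v w"
    have "N dvd cross (u, 1) v \<longleftrightarrow> N dvd cross (u, 1) w"
      using cross_dvd_transfer[OF vw, of "(u, 1)"] dvd_cross_swap by blast
    then show "f1 v = f1 w" using vw by (simp add: f1_def)
  qed (simp add: f1_def)
  have lo: "lev N one" unfolding lev_def by (simp add: one_def)
  have l0: "lev N f0" unfolding f0_def[abs_def] by (rule lev_lincomb[OF l1 lo])
  have sum1: "(\<Sum>v\<in>pvec N. f1 v) = real (ph N)"
  proof -
    have "(\<Sum>v\<in>pvec N. f1 v) = (\<Sum>v\<in>{v \<in> pvec N. N dvd cross (u, 1) v}. 1)"
      unfolding sum.inter_filter[OF finite_pvec]
      by (intro sum.cong refl) (auto simp: f1_def pvec_def)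
    then show ?thesis using card_line[OF N0 pu] by simp
  qed
  have sumo: "(\<Sum>v\<in>pvec N. one v) = real (card (pvec N))"
  proof -
    have "(\<Sum>v\<in>pvec N. one v) = (\<Sum>v\<in>pvec N. 1)" by (intro sum.cong refl) (simp add: one_def pvec_def)
    then show ?thesis by simp
  qed
  have "vmod N (u, 1) \<in> pvec N" using N0 pu by (rule vmod_in_pvec)
  then have "card (pvec N) > 0" using finite_pvec card_gt_0_iff by blast
  then have cV: "real (card (pvec N)) > 0" by (simp only: of_nat_0_less_iff)
  have "(\<Sum>v\<in>pvec N. f0 v) = (\<Sum>v\<in>pvec N. f1 v) + (- \<kappa>) * (\<Sum>v\<in>pvec N. one v)"
    unfolding f0_def sum.distrib sum_distrib_left by simp
  also have "\<dots> = 0"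
  proof -
    have "a + - (a / b) * b = 0" if "b > 0" for a b :: real using that by simp
    from this[OF cV, of "real (ph N)"] show ?thesis unfolding sum1 sumo \<kappa>_def .
  qed
  finally have f00: "f0 \<in> lev0 N" using l0 by (simp add: lev0_def)
  have cV2: "real (card (pvec N)) \<le> real_of_int N ^ 2"
  proof -
    have "card (pvec N) \<le> card ({0..<N} \<times> {0..<N})" unfolding pvec_def by (intro card_mono) auto
    also have "\<dots> = nat N * nat N" by (simp add: card_cartesian_product)
    finally have "real (card (pvec N)) \<le> real (nat N * nat N)" by (simp only: of_nat_le_iff)
    then show ?thesis using N0 by (simp add: power2_eq_square)
  qed
  have \<kappa>1: "\<kappa> \<le> 1"
  proof -
    have "(\<Sum>v\<in>pvec N. f1 v) \<le> (\<Sum>v\<in>pvec N. one v)" by (intro sum_mono) (simp add: f1_def one_def)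
    then have "real (ph N) \<le> real (card (pvec N))" by (simp only: sum1 sumo)
    then show ?thesis unfolding \<kappa>_def using cV by (simp only: divide_le_eq_1_pos)
  qed
  have \<kappa>0: "\<kappa> \<ge> 1 / real_of_int N ^ 2"
  proof -
    have "1 \<le> real (ph N)" using ph_pos[OF N0] by simp
    then show ?thesis unfolding \<kappa>_def using cV cV2 by (intro frac_le) auto
  qed
  have N2: "1 / real_of_int N ^ 2 > 0" using N0 by simp
  have "sqn N f0 \<le> (\<Sum>v\<in>pvec N. 1)" unfolding sqn_def
  proof (rule sum_mono)
    fix v
    have "0 \<le> \<kappa>" using \<kappa>0 N2 by linarith
    then have "\<bar>f0 v\<bar> \<le> 1" using \<kappa>1 by (auto simp: f0_def f1_def one_def)
    then show "(f0 v)\<^sup>2 \<le> 1" using abs_square_le_1 by blast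
  qed
  then have sq0: "sqn N f0 \<le> real_of_int N ^ 2" using cV2 by simp
  have iter: "(Sop ^^ (2 * i)) f0 \<in> lev0 N \<and> sqn N ((Sop ^^ (2 * i)) f0) \<le> \<rho> ^ i * sqn N f0" for i
  proof (induction i)
    case 0
    then show ?case using f00 by simp
  next
    case (Suc i)
    let ?g = "(Sop ^^ (2 * i)) f0"
    have e: "(Sop ^^ (2 * Suc i)) f0 = Sop (Sop ?g)" by simp
    have g: "?g \<in> lev0 N" "sqn N ?g \<le> \<rho> ^ i * sqn N f0" using Suc.IH by auto
    have "sqn N (Sop (Sop ?g)) \<le> \<rho> * sqn N ?g" by (rule contr[OF g(1)])
    also have "\<dots> \<le> \<rho> * (\<rho> ^ i * sqn N f0)" using g(2) \<rho> by (intro mult_left_mono) auto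
    finally show ?case unfolding e using Sop_lev0[OF N0 Sop_lev0[OF N0 g(1)]] by (simp add: mult_ac)
  qed
  have Slin: "(Sop ^^ n) f0 v = (Sop ^^ n) f1 v - \<kappa> * (Sop ^^ n) one v" for n v
  proof (induction n arbitrary: v)
    case 0
    show ?case by (simp add: f0_def)
  next
    case (Suc n)
    show ?case unfolding Sop_funpow_Suc Suc.IH by (simp add: algebra_simps)
  qed
  have Sone: "(Sop ^^ n) one v = 2 ^ n" if "prim N v" for n v
    using that
  proof (induction n arbitrary: v)
    case (Suc n)
    have "prim N (act (matA a) v)" for a using Suc.prems matA_SL2 SL2_coprime prim_act by blast
    then show ?case unfolding Sop_funpow_Suc using Suc.IH by simp
  qed (simp add: one_def)
  let ?v = "(0, 1) :: vec2"
  have pv: "prim N ?v" by (rule prim_unit_right) simp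
  let ?g = "(Sop ^^ (2 * j)) f0"
  have "(?g ?v)\<^sup>2 \<le> sqn N ?g" using iter[of j] by (intro lev_bound[OF N0]) (auto simp: lev0_def)
  also have "\<dots> \<le> \<rho> ^ j * real_of_int N ^ 2"
  proof -
    have "\<rho> ^ j * sqn N f0 \<le> \<rho> ^ j * real_of_int N ^ 2" using sq0 \<rho> by (intro mult_left_mono) auto
    then show ?thesis using iter[of j] by linarith
  qed
  also have "\<dots> < (4 ^ j * (1 / real_of_int N ^ 2))\<^sup>2"
  proof -
    have "(4 ^ j * (1 / real_of_int N ^ 2))\<^sup>2 = 16 ^ j / real_of_int N ^ 4"
      by (simp add: power_mult_distrib power_divide power_mult[symmetric] mult.commute[of j 2])
         (simp add: power_mult)
    moreover have "\<rho> ^ j * real_of_int N ^ 2 * real_of_int N ^ 4 < 16 ^ j"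
      using j by (simp add: mult_ac flip: power_add)
    ultimately show ?thesis using N0 by (simp add: pos_less_divide_eq)
  qed
  finally have "\<bar>?g ?v\<bar> < 4 ^ j * (1 / real_of_int N ^ 2)"
    by (rule power2_less_imp_less[of "\<bar>?g ?v\<bar>", simplified power2_abs]) (use N2 in simp)
  also have "\<dots> \<le> 4 ^ j * \<kappa>" using \<kappa>0 by (intro mult_left_mono) auto
  finally have lt: "\<bar>?g ?v\<bar> < 4 ^ j * \<kappa>" .
  have "(2::real) ^ (2 * j) = 4 ^ j" by (simp add: power_mult)
  then have "?g ?v = (Sop ^^ (2 * j)) f1 ?v - 4 ^ j * \<kappa>"
    unfolding Slin Sone[OF pv] by simp
  with lt have "(Sop ^^ (2 * j)) f1 ?v > 0" by linarith
  from Sop_power_word[OF this] obtain as where as: "length as = 2 * j" "set as \<subseteq> {1, 2}"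
    "f1 (act (prod_list (map matA as)) ?v) > 0" by blast
  obtain p q where pq: "act (prod_list (map matA as)) ?v = (p, q)" by (cases "act (prod_list (map matA as)) ?v")
  have "prim N (p, q)" "N dvd cross (u, 1) (p, q)"
    using as(3) by (auto simp: pq f1_def split: if_splits)
  then have "rat_cong (cfrac (interleave_ones as)) u N"
    using N0 as(2) pq by (intro rat_cong_word)
  with as show ?thesis by blast
qed

theorem theorem1p5:
  shows "\<exists>(C::real) (N0::int). C > 0 \<and>
    (\<forall>N\<ge>N0. \<forall>u::int. 0 \<le> u \<and> u < N \<longrightarrow>
      (\<exists>as :: int list. real (length as) \<le> C * log 2 (real_of_int N) \<and>
        set as \<subseteq> {1, 2} \<and> rat_cong (cfrac (interleave_ones as)) u N))"
proof -
  obtain \<rho> :: real where \<rho>: "1 \<le> \<rho>" "\<rho> < 16" and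
    contr: "\<And>N f. N > 1 \<Longrightarrow> f \<in> lev0 N \<Longrightarrow> sqn N (Sop (Sop f)) \<le> \<rho> * sqn N f"
    using semigroup_contraction by blast
  \<comment> \<open>The gain in bits per double step: \<open>j\<close> double steps gain
    \<open>(16 / \<rho>)^j = 2 powr (s * j)\<close>, which must exceed \<open>N^6\<close>.\<close>
  define s where "s = log 2 (16 / \<rho>)"
  have s: "s > 0" using \<rho> by (simp add: s_def)
  have main: "\<exists>as :: int list. real (length as) \<le> (12 / s + 4) * log 2 (real_of_int N) \<and>
      set as \<subseteq> {1, 2} \<and> rat_cong (cfrac (interleave_ones as)) u N" if N: "N \<ge> 2" for N u :: int
  proof -
    define l where "l = log 2 (real_of_int N)"
    have l: "l \<ge> 1" using N by (simp add: l_def)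
    \<comment> \<open>Strictly more than \<open>6 * l / s\<close>, hence the \<open>+ 1\<close>. A
      word has \<open>2 * j\<close> letters, and the surplus of 2 is absorbed because
      \<open>l \<ge> 1\<close>.\<close>
    define j where "j = nat \<lfloor>6 * l / s\<rfloor> + 1"
    have "6 * l / s \<ge> 0" using l s by simp
    then have j1: "real j > 6 * l / s" and j2: "real j \<le> 6 * l / s + 1"
      unfolding j_def by linarith+
    have "real_of_int N ^ 6 = 2 powr (6 * l)"
    proof -
      have "2 powr l = real_of_int N" using N by (simp add: l_def)
      then show ?thesis using N by (simp add: powr_powr[symmetric] mult.commute[of 6])
    qed
    also have "\<dots> < 2 powr (s * real j)" using j1 s by (simp add: field_simps)
    also have "\<dots> = (16 / \<rho>) ^ j"
    proof -
      have "2 powr s = 16 / \<rho>" using \<rho> by (simp add: s_def)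
      then show ?thesis using \<rho> by (simp add: powr_powr[symmetric] powr_realpow)
    qed
    finally have "real_of_int N ^ 6 * \<rho> ^ j < 16 ^ j"
      using \<rho> by (simp add: power_divide pos_less_divide_eq)
    then obtain as where as: "length as = 2 * j" "set as \<subseteq> {1, 2}" "rat_cong (cfrac (interleave_ones as)) u N"
      using exists_word[of N \<rho> j u] N \<rho>(1) contr[of N] by auto
    have "real (length as) \<le> 12 * l / s + 2" using as(1) j2 by simp
    also have "\<dots> \<le> (12 / s + 4) * l" using l by (simp add: algebra_simps)
    finally show ?thesis using as(2,3) unfolding l_def by blast
  qed
  have "12 / s + 4 > 0" using s by (simp add: add_pos_pos)
  then show ?thesis using main by (intro exI[of _ "12 / s + 4"] exI[of _ 2]) auto
qed

end
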